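(* Let $U$ be a sunshine graph and $T$ a caterpillar of order $n\ge 12$ with $b(U,T)\ge 5$, and let $U^+$ be a sunshine supercard of $U$ and $T$ (with $w,v$, labelling and $\chi$ as in the context) chosen so that $\chi(U^+)$ is largest possible among all sunshine supercards of $U$ and $T$. Suppose that $B_U\ne\mathrm{Aut}(U^+)$. Then $b(U,T)\le 2\left\lfloor\sqrt{2n+1}\right\rfloor+3$.
   Context: All graphs are finite and simple. The deck of $G$ is the multiset of unlabelled cards $G-v$; $b(G,H)$ is the cardinality of the multiset intersection of the decks. The skeleton of a graph is obtained by deleting all vertices of degree $0$ or $1$; sunshine graph: connected, skeleton a cycle; caterpillar: connected, skeleton a path. A supercard of $U$ and $T$ is a graph of order $n+1$ whose deck contains cards isomorphic to $U$ and to $T$. For a sunshine supercard $U^+$, fix $w,v$ with $U^+-w\cong U$, $U^+-v\cong T$ ($w$ a leaf, $v$ a degree-2 cycle vertex); identify $U=U^+-w$, $T=U^+-v$. Label the cycle $x_0\ldots x_{c-1}x_0$ (indices mod $c$) with $x_0$ adjacent to $w$, $v=x_\nu$, $d_{U^+}(x_{\nu-1})\ge d_{U^+}(x_{\nu+1})$. Write $\lambda(G)=H$ if the bijection $\lambda$ is an isomorphism from $G$ onto $H$. $B_{vw}(U^+)=\{\lambda\in\mathrm{Sym}(V(U^+)):\lambda(U-\lambda^{-1}(v))=T-\lambda(w)\}$, $B_U=\{\lambda\in B_{vw}(U^+):\lambda(U)=U^+-\lambda(w)\}$ (note $\mathrm{Aut}(U^+)\subseteq B_U$). A maximum saturating set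 is $X\subseteq B_{vw}(U^+)$ with: the identity in $X$; distinct $\lambda,\pi\in X$ have $\lambda^{-1}(v)\ne\pi^{-1}(v)$ and $\lambda(w)\ne\pi(w)$; and no $\sigma\in B_{vw}(U^+)\setminus X$ can be added keeping the previous property. $\chi(U^+)=\max|X\cap B_U|$ over maximum saturating sets $X$. *)

theory Defs
  imports
    Complex_Main
    "HOL-Library.Multiset"
    "HOL-Combinatorics.Permutations"
    "Graph_Theory.Digraph_Isomorphism"
begin

text \<open>
  A finite simple graph is a \<^const>\<open>pair_graph\<close>: a finite vertex set together with a symmetric
  irreflexive relation of arcs, so that every edge is present as two opposite arcs and the degree
  of a vertex is its out-degree.
\<close>

abbreviation vdegree :: "'a pair_pre_digraph \<Rightarrow> 'a \<Rightarrow> nat" where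
  "vdegree G v \<equiv> out_degree (with_proj G) v"

definition delete_verts :: "'a pair_pre_digraph \<Rightarrow> 'a set \<Rightarrow> 'a pair_pre_digraph" where
  "delete_verts G S =
     \<lparr> pverts = pverts G - S, parcs = {e \<in> parcs G. fst e \<notin> S \<and> snd e \<notin> S} \<rparr>"

abbreviation delete_vert :: "'a pair_pre_digraph \<Rightarrow> 'a \<Rightarrow> 'a pair_pre_digraph" where
  "delete_vert G v \<equiv> delete_verts G {v}"

abbreviation isomorphic :: "'a pair_pre_digraph \<Rightarrow> 'b pair_pre_digraph \<Rightarrow> bool" where
  "isomorphic G H \<equiv> digraph_iso (with_proj G) (with_proj H)"

definition relabel :: "('a \<Rightarrow> 'b) \<Rightarrow> 'a pair_pre_digraph \<Rightarrow> 'b pair_pre_digraph" where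
  "relabel f G = \<lparr> pverts = f ` pverts G, parcs = map_prod f f ` parcs G \<rparr>"

text \<open>For injective \<open>f\<close>, the equation \<open>relabel f G = H\<close> says that \<open>f\<close> is an isomorphism from
  \<open>G\<close> onto \<open>H\<close>:\<close>

lemma isomorphic_iff_relabel:
  assumes "pair_wf_digraph G"
  shows "isomorphic G H \<longleftrightarrow> (\<exists>f. inj_on f (pverts G) \<and> relabel f G = H)"
proof
  assume "isomorphic G H"
  then obtain h where h: "pre_digraph.digraph_isomorphism (with_proj G) h"
      and H: "with_proj H = app_iso h (with_proj G)"
    unfolding digraph_iso_def by blast
  let ?f = "iso_verts h"
  have tl: "iso_tail h = fst" and hd: "iso_head h = snd"
    and pv: "pverts H = ?f ` pverts G" and pa: "parcs H = iso_arcs h ` parcs G"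
    using H by (auto simp: app_iso_def with_proj_def)
  have inj: "inj_on ?f (pverts G)"
    using h by (simp add: pre_digraph.digraph_isomorphism_def)
  have "iso_arcs h e = map_prod ?f ?f e" if "e \<in> parcs G" for e
    using h that tl hd by (auto simp: pre_digraph.digraph_isomorphism_def prod_eq_iff)
  then have "parcs H = map_prod ?f ?f ` parcs G"
    using pa by (auto simp: image_iff)
  then have "relabel ?f G = H"
    using pv by (simp add: relabel_def)
  then show "\<exists>f. inj_on f (pverts G) \<and> relabel f G = H"
    using inj by blast
next
  assume "\<exists>f. inj_on f (pverts G) \<and> relabel f G = H"
  then obtain f where f: "inj_on f (pverts G)" "relabel f G = H" by blast
  let ?h = "\<lparr> iso_verts = f, iso_arcs = map_prod f f, iso_head = snd, iso_tail = fst \<rparr>"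
  have sub: "parcs G \<subseteq> pverts G \<times> pverts G"
    using assms by (auto dest: pair_wf_digraph.wellformed')
  have "inj_on (map_prod f f) (parcs G)"
    using map_prod_inj_on[OF f(1) f(1)] sub by (rule inj_on_subset)
  then have "pre_digraph.digraph_isomorphism (with_proj G) ?h"
    using f assms by (auto simp: pre_digraph.digraph_isomorphism_def wf_digraph_wp_iff)
  moreover have "with_proj H = app_iso ?h (with_proj G)"
    using f(2) by (auto simp: app_iso_def relabel_def with_proj_def)
  ultimately show "isomorphic G H"
    unfolding digraph_iso_def by blast
qed


subsection \<open>Decks\<close>

text \<open>An unlabelled graph is an isomorphism class. Every finite graph has a copy with vertices in
  \<^typ>\<open>nat\<close>, so the classes are taken there; this makes graphs over different vertex types
  comparable.\<close>

definition unlabelled :: "'a pair_pre_digraph \<Rightarrow> nat pair_pre_digraph set" where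
  "unlabelled G = {H. isomorphic G H}"

definition deck :: "'a pair_pre_digraph \<Rightarrow> nat pair_pre_digraph set multiset" where
  "deck G = image_mset (\<lambda>v. unlabelled (delete_vert G v)) (mset_set (pverts G))"

definition common_cards :: "'a pair_pre_digraph \<Rightarrow> 'b pair_pre_digraph \<Rightarrow> nat" where
  "common_cards G H = size (deck G \<inter># deck H)"


subsection \<open>Sunshine graphs and caterpillars\<close>

definition skeleton :: "'a pair_pre_digraph \<Rightarrow> 'a pair_pre_digraph" where
  "skeleton G = delete_verts G {v \<in> pverts G. vdegree G v \<le> 1}"

definition cycle_labelling :: "'a pair_pre_digraph \<Rightarrow> nat \<Rightarrow> (nat \<Rightarrow> 'a) \<Rightarrow> bool" where
  "cycle_labelling C c x \<longleftrightarrow> 3 \<le> c \<and> bij_betw x {..<c} (pverts C) \<and>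
     parcs C = {(x i, x (Suc i mod c)) | i. i < c} \<union> {(x (Suc i mod c), x i) | i. i < c}"

definition path_labelling :: "'a pair_pre_digraph \<Rightarrow> nat \<Rightarrow> (nat \<Rightarrow> 'a) \<Rightarrow> bool" where
  "path_labelling P k x \<longleftrightarrow> 1 \<le> k \<and> bij_betw x {..<k} (pverts P) \<and>
     parcs P = {(x i, x (Suc i)) | i. Suc i < k} \<union> {(x (Suc i), x i) | i. Suc i < k}"

definition sunshine :: "'a pair_pre_digraph \<Rightarrow> bool" where
  "sunshine G \<longleftrightarrow> pair_graph G \<and> Digraph_Component.connected (with_proj G) \<and>
     (\<exists>c x. cycle_labelling (skeleton G) c x)"

definition caterpillar :: "'a pair_pre_digraph \<Rightarrow> bool" where
  "caterpillar G \<longleftrightarrow> pair_graph G \<and> Digraph_Component.connected (with_proj G) \<and>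
     (\<exists>k x. path_labelling (skeleton G) k x)"


subsection \<open>Supercards\<close>

definition supercard ::
  "'a pair_pre_digraph \<Rightarrow> 'b pair_pre_digraph \<Rightarrow> 'c pair_pre_digraph \<Rightarrow> bool" where
  "supercard U T W \<longleftrightarrow> pair_graph W \<and> card (pverts W) = card (pverts U) + 1 \<and>
     (\<exists>w \<in> pverts W. isomorphic (delete_vert W w) U) \<and>
     (\<exists>v \<in> pverts W. isomorphic (delete_vert W v) T)"

text \<open>A sunshine supercard \<open>W\<close> together with all the data fixed along with it: the vertices \<open>w\<close> and
  \<open>v\<close> whose deletion gives \<open>U\<close> and \<open>T\<close>, and a labelling of the cycle. The term \<open>\<nu> + c - 1\<close> is
  \<open>\<nu> - 1\<close> modulo \<open>c\<close>. All supercards of \<open>U\<close> and \<open>T\<close> have the same order, so once one exists over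
  the type \<open>'c\<close>, each of them has a copy over \<open>'c\<close>, and comparing \<open>chi\<close> over \<open>'c\<close> compares all of
  them.\<close>

definition sunshine_supercard ::
  "'a pair_pre_digraph \<Rightarrow> 'b pair_pre_digraph \<Rightarrow> 'c pair_pre_digraph \<Rightarrow>
   'c \<Rightarrow> 'c \<Rightarrow> nat \<Rightarrow> (nat \<Rightarrow> 'c) \<Rightarrow> nat \<Rightarrow> bool" where
  "sunshine_supercard U T W w v c x \<nu> \<longleftrightarrow> sunshine W \<and> supercard U T W \<and>
     w \<in> pverts W \<and> vdegree W w = 1 \<and> isomorphic (delete_vert W w) U \<and>
     v \<in> pverts (skeleton W) \<and> vdegree W v = 2 \<and> isomorphic (delete_vert W v) T \<and>
     cycle_labelling (skeleton W) c x \<and> (x 0, w) \<in> parcs W \<and>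
     \<nu> < c \<and> v = x \<nu> \<and>
     vdegree W (x ((\<nu> + c - 1) mod c)) \<ge> vdegree W (x ((\<nu> + 1) mod c))"


subsection \<open>Saturating sets\<close>

text \<open>In this part \<open>W\<close> is the supercard, and \<open>U\<close> and \<open>T\<close> are identified with \<open>delete_vert W w\<close> and
  \<open>delete_vert W v\<close>. The symmetric group on \<open>pverts W\<close> consists of the functions that permute
  \<open>pverts W\<close> and fix everything outside it.\<close>

definition B_vw :: "'a pair_pre_digraph \<Rightarrow> 'a \<Rightarrow> 'a \<Rightarrow> ('a \<Rightarrow> 'a) set" where
  "B_vw W w v = {l. l permutes pverts W \<and>
     relabel l (delete_vert (delete_vert W w) (inv l v)) = delete_vert (delete_vert W v) (l w)}"

definition B_U :: "'a pair_pre_digraph \<Rightarrow> 'a \<Rightarrow> 'a \<Rightarrow> ('a \<Rightarrow> 'a) set" where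
  "B_U W w v = {l \<in> B_vw W w v. relabel l (delete_vert W w) = delete_vert W (l w)}"

definition automorphisms :: "'a pair_pre_digraph \<Rightarrow> ('a \<Rightarrow> 'a) set" where
  "automorphisms G = {l. l permutes pverts G \<and> relabel l G = G}"

definition separated :: "'a \<Rightarrow> 'a \<Rightarrow> ('a \<Rightarrow> 'a) set \<Rightarrow> bool" where
  "separated w v X \<longleftrightarrow>
     (\<forall>l \<in> X. \<forall>p \<in> X. l \<noteq> p \<longrightarrow> inv l v \<noteq> inv p v \<and> l w \<noteq> p w)"

definition max_saturating :: "'a pair_pre_digraph \<Rightarrow> 'a \<Rightarrow> 'a \<Rightarrow> ('a \<Rightarrow> 'a) set \<Rightarrow> bool" where
  "max_saturating W w v X \<longleftrightarrow> X \<subseteq> B_vw W w v \<and> id \<in> X \<and> separated w v X \<and>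
     \<not> (\<exists>s \<in> B_vw W w v - X. separated w v (insert s X))"

definition chi :: "'a pair_pre_digraph \<Rightarrow> 'a \<Rightarrow> 'a \<Rightarrow> nat" where
  "chi W w v = Max {card (X \<inter> B_U W w v) | X. max_saturating W w v X}"

end

theory Submission
  imports Defs
begin

text \<open>A supercard is encoded by the cyclic word \<open>d\<close> of its degrees along the cycle, and \<open>U\<close> by
  the word \<open>u\<close> that is one smaller at the position of \<open>w\<close>. All but four of the common cards come from
  a cycle vertex of degree two of \<open>U\<close> and a leaf of \<open>T\<close> whose neighbour has degree at least three; such
  a card says that a rotated or reflected copy of \<open>u\<close> becomes, after adding one at a single
  position, one of at most two words that depend on \<open>T\<close> only.

  If \<open>u\<close> has a nontrivial period, that position is determined by the completion used. The number
  of cards for one completion is then at most twice the number of periods, and also at most the degree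
  at that position. All periods translate that position to others of the same degree, so \<open>n\<close> is at
  least the product of these two quantities, and the number of cards is \<open>O(sqrt n)\<close>.

  If \<open>u\<close> has no period, ten cards contain three with the same completion and orientation.
  Commuting the corresponding rotations shows that the three of them add their leaf at the same vertex of
  the cycle, so moving \<open>w\<close> there gives a supercard with a rotation of order at least three. Its
  \<^const>\<open>chi\<close> is at least three. But a supercard with \<^const>\<open>B_U\<close> larger than its automorphism group
  has no rotational symmetry, so \<open>w\<close> was attached elsewhere, and then \<^const>\<open>chi\<close> is at most two,
  against the choice of the supercard.\<close>

subsection \<open>Cyclic words\<close>

text \<open>Why only four cards are exceptional: if \<open>U - a\<close> and \<open>T - b\<close>
  are isomorphic, counting edges gives \<open>deg a = deg b + 1\<close>, and counting isolated
  vertices then leaves \<open>b\<close> exactly one neighbour of degree at least two. So a nonleaf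
  \<open>b\<close> is one of the two ends of the core of \<open>T\<close>, and a leaf
  \<open>b\<close> at a vertex of degree two hangs at such an end. Why two completions: cutting the
  cycle may turn a neighbour of the cut vertex into a leaf on one side and not on the other, which
  shifts the two words against each other by one place. The orientation of the labelling excludes
  one direction of this shift. The constants, with \<open>s\<close> the floor of the root: two
  completions with at most \<open>s\<close> cards each and four exceptional cards allow 2s + 4, and
  the last unit is gained by refuting equality. From \<open>12 <= n\<close> follows
  \<open>5 <= s\<close>, so a counterexample has at least 14 common cards. At least ten of them are
  unexceptional, more than twice the four combinations of completion and orientation. Periods of
  order two are the obstacle throughout: four marks can cancel in pairs under a half turn. Hence the
  condition that \<open>c\<close> does not divide \<open>2 * r\<close>.\<close>

definition mark :: "int \<Rightarrow> int \<Rightarrow> int \<Rightarrow> int" where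
  "mark c y i = of_bool (c dvd i - y)"

lemma mark_range: "0 \<le> mark c y i" "mark c y i \<le> 1"
  by (auto simp: mark_def)

lemma mark_eq_1_iff: "mark c y i = 1 \<longleftrightarrow> c dvd i - y"
  by (auto simp: mark_def)

lemma mark_cong: "c dvd a - b \<Longrightarrow> mark c a i = mark c b i"
proof -
  assume "c dvd a - b"
  then have "c dvd (i - a) + (a - b) \<longleftrightarrow> c dvd i - a"
    by (rule dvd_add_left_iff)
  then show ?thesis by (simp add: mark_def)
qed

text \<open>If the classes of \<open>a\<close> and \<open>b\<close> differed, the difference would
  be 1 at \<open>a\<close> and by periodicity also at \<open>a + r\<close>, but the marks allow the
  value 1 in the class of \<open>a\<close> only.\<close>

lemma periodic_difference_two_marks:
  assumes h: "\<And>i. f i - g i = mark c a i - mark c b i"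
    and f: "\<And>i. f (i + r) = f i" and g: "\<And>i. g (i + r) = g i" and r: "\<not> c dvd r"
  shows "c dvd a - b"
proof (rule ccontr)
  assume "\<not> c dvd a - b"
  then have "f a - g a = 1" using h[of a] by (simp add: mark_def)
  then have "f (a + r) - g (a + r) = 1" using f g by simp
  then have "mark c a (a + r) = 1"
    using h[of "a + r"] mark_range[of c a "a + r"] mark_range[of c b "a + r"] by linarith
  then show False using r by (simp add: mark_eq_1_iff)
qed

text \<open>Once one pair of marks cancels, the two-mark lemma settles the other pair. Without
  cancellation the difference is positive at \<open>a\<close>, \<open>a + r\<close> and
  \<open>a + 2 r\<close>. These are three classes because \<open>c\<close> does not divide
  \<open>2 * r\<close>, while only the classes of \<open>a\<close> and \<open>b\<close> can be
  positive. Under a half turn the claim can fail, with \<open>b = a + r\<close> and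
  \<open>b' = a' + r\<close>.\<close>

lemma periodic_difference_four_marks:
  assumes h: "\<And>i. f i - g i = mark c a i + mark c b i - mark c a' i - mark c b' i"
    and f: "\<And>i. f (i + r) = f i" and g: "\<And>i. g (i + r) = g i" and r: "\<not> c dvd 2 * r"
  shows "c dvd a - a' \<and> c dvd b - b' \<or> c dvd a - b' \<and> c dvd b - a'"
proof -
  have r1: "\<not> c dvd r" using r by auto
  have two: "c dvd x - y" if "\<And>i. f i - g i = mark c x i - mark c y i" for x y
    using periodic_difference_two_marks[OF that f g r1] by simp
  show ?thesis
  proof (cases "c dvd a - a' \<or> c dvd a - b' \<or> c dvd b - a' \<or> c dvd b - b'")
    case True
    then consider (1) "c dvd a - a'" | (2) "c dvd a - b'" | (3) "c dvd b - a'" | (4) "c dvd b - b'"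
      by blast
    then show ?thesis
    proof cases
      case 1
      have "c dvd b - b'" by (rule two) (simp add: h mark_cong[OF 1])
      then show ?thesis using 1 by blast
    next
      case 2
      have "c dvd b - a'" by (rule two) (simp add: h mark_cong[OF 2])
      then show ?thesis using 2 by blast
    next
      case 3
      have "c dvd a - b'" by (rule two) (simp add: h mark_cong[OF 3])
      then show ?thesis using 3 by blast
    next
      case 4
      have "c dvd a - a'" by (rule two) (simp add: h mark_cong[OF 4])
      then show ?thesis using 4 by blast
    qed
  next
    case False
    have pos: "c dvd i - a \<or> c dvd i - b" if "f i - g i \<ge> 1" for i
    proof (rule ccontr)
      assume "\<not> ?thesis"
      then have "mark c a i = 0" "mark c b i = 0" by (auto simp: mark_def)
      then show False using that h[of i] mark_range[of c a' i] mark_range[of c b' i] by linarith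
    qed
    have "f a - g a \<ge> 1"
      using h[of a] False mark_range[of c b a] by (simp add: mark_def)
    then have p: "f (a + r) - g (a + r) \<ge> 1" "f (a + r + r) - g (a + r + r) \<ge> 1"
      unfolding f g by simp_all
    have 1: "c dvd a + r - b" using pos[OF p(1)] r1 by auto
    have "c dvd (a + r + r) - b" using pos[OF p(2)] r by (auto simp: algebra_simps)
    then have "c dvd ((a + r + r) - b) - (a + r - b)" using 1 by (rule dvd_diff)
    then show ?thesis using r1 by simp
  qed
qed

text \<open>Rotations commute: equation \<open>s\<close> shifted by \<open>\<alpha> t\<close> and
  equation \<open>t\<close> shifted by \<open>\<alpha> s\<close> read the same value of
  \<open>W\<close>. This is \<open>swap\<close>; aperiodicity then keeps the two marks occurring in
  it apart.\<close>

lemma three_rotations: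
  assumes h: "\<And>s i. s \<in> {1, 2, 3::nat} \<Longrightarrow> u i + mark c (y s) i = W (i - \<alpha> s)"
    and \<alpha>: "\<And>s t. s \<in> {1, 2, 3} \<Longrightarrow> t \<in> {1, 2, 3} \<Longrightarrow> s \<noteq> t \<Longrightarrow> \<not> c dvd \<alpha> s - \<alpha> t"
    and aper: "\<And>r. (\<And>i. u (i + r) = u i) \<Longrightarrow> c dvd r"
    and per: "\<And>i. u (i + c) = u i"
  shows "c dvd y 2 - y 1" "c dvd y 3 - y 1"
proof -
  let ?S = "{1, 2, 3::nat}"
  have shift: "mark c (y s) (i - t) = mark c (t + y s) i" for s i t
    by (simp add: mark_def algebra_simps)
  have swap: "u (i - \<alpha> t) + mark c (\<alpha> t + y s) i = u (i - \<alpha> s) + mark c (\<alpha> s + y t) i"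
    if "s \<in> ?S" "t \<in> ?S" for s t i
    using h[OF that(1), of "i - \<alpha> t"] h[OF that(2), of "i - \<alpha> s"]
    by (simp add: shift algebra_simps)
  have no_same: "\<not> c dvd (\<alpha> s + y t) - (\<alpha> t + y s)" if "s \<in> ?S" "t \<in> ?S" "s \<noteq> t" for s t
  proof
    assume "c dvd (\<alpha> s + y t) - (\<alpha> t + y s)"
    then have "u (i - \<alpha> t) = u (i - \<alpha> s)" for i
      using swap[OF that(1,2), of i] mark_cong[of c "\<alpha> s + y t" "\<alpha> t + y s" i] by simp
    from this[of "_ + \<alpha> s"] have "c dvd \<alpha> s - \<alpha> t"
      by (intro aper) (simp add: algebra_simps)
    then show False using \<alpha> that by blast
  qed
  \<comment> \<open>Two coinciding marks give one word \<open>f\<close> that is a rotation of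
    \<open>W\<close> in two ways, hence periodic. The third equation differs from it by two marks,
    which therefore have to agree.\<close>
  have step: "c dvd y q - y p" if pqr: "p \<in> ?S" "q \<in> ?S" "r \<in> ?S" "p \<noteq> q" "p \<noteq> r" "q \<noteq> r"
    and eq: "c dvd y r - y p" for p q r
  proof -
    define f where "f i = u i + mark c (y p) i" for i
    have fr: "u i + mark c (y r) i = f i" for i
      using mark_cong[OF eq] by (simp add: f_def)
    have 1: "f i = W (i - \<alpha> p)" "f i = W (i - \<alpha> r)" for i
      using h[OF pqr(1), of i] h[OF pqr(3), of i] fr[of i] by (simp_all add: f_def)
    let ?d = "\<alpha> p - \<alpha> r"
    have Wper: "W (i + ?d) = W i" for i
      using 1[of "i + \<alpha> p"] by (simp add: algebra_simps)
    have fper: "f (i + ?d) = f i" for i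
      using Wper[of "i - \<alpha> p"] by (simp add: 1(1) algebra_simps)
    have "c dvd y p - y q"
    proof (rule periodic_difference_two_marks[where f = f and g = "\<lambda>i. W (i - \<alpha> q)" and r = ?d])
      show "f i - W (i - \<alpha> q) = mark c (y p) i - mark c (y q) i" for i
        using h[OF pqr(2), of i] by (simp add: f_def)
      show "W (i + ?d - \<alpha> q) = W (i - \<alpha> q)" for i
        using Wper[of "i - \<alpha> q"] by (simp add: algebra_simps)
      show "\<not> c dvd ?d" using \<alpha> pqr by blast
    qed (rule fper)
    then show ?thesis by (simp add: dvd_diff_commute)
  qed
  have "c dvd y 2 - y 1 \<and> c dvd y 3 - y 1"
  proof (cases "c dvd y 2 - y 1 \<or> c dvd y 3 - y 1 \<or> c dvd y 3 - y 2")
    case True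
    then consider "c dvd y 2 - y 1" | "c dvd y 3 - y 1" | "c dvd y 3 - y 2" by blast
    then show ?thesis
    proof cases
      case 1
      then show ?thesis using step[of 1 3 2] by simp
    next
      case 2
      then show ?thesis using step[of 1 2 3] by simp
    next
      case 3
      then have "c dvd y 1 - y 2" using step[of 2 1 3] by simp
      then have "c dvd y 2 - y 1" by (simp add: dvd_diff_commute)
      moreover from this have "c dvd (y 3 - y 2) + (y 2 - y 1)" using 3 by (intro dvd_add)
      ultimately show ?thesis by simp
    qed
  next
    case False
    text \<open>The three commutation relations sum to an equality of two triples of marks,
      which can only be matched in the way excluded above.\<close>
    have sum: "mark c (\<alpha> 2 + y 1) i + mark c (\<alpha> 3 + y 2) i + mark c (\<alpha> 1 + y 3) i =
        mark c (\<alpha> 1 + y 2) i + mark c (\<alpha> 2 + y 3) i + mark c (\<alpha> 3 + y 1) i" for i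
      using swap[of 1 2 i] swap[of 2 3 i] swap[of 3 1 i] by simp
    let ?i = "\<alpha> 1 + y 3"
    have "mark c (\<alpha> 1 + y 2) ?i = 0" using False by (simp add: mark_def)
    moreover have "mark c (\<alpha> 2 + y 3) ?i = 0" using \<alpha>[of 1 2] by (simp add: mark_def)
    moreover have "mark c (\<alpha> 3 + y 1) ?i = 0" using no_same[of 1 3] by (simp add: mark_def)
    moreover have "mark c (\<alpha> 1 + y 3) ?i = 1" by (simp add: mark_def)
    ultimately have False
      using sum[of ?i] mark_range[of c "\<alpha> 2 + y 1" ?i] mark_range[of c "\<alpha> 3 + y 2" ?i] by linarith
    then show ?thesis ..
  qed
  then show "c dvd y 2 - y 1" "c dvd y 3 - y 1" by auto
qed

text \<open>A change of direction would return, modulo \<open>c\<close>, to the position two steps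
  back, which \<open>turn\<close> forbids. The lemma serves both maps of the whole cycle and maps of
  a path inside it.\<close>

lemma walk_keeps_direction:
  fixes F :: "nat \<Rightarrow> int"
  assumes step: "\<And>i. i < N \<Longrightarrow> c dvd F (Suc i) - F i - 1 \<or> c dvd F (Suc i) - F i + 1"
    and turn: "\<And>i. Suc i < N \<Longrightarrow> \<not> c dvd F (Suc (Suc i)) - F i"
  obtains \<epsilon> :: int where "\<epsilon> \<in> {1, -1}" "\<And>i. i \<le> N \<Longrightarrow> c dvd F i - (F 0 + \<epsilon> * int i)"
proof (cases N)
  case 0
  then show ?thesis using that[of 1] by simp
next
  case (Suc N')
  obtain \<epsilon> :: int where \<epsilon>: "\<epsilon> \<in> {1, -1}" "c dvd F 1 - F 0 - \<epsilon>"
    using step[of 0] Suc by fastforce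
  have inc: "c dvd F (Suc i) - F i - \<epsilon>" if "i < N" for i
    using that
  proof (induction i)
    case 0
    then show ?case using \<epsilon> by simp
  next
    case (Suc i)
    have IH: "c dvd F (Suc i) - F i - \<epsilon>" using Suc by simp
    have "\<not> c dvd F (Suc (Suc i)) - F (Suc i) + \<epsilon>"
    proof
      assume "c dvd F (Suc (Suc i)) - F (Suc i) + \<epsilon>"
      then have "c dvd (F (Suc (Suc i)) - F (Suc i) + \<epsilon>) + (F (Suc i) - F i - \<epsilon>)"
        using IH by (rule dvd_add)
      then show False using turn[of i] Suc.prems by simp
    qed
    then show ?case using step[OF Suc.prems] \<epsilon>(1) by auto
  qed
  have "c dvd F i - (F 0 + \<epsilon> * int i)" if "i \<le> N" for i
    using that
  proof (induction i)
    case (Suc i)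
    then have "c dvd (F (Suc i) - F i - \<epsilon>) + (F i - (F 0 + \<epsilon> * int i))"
      using inc[of i] by (intro dvd_add) auto
    then show ?case by (simp add: algebra_simps)
  qed simp
  then show ?thesis using that \<epsilon>(1) by blast
qed

section \<open>Periods of a cyclic word, one representative for each rotation\<close>

definition periods :: "int \<Rightarrow> (int \<Rightarrow> int) \<Rightarrow> int set" where
  "periods c f = {r \<in> {0..<c}. \<forall>i. f (i + r) = f i}"

lemma finite_periods [simp]: "finite (periods c f)"
  by (rule finite_subset[of _ "{0..<c}"]) (auto simp: periods_def)

lemma period_add_mult:
  assumes "\<And>i. f (i + c) = f i"
  shows "f (i + c * k) = (f (i::int) :: 'b)"
proof (induction k arbitrary: i rule: int_induct[where k = 0])
  case (step1 k)
  then show ?case using assms[of "i + c * k"] by (simp add: algebra_simps)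
next
  case (step2 k)
  have "f (i - c) = f i" using assms[of "i - c"] by simp
  then show ?case using step2(2)[of "i - c"] by (simp add: algebra_simps)
qed simp

lemma mod_periods:
  assumes c: "0 < c" "\<And>i. f (i + c) = f i" and r: "\<And>i. f (i + r) = f i"
  shows "r mod c \<in> periods c f"
proof -
  have "f (i + r mod c) = f i" for i
  proof -
    have "(i + r mod c) + c * (r div c) = i + r" by simp
    then show ?thesis using period_add_mult[of f c "i + r mod c" "r div c", OF c(2)] r[of i] by metis
  qed
  then show ?thesis using c(1) by (simp add: periods_def)
qed

text \<open>Among the representatives only 0 and, for even \<open>c\<close>, \<open>c div 2\<close>
  are annihilated by doubling, so a third period has order at least three.\<close>

lemma ex_period_order_ge_3:
  assumes c: "0 < c" and card: "card (periods c f) \<ge> 3"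
  obtains r where "\<And>i. f (i + r) = f i" "\<not> c dvd 2 * r"
proof -
  have "\<not> periods c f \<subseteq> {0, c div 2}"
  proof
    assume "periods c f \<subseteq> {0, c div 2}"
    then have "card (periods c f) \<le> card {0, c div 2}" by (intro card_mono) auto
    also have "\<dots> \<le> 2" by (simp add: card_insert_if)
    finally show False using card by simp
  qed
  then obtain r where r: "r \<in> periods c f" "r \<noteq> 0" "r \<noteq> c div 2" by auto
  have "\<not> c dvd 2 * r"
  proof
    assume "c dvd 2 * r"
    then obtain k where k: "2 * r = c * k" by (rule dvdE)
    have rr: "0 < r" "r < c" using r by (auto simp: periods_def)
    then have "0 < c * k" "c * k < c * 2" using k rr by linarith+
    then have "0 < k" "k < 2"
      using mult_less_cancel_left_pos[OF c, of 0 k] mult_less_cancel_left_pos[OF c, of k 2] by simp_all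
    then have "k = 1" by simp
    then show False using k r(3) by simp
  qed
  then show ?thesis using that r(1) by (auto simp: periods_def)
qed

subsection \<open>Degrees, isomorphisms and matched cards\<close>

definition nbrs :: "'a pair_pre_digraph \<Rightarrow> 'a \<Rightarrow> 'a set" where
  "nbrs G t = {s. (t, s) \<in> parcs G}"

abbreviation deg :: "'a pair_pre_digraph \<Rightarrow> 'a \<Rightarrow> nat" where
  "deg G t \<equiv> card (nbrs G t)"

lemma vdegree_eq_deg: "vdegree G t = deg G t"
proof -
  have "out_arcs (with_proj G) t = Pair t ` nbrs G t"
    by (auto simp: out_arcs_def nbrs_def)
  then show ?thesis by (simp add: out_degree_def card_image inj_on_def)
qed

text \<open>An equation between \<open>relabel f G\<close> and \<open>H\<close> alone would also
  admit maps that identify vertices, so injectivity is made part of the notion.\<close>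

definition graph_iso :: "('a \<Rightarrow> 'b) \<Rightarrow> 'a pair_pre_digraph \<Rightarrow> 'b pair_pre_digraph \<Rightarrow> bool" where
  "graph_iso f G H \<longleftrightarrow> inj_on f (pverts G) \<and> relabel f G = H"

lemma pair_graph_iff:
  "pair_graph G \<longleftrightarrow> finite (pverts G) \<and> parcs G \<subseteq> pverts G \<times> pverts G \<and> sym (parcs G) \<and>
    (\<forall>t. (t, t) \<notin> parcs G)"
proof
  assume "pair_graph G"
  then interpret pair_graph G .
  show "finite (pverts G) \<and> parcs G \<subseteq> pverts G \<times> pverts G \<and> sym (parcs G) \<and> (\<forall>t. (t, t) \<notin> parcs G)"
    using pair_finite_verts wellformed' pair_no_loops pair_sym_arcs
    by (auto simp: symmetric_def) blast
next
  assume *: "finite (pverts G) \<and> parcs G \<subseteq> pverts G \<times> pverts G \<and> sym (parcs G) \<and> (\<forall>t. (t, t) \<notin> parcs G)"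
  then have "finite (parcs G)"
    using finite_subset[of "parcs G" "pverts G \<times> pverts G"] by simp
  with * show "pair_graph G"
    by unfold_locales (auto simp: symmetric_def)
qed

lemma pair_graph_wf: "pair_graph G \<Longrightarrow> pair_wf_digraph G"
  by (auto simp: pair_graph_iff pair_wf_digraph_def)

context
  fixes G :: "'a pair_pre_digraph"
  assumes G: "pair_graph G"
begin

lemma finite_pverts: "finite (pverts G)"
  and arc_pverts: "(s, t) \<in> parcs G \<Longrightarrow> s \<in> pverts G \<and> t \<in> pverts G"
  and arc_sym: "(s, t) \<in> parcs G \<longleftrightarrow> (t, s) \<in> parcs G"
  and no_loop: "(t, t) \<notin> parcs G"
  using G by (auto simp: pair_graph_iff sym_def)

lemma nbrs_subset: "nbrs G t \<subseteq> pverts G"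
  using arc_pverts by (auto simp: nbrs_def)

lemma finite_nbrs: "finite (nbrs G t)"
  using nbrs_subset finite_pverts by (rule finite_subset)

lemma nbrs_sym: "s \<in> nbrs G t \<longleftrightarrow> t \<in> nbrs G s"
  using arc_sym by (auto simp: nbrs_def)

lemma not_in_own_nbrs: "t \<notin> nbrs G t"
  using no_loop by (auto simp: nbrs_def)

lemma finite_parcs: "finite (parcs G)"
  by (rule finite_subset[of _ "pverts G \<times> pverts G"]) (use G in \<open>auto simp: pair_graph_iff\<close>)

end

lemma pverts_delete [simp]: "pverts (delete_verts G S) = pverts G - S"
  and parcs_delete: "parcs (delete_verts G S) = {e \<in> parcs G. fst e \<notin> S \<and> snd e \<notin> S}"
  by (simp_all add: delete_verts_def)

lemma pair_graph_delete: "pair_graph G \<Longrightarrow> pair_graph (delete_verts G S)"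
  by (auto simp: pair_graph_iff parcs_delete sym_def)

lemma nbrs_delete: "t \<notin> S \<Longrightarrow> nbrs (delete_verts G S) t = nbrs G t - S"
  by (auto simp: nbrs_def parcs_delete)

lemma deg_delete_vert:
  assumes "pair_graph G" "t \<noteq> s"
  shows "int (deg (delete_vert G s) t) = int (deg G t) - of_bool (s \<in> nbrs G t)"
proof (cases "s \<in> nbrs G t")
  case True
  then have "deg G t \<noteq> 0" using finite_nbrs[OF assms(1)] by auto
  then show ?thesis using assms True by (simp add: nbrs_delete card_Diff_singleton)
qed (use assms in \<open>simp add: nbrs_delete\<close>)

lemma delete_verts_commute: "delete_verts (delete_verts G S) S' = delete_verts (delete_verts G S') S"
  by (auto simp: delete_verts_def)

lemma card_parcs_delete_vert:
  assumes G: "pair_graph G" and s: "s \<in> pverts G"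
  shows "card (parcs (delete_vert G s)) + 2 * deg G s = card (parcs G)"
proof -
  let ?A = "Pair s ` nbrs G s" and ?B = "(\<lambda>t. (t, s)) ` nbrs G s"
  have eq: "parcs G = parcs (delete_vert G s) \<union> (?A \<union> ?B)"
    using arc_sym[OF G] by (auto simp: parcs_delete nbrs_def)
  have fin: "finite (parcs (delete_vert G s))" "finite ?A" "finite ?B"
    using finite_parcs[OF pair_graph_delete[OF G]] finite_nbrs[OF G] by auto
  have "card (parcs G) = card (parcs (delete_vert G s)) + card (?A \<union> ?B)"
    by (subst eq, rule card_Un_disjoint) (use fin in \<open>auto simp: parcs_delete\<close>)
  also have "card (?A \<union> ?B) = card ?A + card ?B"
    using not_in_own_nbrs[OF G] fin by (intro card_Un_disjoint) auto
  also have "\<dots> = deg G s + deg G s"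
    by (intro arg_cong2[where f = "(+)"] card_image) (auto intro!: inj_onI)
  finally show ?thesis by simp
qed

context
  fixes f :: "'a \<Rightarrow> 'b" and G H
  assumes G: "pair_graph G" and iso: "graph_iso f G H"
begin

lemma iso_inj: "inj_on f (pverts G)"
  using iso by (simp add: graph_iso_def)

lemma iso_pverts: "pverts H = f ` pverts G"
  and iso_parcs: "parcs H = map_prod f f ` parcs G"
  using iso by (auto simp: graph_iso_def relabel_def)

lemma iso_arc:
  assumes "s \<in> pverts G" "t \<in> pverts G"
  shows "(f s, f t) \<in> parcs H \<longleftrightarrow> (s, t) \<in> parcs G"
proof
  assume "(f s, f t) \<in> parcs H"
  then obtain s' t' where "(s', t') \<in> parcs G" "f s = f s'" "f t = f t'"
    by (auto simp: iso_parcs)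
  then show "(s, t) \<in> parcs G"
    using assms arc_pverts[OF G, of s' t'] inj_onD[OF iso_inj] by metis
next
  assume "(s, t) \<in> parcs G"
  then have "map_prod f f (s, t) \<in> parcs H" unfolding iso_parcs by (rule imageI)
  then show "(f s, f t) \<in> parcs H" by simp
qed

lemma iso_nbrs:
  assumes "t \<in> pverts G"
  shows "nbrs H (f t) = f ` nbrs G t"
proof (intro equalityI subsetI)
  fix s assume s: "s \<in> nbrs H (f t)"
  then obtain s' where "s' \<in> pverts G" "s = f s'"
    by (auto simp: nbrs_def iso_parcs dest: arc_pverts[OF G])
  then show "s \<in> f ` nbrs G t" using s assms iso_arc by (auto simp: nbrs_def)
qed (use assms iso_arc arc_pverts[OF G] in \<open>auto simp: nbrs_def\<close>)

lemma iso_deg: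
  assumes "t \<in> pverts G"
  shows "deg H (f t) = deg G t"
  unfolding iso_nbrs[OF assms]
  by (rule card_image) (meson inj_on_subset iso_inj nbrs_subset[OF G])

lemma iso_pair_graph: "pair_graph H"
proof -
  have "finite (pverts H)" using finite_pverts[OF G] by (simp add: iso_pverts)
  moreover have "parcs H \<subseteq> pverts H \<times> pverts H"
    using arc_pverts[OF G] by (auto simp: iso_pverts iso_parcs)
  moreover have "sym (parcs H)"
  proof (rule symI)
    fix p q assume "(p, q) \<in> parcs H"
    then obtain s t where "(s, t) \<in> parcs G" "p = f s" "q = f t" by (auto simp: iso_parcs)
    then show "(q, p) \<in> parcs H"
      using iso_arc[of t s] arc_sym[OF G, of s t] arc_pverts[OF G, of s t] by blast
  qed
  moreover have "(p, p) \<notin> parcs H" for p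
  proof
    assume "(p, p) \<in> parcs H"
    then obtain s t where st: "(s, t) \<in> parcs G" "p = f s" "p = f t" by (auto simp: iso_parcs)
    then have "s = t" using arc_pverts[OF G st(1)] iso_inj by (metis inj_onD)
    then show False using st no_loop[OF G] by blast
  qed
  ultimately show ?thesis by (simp add: pair_graph_iff)
qed

lemma iso_card_parcs: "card (parcs H) = card (parcs G)"
  unfolding iso_parcs
proof (rule card_image)
  have "inj_on (map_prod f f) (pverts G \<times> pverts G)" by (rule map_prod_inj_on) (rule iso_inj)+
  then show "inj_on (map_prod f f) (parcs G)"
    using G by (auto simp: pair_graph_iff intro: inj_on_subset)
qed

lemma iso_delete:
  assumes "S \<subseteq> pverts G"
  shows "graph_iso f (delete_verts G S) (delete_verts H (f ` S))"
proof -
  have *: "f t \<in> f ` S \<longleftrightarrow> t \<in> S" if "t \<in> pverts G" for t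
    using that assms iso_inj by (auto dest: inj_onD)
  have "parcs (delete_verts H (f ` S)) = map_prod f f ` parcs (delete_verts G S)"
  proof (intro equalityI subsetI)
    fix e assume e: "e \<in> parcs (delete_verts H (f ` S))"
    then obtain s t where st: "(s, t) \<in> parcs G" "e = (f s, f t)"
      by (auto simp: parcs_delete iso_parcs)
    then have "(s, t) \<in> parcs (delete_verts G S)" using e by (auto simp: parcs_delete)
    then show "e \<in> map_prod f f ` parcs (delete_verts G S)" using st(2) by force
  next
    fix e assume "e \<in> map_prod f f ` parcs (delete_verts G S)"
    then obtain s t where st: "(s, t) \<in> parcs G" "s \<notin> S" "t \<notin> S" "e = (f s, f t)"
      by (auto simp: parcs_delete)
    then show "e \<in> parcs (delete_verts H (f ` S))"
      using *[of s] *[of t] arc_pverts[OF G st(1)] iso_arc[of s t] by (simp add: parcs_delete)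
  qed
  moreover have "pverts (delete_verts H (f ` S)) = f ` pverts (delete_verts G S)"
    using * by (auto simp: iso_pverts)
  moreover have "inj_on f (pverts (delete_verts G S))"
    using iso_inj by (auto intro: inj_on_subset)
  ultimately show ?thesis by (simp add: graph_iso_def relabel_def)
qed

lemma iso_delete_vert: "s \<in> pverts G \<Longrightarrow> graph_iso f (delete_vert G s) (delete_vert H (f s))"
  using iso_delete[of "{s}"] by simp

end

lemma graph_isoI:
  assumes "pair_graph G" "pair_graph H" "bij_betw f (pverts G) (pverts H)"
    and "\<And>s t. s \<in> pverts G \<Longrightarrow> t \<in> pverts G \<Longrightarrow> (f s, f t) \<in> parcs H \<longleftrightarrow> (s, t) \<in> parcs G"
  shows "graph_iso f G H"
proof -
  have im: "f ` pverts G = pverts H" using assms(3) by (simp add: bij_betw_def)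
  have "parcs H = map_prod f f ` parcs G"
  proof (intro equalityI subsetI)
    fix e :: "'b \<times> 'b"
    assume e: "e \<in> parcs H"
    then have "fst e \<in> f ` pverts G" "snd e \<in> f ` pverts G"
      using arc_pverts[OF assms(2), of "fst e" "snd e"] by (auto simp: im)
    then obtain s t where st: "s \<in> pverts G" "t \<in> pverts G" "fst e = f s" "snd e = f t"
      by blast
    then have "(s, t) \<in> parcs G" "e = map_prod f f (s, t)"
      using e assms(4)[OF st(1,2)] by (simp_all add: prod_eq_iff) (metis prod.collapse)
    then show "e \<in> map_prod f f ` parcs G" by blast
  next
    fix e assume "e \<in> map_prod f f ` parcs G"
    then show "e \<in> parcs H" using assms(4) arc_pverts[OF assms(1)] by auto
  qed
  then show ?thesis
    using assms(3) im by (simp add: graph_iso_def relabel_def bij_betw_def)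
qed

lemma graph_iso_comp:
  assumes "graph_iso f G H" "graph_iso g H K"
  shows "graph_iso (g \<circ> f) G K"
proof -
  have "inj_on f (pverts G)" "inj_on g (f ` pverts G)"
    using assms by (auto simp: graph_iso_def relabel_def)
  then have "inj_on (g \<circ> f) (pverts G)" by (rule comp_inj_on)
  moreover have "relabel (g \<circ> f) G = relabel g (relabel f G)"
    by (simp add: relabel_def image_comp map_prod_compose)
  ultimately show ?thesis
    using assms by (simp add: graph_iso_def)
qed

lemma graph_iso_inv:
  assumes G: "pair_graph G" and f: "graph_iso f G H"
  shows "graph_iso (inv_into (pverts G) f) H G"
proof (rule graph_isoI)
  show H: "pair_graph H" by (rule iso_pair_graph[OF G f])
  have "bij_betw f (pverts G) (pverts H)"
    using iso_inj[OF G f] iso_pverts[OF G f] by (simp add: bij_betw_def)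
  then show bij: "bij_betw (inv_into (pverts G) f) (pverts H) (pverts G)"
    by (rule bij_betw_inv_into)
  fix s t assume "s \<in> pverts H" "t \<in> pverts H"
  then obtain s' t' where *: "s' \<in> pverts G" "t' \<in> pverts G" "s = f s'" "t = f t'"
    using iso_pverts[OF G f] by auto
  then show "(inv_into (pverts G) f s, inv_into (pverts G) f t) \<in> parcs G \<longleftrightarrow> (s, t) \<in> parcs H"
    using iso_arc[OF G f] iso_inj[OF G f] by simp
qed (rule G)

section \<open>From equal unlabelled cards to matched vertices\<close>

lemma isomorphic_iff_graph_iso:
  "pair_graph G \<Longrightarrow> isomorphic G H \<longleftrightarrow> (\<exists>f. graph_iso f G H)"
  using isomorphic_iff_relabel[of G H] pair_graph_wf[of G] by (simp add: graph_iso_def)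

text \<open>Graphs over different vertex types are compared through a copy on \<open>nat\<close>: a
  finite graph has one, it lies in the class of that graph, and equality of the classes makes it a
  copy of the other graph too.\<close>

lemma unlabelled_eq_imp_iso:
  assumes G: "pair_graph G" and H: "pair_graph H" and eq: "unlabelled G = unlabelled H"
  obtains f where "graph_iso f G H"
proof -
  obtain g :: "'a \<Rightarrow> nat" where "inj_on g (pverts G)"
    using finite_imp_inj_to_nat_seg[OF finite_pverts[OF G]] by metis
  then have g: "graph_iso g G (relabel g G)" by (simp add: graph_iso_def)
  then have "relabel g G \<in> unlabelled G"
    using isomorphic_iff_graph_iso[OF G] by (auto simp: unlabelled_def)
  then obtain h where h: "graph_iso h H (relabel g G)"
    using isomorphic_iff_graph_iso[OF H] eq by (auto simp: unlabelled_def)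
  show ?thesis
    using that graph_iso_comp[OF g graph_iso_inv[OF H h]] by blast
qed

text \<open>Removing a common value, together with one index on each side that attains it, lowers
  the intersection by one, so the matching is built by induction on the size.\<close>

lemma mset_inter_matching:
  assumes "finite A" "finite B"
  shows "\<exists>A0 \<beta>. A0 \<subseteq> A \<and> inj_on \<beta> A0 \<and> \<beta> ` A0 \<subseteq> B \<and> (\<forall>a\<in>A0. f a = g (\<beta> a)) \<and>
    card A0 = size (image_mset f (mset_set A) \<inter># image_mset g (mset_set B))"
  using assms
proof (induction "size (image_mset f (mset_set A) \<inter># image_mset g (mset_set B))" arbitrary: A B)
  case 0
  then show ?case by (intro exI[of _ "{}"]) auto
next
  case (Suc m)
  let ?M = "\<lambda>A B. image_mset f (mset_set A) \<inter># image_mset g (mset_set B)"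
  obtain C where "C \<in># ?M A B"
    using Suc.hyps(2) by (metis gr0_conv_Suc size_empty size_eq_0_iff_empty multiset_nonemptyE nat.distinct(1))
  then have "C \<in># image_mset f (mset_set A)" "C \<in># image_mset g (mset_set B)" by auto
  then obtain a b where ab: "a \<in> A" "b \<in> B" "f a = C" "g b = C"
    using Suc.prems by auto
  have "mset_set A = add_mset a (mset_set (A - {a}))" "mset_set B = add_mset b (mset_set (B - {b}))"
    using ab Suc.prems by (auto simp: mset_set.remove)
  then have eq: "?M A B = add_mset C (?M (A - {a}) (B - {b}))"
    using ab by (simp add: inter_add_right1)
  then have "m = size (?M (A - {a}) (B - {b}))" using Suc.hyps(2) by simp
  from Suc.hyps(1)[OF this] Suc.prems obtain A0 \<beta> where *: "A0 \<subseteq> A - {a}" "inj_on \<beta> A0"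
    "\<beta> ` A0 \<subseteq> B - {b}" "\<forall>a\<in>A0. f a = g (\<beta> a)" "card A0 = m"
    using \<open>m = _\<close> by auto
  have notin: "a \<notin> A0" "finite A0" using *(1) Suc.prems by (auto intro: finite_subset)
  show ?case
  proof (intro exI conjI)
    show "insert a A0 \<subseteq> A" using * ab by auto
    show "inj_on (\<beta>(a := b)) (insert a A0)" using * notin by (auto simp: inj_on_def)
    show "(\<beta>(a := b)) ` insert a A0 \<subseteq> B" using * ab notin by auto
    show "\<forall>x\<in>insert a A0. f x = g ((\<beta>(a := b)) x)" using * ab notin by auto
    show "card (insert a A0) = size (?M A B)" using * notin Suc.hyps(2) by simp
  qed
qed

text \<open>Moves the matching onto \<open>U0\<close> and \<open>T0\<close>, which later are two
  vertex-deleted subgraphs of one supercard, so that all common cards are studied inside a single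
  labelled graph.\<close>

lemma common_cards_matching:
  assumes U: "pair_graph U" and T: "pair_graph T"
    and U0: "pair_graph U0" "isomorphic U0 U" and T0: "pair_graph T0" "isomorphic T0 T"
  obtains A \<beta> where "A \<subseteq> pverts U0" "inj_on \<beta> A" "\<beta> ` A \<subseteq> pverts T0" "card A = common_cards U T"
    "\<And>a. a \<in> A \<Longrightarrow> \<exists>f. graph_iso f (delete_vert U0 a) (delete_vert T0 (\<beta> a))"
proof -
  obtain A \<beta> where *: "A \<subseteq> pverts U" "inj_on \<beta> A" "\<beta> ` A \<subseteq> pverts T"
    "\<forall>a\<in>A. unlabelled (delete_vert U a) = unlabelled (delete_vert T (\<beta> a))" "card A = common_cards U T"
    using mset_inter_matching[OF finite_pverts[OF U] finite_pverts[OF T],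
      of "\<lambda>a. unlabelled (delete_vert U a)" "\<lambda>b. unlabelled (delete_vert T b)"]
    unfolding common_cards_def deck_def by auto
  obtain g h where "graph_iso g U0 U" "graph_iso h T0 T"
    using U0 T0 by (auto simp: isomorphic_iff_graph_iso)
  then obtain g' where g': "graph_iso g' U U0" and h: "graph_iso h T0 T"
    using graph_iso_inv[OF U0(1)] by blast
  obtain h' where h': "graph_iso h' T T0" using graph_iso_inv[OF T0(1) h] by blast
  let ?A = "g' ` A" and ?\<beta> = "h' \<circ> \<beta> \<circ> inv_into A g'"
  have injg: "inj_on g' A" using iso_inj[OF U g'] *(1) by (rule inj_on_subset)
  have injh: "inj_on h' (\<beta> ` A)" using iso_inj[OF T h'] *(3) by (rule inj_on_subset)
  have "\<exists>f. graph_iso f (delete_vert U0 (g' a)) (delete_vert T0 (h' (\<beta> a)))" if a: "a \<in> A" for a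
  proof -
    have mem: "a \<in> pverts U" "\<beta> a \<in> pverts T" using a * by auto
    obtain f where "graph_iso f (delete_vert U a) (delete_vert T (\<beta> a))"
      using unlabelled_eq_imp_iso[OF pair_graph_delete[OF U] pair_graph_delete[OF T]] *(4) a by metis
    moreover obtain p where "graph_iso p (delete_vert U0 (g' a)) (delete_vert U a)"
      using graph_iso_inv[OF pair_graph_delete[OF U] iso_delete_vert[OF U g' mem(1)]] by blast
    moreover have "graph_iso h' (delete_vert T (\<beta> a)) (delete_vert T0 (h' (\<beta> a)))"
      using iso_delete_vert[OF T h' mem(2)] .
    ultimately have "graph_iso (h' \<circ> (f \<circ> p)) (delete_vert U0 (g' a)) (delete_vert T0 (h' (\<beta> a)))"
      by (intro graph_iso_comp)
    then show ?thesis by blast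
  qed
  then have "\<And>a. a \<in> ?A \<Longrightarrow> \<exists>f. graph_iso f (delete_vert U0 a) (delete_vert T0 (?\<beta> a))"
    using injg by auto
  moreover have "?A \<subseteq> pverts U0" using *(1) iso_pverts[OF U g'] by auto
  moreover have "inj_on ?\<beta> ?A"
    using *(2) injg injh
    by (intro comp_inj_on) (auto simp: inj_on_inv_into)
  moreover have "?\<beta> ` ?A \<subseteq> pverts T0"
    using *(3) injg iso_pverts[OF T h'] by auto
  moreover have "card ?A = common_cards U T" using *(5) injg by (simp add: card_image)
  ultimately show ?thesis by (intro that[of ?A ?\<beta>])
qed

subsection \<open>Sunshine graphs with integer cycle labels\<close>

lemma connected_iff_rtrancl_on:
  assumes "pair_graph G"
  shows "Digraph_Component.connected (with_proj G) \<longleftrightarrow>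
    pverts G \<noteq> {} \<and> (\<forall>s\<in>pverts G. \<forall>t\<in>pverts G. (s, t) \<in> rtrancl_on (pverts G) (parcs G))"
proof -
  have "symcl (parcs G) = parcs G"
    using arc_sym[OF assms] by (auto simp: symcl_def)
  then show ?thesis by (simp add: connected_conv)
qed

text \<open>Cycle labellings are used with indices in \<^typ>\<open>int\<close>, read modulo \<open>c\<close>.\<close>

definition int_cycle :: "'a pair_pre_digraph \<Rightarrow> int \<Rightarrow> (int \<Rightarrow> 'a) \<Rightarrow> bool" where
  "int_cycle C c X \<longleftrightarrow> 3 \<le> c \<and> range X = pverts C \<and> (\<forall>i j. X i = X j \<longleftrightarrow> c dvd i - j) \<and>
     parcs C = {(X i, X (i + 1)) | i. True} \<union> {(X (i + 1), X i) | i. True}"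

lemma cycle_labelling_imp_int_cycle:
  assumes "cycle_labelling C c x"
  shows "int_cycle C (int c) (\<lambda>i. x (nat (i mod int c)))"
proof -
  let ?X = "\<lambda>i. x (nat (i mod int c))"
  have c: "3 \<le> c" and bij: "bij_betw x {..<c} (pverts C)"
    and parcs: "parcs C = {(x i, x (Suc i mod c)) | i. i < c} \<union> {(x (Suc i mod c), x i) | i. i < c}"
    using assms by (auto simp: cycle_labelling_def)
  have lt: "nat (i mod int c) < c" for i using c by (simp add: nat_less_iff)
  have eq: "?X i = ?X j \<longleftrightarrow> int c dvd i - j" for i j
  proof -
    have "?X i = ?X j \<longleftrightarrow> nat (i mod int c) = nat (j mod int c)"
      using bij lt by (auto simp: bij_betw_def inj_on_eq_iff)
    also have "\<dots> \<longleftrightarrow> i mod int c = j mod int c" using c by (simp add: eq_nat_nat_iff)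
    finally show ?thesis by (simp add: mod_eq_dvd_iff)
  qed
  have X_nat: "x k = ?X (int k)" if "k < c" for k using that by simp
  have X_suc: "x (Suc k mod c) = ?X (int k + 1)" for k
    by (simp add: of_nat_mod[symmetric] nat_mod_distrib nat_add_distrib)
  have im: "?X i = x (nat (i mod int c))" "?X (i + 1) = x (Suc (nat (i mod int c)) mod c)" for i
  proof -
    have "?X (i + 1) = ?X (int (nat (i mod int c)) + 1)"
      unfolding eq using c by (simp add: mod_eq_dvd_iff[symmetric])
    then show "?X (i + 1) = x (Suc (nat (i mod int c)) mod c)" using X_suc by simp
  qed simp
  have "range ?X = pverts C"
  proof
    show "range ?X \<subseteq> pverts C" using bij lt by (auto simp: bij_betw_def)
    show "pverts C \<subseteq> range ?X"
    proof
      fix p assume "p \<in> pverts C"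
      then obtain k where "k < c" "p = x k" using bij by (auto simp: bij_betw_def)
      then show "p \<in> range ?X" using X_nat by blast
    qed
  qed
  moreover have "{(x k, x (Suc k mod c)) | k. k < c} = {(?X i, ?X (i + 1)) | i. True}"
  proof (intro equalityI subsetI)
    fix e assume "e \<in> {(x k, x (Suc k mod c)) | k. k < c}"
    then obtain k where "k < c" "e = (x k, x (Suc k mod c))" by blast
    then have "e = (?X (int k), ?X (int k + 1))" by (simp only: X_nat X_suc)
    then show "e \<in> {(?X i, ?X (i + 1)) | i. True}" by blast
  next
    fix e assume "e \<in> {(?X i, ?X (i + 1)) | i. True}"
    then obtain i where "e = (?X i, ?X (i + 1))" by blast
    then show "e \<in> {(x k, x (Suc k mod c)) | k. k < c}" using im lt by auto
  qed
  moreover have "{(x (Suc k mod c), x k) | k. k < c} = {(?X (i + 1), ?X i) | i. True}"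
  proof (intro equalityI subsetI)
    fix e assume "e \<in> {(x (Suc k mod c), x k) | k. k < c}"
    then obtain k where "k < c" "e = (x (Suc k mod c), x k)" by blast
    then have "e = (?X (int k + 1), ?X (int k))" by (simp only: X_nat X_suc)
    then show "e \<in> {(?X (i + 1), ?X i) | i. True}" by blast
  next
    fix e assume "e \<in> {(?X (i + 1), ?X i) | i. True}"
    then obtain i where "e = (?X (i + 1), ?X i)" by blast
    then show "e \<in> {(x (Suc k mod c), x k) | k. k < c}" using im lt by auto
  qed
  ultimately show ?thesis using c eq parcs by (simp add: int_cycle_def)
qed

lemma int_cycle_imp_cycle_labelling:
  assumes "int_cycle C (int c) X"
  shows "cycle_labelling C c (\<lambda>i. X (int i))"
proof -
  have c: "3 \<le> c" and r: "range X = pverts C" and eq: "\<And>i j. X i = X j \<longleftrightarrow> int c dvd i - j"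
    and parcs: "parcs C = {(X i, X (i + 1)) | i. True} \<union> {(X (i + 1), X i) | i. True}"
    using assms by (auto simp: int_cycle_def)
  have red: "X i = X (int (nat (i mod int c)))" "nat (i mod int c) < c" for i
    using c by (auto simp: eq nat_less_iff mod_eq_dvd_iff[symmetric])
  have suc: "X (int (Suc k mod c)) = X (int k + 1)" for k
    by (simp add: eq mod_eq_dvd_iff[symmetric] of_nat_mod add.commute)
  have suc': "X (i + 1) = X (int (Suc (nat (i mod int c)) mod c))" for i
    using c by (simp only: suc) (simp add: eq mod_eq_dvd_iff[symmetric])
  have "bij_betw (\<lambda>i. X (int i)) {..<c} (pverts C)"
  proof (rule bij_betwI')
    fix i j assume "i \<in> {..<c}" "j \<in> {..<c}"
    then show "X (int i) = X (int j) \<longleftrightarrow> i = j"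
      by (simp add: eq mod_eq_dvd_iff[symmetric])
  next
    fix p assume "p \<in> pverts C"
    then obtain i where "p = X i" using r by auto
    then show "\<exists>k\<in>{..<c}. p = X (int k)" using red[of i] by (metis lessThan_iff)
  qed (use r in auto)
  moreover have "{(X (int k), X (int (Suc k mod c))) | k. k < c} = {(X i, X (i + 1)) | i. True}"
  proof (intro equalityI subsetI)
    fix e assume "e \<in> {(X i, X (i + 1)) | i. True}"
    then obtain i where "e = (X i, X (i + 1))" by blast
    then show "e \<in> {(X (int k), X (int (Suc k mod c))) | k. k < c}"
      using red[of i] suc'[of i] by blast
  qed (use suc in blast)
  moreover have "{(X (int (Suc k mod c)), X (int k)) | k. k < c} = {(X (i + 1), X i) | i. True}"
  proof (intro equalityI subsetI)
    fix e assume "e \<in> {(X (i + 1), X i) | i. True}"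
    then obtain i where "e = (X (i + 1), X i)" by blast
    then show "e \<in> {(X (int (Suc k mod c)), X (int k)) | k. k < c}"
      using red[of i] suc'[of i] by blast
  qed (use suc in blast)
  ultimately show ?thesis using c parcs by (simp add: cycle_labelling_def)
qed

text \<open>Connectedness is replaced by the clause that every vertex off the cycle is a leaf
  attached to it. In this form the structure visibly survives the deletion or reattachment of a
  leaf.\<close>

locale sun =
  fixes G :: "'a pair_pre_digraph" and c :: int and X :: "int \<Rightarrow> 'a"
  assumes pair_graph: "pair_graph G" and c_ge_3: "3 \<le> c"
    and X_eq_iff: "X i = X j \<longleftrightarrow> c dvd i - j"
    and X_pverts: "X i \<in> pverts G"
    and X_nbrs: "X j \<in> nbrs G (X i) \<longleftrightarrow> c dvd j - i - 1 \<or> c dvd j - i + 1"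
    and pendant: "t \<in> pverts G \<Longrightarrow> t \<notin> range X \<Longrightarrow> \<exists>i. nbrs G t = {X i}"
begin

definition d :: "int \<Rightarrow> int" where
  "d i = int (deg G (X i))"

lemma X_add_c [simp]: "X (i + c) = X i"
  by (simp add: X_eq_iff)

lemma d_add_c: "d (i + c) = d i"
  by (simp add: d_def)

lemma d_cong: "c dvd i - j \<Longrightarrow> d i = d j"
  using X_eq_iff[of i j] by (simp add: d_def)

lemma X_mod [simp]: "X (i mod c) = X i"
  by (simp add: X_eq_iff mod_eq_dvd_iff[symmetric])

lemma range_X: "range X = X ` {0..<c}"
proof
  show "range X \<subseteq> X ` {0..<c}"
  proof
    fix p assume "p \<in> range X"
    then obtain i where "p = X i" by auto
    then have "p = X (i mod c)" by simp
    moreover have "i mod c \<in> {0..<c}" using c_ge_3 by simp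
    ultimately show "p \<in> X ` {0..<c}" by (rule image_eqI)
  qed
qed auto

lemma inj_on_X: "inj_on X {0..<c}"
proof (rule inj_onI)
  fix i j assume ij: "i \<in> {0..<c}" "j \<in> {0..<c}" "X i = X j"
  then have "i mod c = j mod c" by (simp only: X_eq_iff mod_eq_dvd_iff)
  moreover have "i mod c = i" "j mod c = j" using ij(1,2) by (simp_all add: mod_pos_pos_trivial)
  ultimately show "i = j" by metis
qed

lemma card_range_X: "int (card (range X)) = c"
  using c_ge_3 by (simp add: range_X card_image inj_on_X)

lemma small_not_dvd: "0 < k \<Longrightarrow> k < c \<Longrightarrow> \<not> c dvd k"
  by (simp add: zdvd_not_zless)

lemma X_neighbours: "X (i + 1) \<in> nbrs G (X i)" "X (i - 1) \<in> nbrs G (X i)" "X (i + 1) \<noteq> X (i - 1)"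
  using small_not_dvd[of 2] c_ge_3 by (simp_all add: X_nbrs X_eq_iff)

lemma cycle_nbrs: "nbrs G (X i) \<inter> range X = {X (i - 1), X (i + 1)}"
proof
  show "nbrs G (X i) \<inter> range X \<subseteq> {X (i - 1), X (i + 1)}"
    by (auto simp: X_nbrs X_eq_iff algebra_simps)
qed (use X_neighbours in auto)

lemma d_ge_2: "2 \<le> d i"
proof -
  have "card {X (i - 1), X (i + 1)} \<le> deg G (X i)"
    using X_neighbours finite_nbrs[OF pair_graph] by (intro card_mono) auto
  then show ?thesis using X_neighbours(3)[of i] by (auto simp: d_def)
qed

lemma pendant_deg: "t \<in> pverts G \<Longrightarrow> t \<notin> range X \<Longrightarrow> deg G t = 1"
  using pendant by fastforce

lemma deg_ge_2_iff: "t \<in> pverts G \<Longrightarrow> 2 \<le> deg G t \<longleftrightarrow> t \<in> range X"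
proof -
  assume t: "t \<in> pverts G"
  have "2 \<le> deg G (X i)" for i using d_ge_2[of i] by (simp add: d_def)
  moreover have "deg G t = 1" if "t \<notin> range X" using pendant_deg t that by blast
  ultimately show ?thesis by fastforce
qed

lemma deg_ge_1: "t \<in> pverts G \<Longrightarrow> 1 \<le> deg G t"
  using deg_ge_2_iff pendant_deg by fastforce

lemma leaves_subset_nbrs:
  assumes "t \<in> pverts G" "t \<notin> range X" "s \<in> nbrs G t"
  shows "s \<in> range X" "nbrs G t = {s}"
  using pendant[OF assms(1,2)] assms(3) by auto

definition leaves :: "int \<Rightarrow> 'a set" where
  "leaves i = nbrs G (X i) - range X"

lemma finite_leaves: "finite (leaves i)"
  using finite_nbrs[OF pair_graph] by (simp add: leaves_def)

lemma leaves_iff: "t \<in> leaves i \<longleftrightarrow> t \<in> pverts G \<and> t \<notin> range X \<and> nbrs G t = {X i}"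
proof
  assume t: "t \<in> leaves i"
  then have "t \<in> pverts G" "t \<notin> range X" "X i \<in> nbrs G t"
    using nbrs_subset[OF pair_graph] nbrs_sym[OF pair_graph] by (auto simp: leaves_def)
  then show "t \<in> pverts G \<and> t \<notin> range X \<and> nbrs G t = {X i}" using leaves_subset_nbrs by blast
next
  assume "t \<in> pverts G \<and> t \<notin> range X \<and> nbrs G t = {X i}"
  then show "t \<in> leaves i" using nbrs_sym[OF pair_graph] by (auto simp: leaves_def)
qed

lemma card_leaves: "int (card (leaves i)) = d i - 2"
proof -
  have "nbrs G (X i) = {X (i - 1), X (i + 1)} \<union> leaves i"
    using cycle_nbrs[of i] by (auto simp: leaves_def)
  moreover have "{X (i - 1), X (i + 1)} \<inter> leaves i = {}" by (auto simp: leaves_def)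
  ultimately have "deg G (X i) = card {X (i - 1), X (i + 1)} + card (leaves i)"
    using finite_leaves by (metis card_Un_disjoint finite.emptyI finite.insertI)
  then show ?thesis using X_neighbours(3)[of i] by (auto simp: d_def)
qed

lemma leaf_cases:
  assumes "t \<in> pverts G" "t \<notin> range X"
  obtains i where "t \<in> leaves i"
  using pendant[OF assms] assms leaves_iff by blast

text \<open>The term \<open>d i - 1\<close> counts \<open>X i\<close> together with its
  \<open>d i - 2\<close> leaves, and these stars are disjoint for different cycle vertices.\<close>

lemma sum_le_card_pverts:
  assumes "I \<subseteq> {0..<c}"
  shows "(\<Sum>i\<in>I. d i - 1) \<le> int (card (pverts G))"
proof -
  have fin: "finite I" using assms by (rule finite_subset) simp
  let ?S = "\<lambda>i. insert (X i) (leaves i)"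
  have "card (?S i) = 1 + card (leaves i)" for i
    using finite_leaves by (simp add: leaves_def)
  then have S: "int (card (?S i)) = d i - 1" for i using card_leaves[of i] by simp
  have "?S i \<inter> ?S j = {}" if "i \<in> I" "j \<in> I" "i \<noteq> j" for i j
  proof -
    have "X i \<noteq> X j" using that assms inj_on_X by (auto dest: inj_onD)
    then show ?thesis by (auto simp: leaves_iff)
  qed
  then have "card (\<Union>i\<in>I. ?S i) = (\<Sum>i\<in>I. card (?S i))"
    using fin finite_leaves by (intro card_UN_disjoint) auto
  moreover have "card (\<Union>i\<in>I. ?S i) \<le> card (pverts G)"
    using X_pverts leaves_iff finite_pverts[OF pair_graph] by (intro card_mono) auto
  ultimately have "int (\<Sum>i\<in>I. card (?S i)) \<le> int (card (pverts G))" by linarith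
  then show ?thesis by (simp only: of_nat_sum S)
qed

lemma skeleton_eq: "skeleton G = delete_verts G (pverts G - range X)"
proof -
  have "{t \<in> pverts G. vdegree G t \<le> 1} = pverts G - range X"
    using deg_ge_2_iff by (force simp: vdegree_eq_deg not_le)
  then show ?thesis by (simp add: skeleton_def)
qed

lemma int_cycle_skeleton: "int_cycle (skeleton G) c X"
proof -
  have "pverts (skeleton G) = range X"
    using X_pverts by (auto simp: skeleton_eq)
  moreover have "parcs (skeleton G) = {(X i, X (i + 1)) | i. True} \<union> {(X (i + 1), X i) | i. True}"
  proof (intro equalityI subsetI)
    fix e assume e: "e \<in> parcs (skeleton G)"
    then have "fst e \<in> range X" "snd e \<in> range X" "(fst e, snd e) \<in> parcs G"
      using arc_pverts[OF pair_graph, of "fst e" "snd e"] by (auto simp: skeleton_eq parcs_delete)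
    moreover from this obtain i j where "fst e = X i" "snd e = X j" by blast
    ultimately have ij: "fst e = X i" "snd e = X j" "X j \<in> nbrs G (X i)"
      by (auto simp: nbrs_def)
    then have "c dvd j - (i + 1) \<or> c dvd i - (j + 1)"
      by (auto simp: X_nbrs algebra_simps dvd_diff_commute)
    then have "X j = X (i + 1) \<or> X i = X (j + 1)" by (simp add: X_eq_iff)
    then have "e = (X i, X (i + 1)) \<or> e = (X (j + 1), X j)" using ij by (auto simp: prod_eq_iff)
    then show "e \<in> {(X i, X (i + 1)) | i. True} \<union> {(X (i + 1), X i) | i. True}" by blast
  next
    fix e assume "e \<in> {(X i, X (i + 1)) | i. True} \<union> {(X (i + 1), X i) | i. True}"
    then obtain i where "e = (X i, X (i + 1)) \<or> e = (X (i + 1), X i)" by blast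
    then show "e \<in> parcs (skeleton G)"
      using X_neighbours(1)[of i] arc_sym[OF pair_graph]
      by (auto simp: skeleton_eq parcs_delete nbrs_def)
  qed
  ultimately show ?thesis using c_ge_3 X_eq_iff by (auto simp: int_cycle_def)
qed

lemma sunshine: "sunshine G"
proof -
  let ?R = "rtrancl_on (pverts G) (parcs G)"
  have sym: "(s, t) \<in> ?R \<Longrightarrow> (t, s) \<in> ?R" for s t
    using rtrancl_on_sym[of "parcs G"] arc_sym[OF pair_graph] by (auto simp: sym_def)
  have "(X 0, X (int k)) \<in> ?R" for k
  proof (induction k)
    case (Suc k)
    have "(X (int k), X (int k + 1)) \<in> parcs G" using X_neighbours(1) by (simp add: nbrs_def)
    then show ?case using Suc X_pverts by (auto intro: rtrancl_on_into_rtrancl_on simp: add.commute)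
  qed (use X_pverts in auto)
  from this[of "nat (i mod c)" for i] have cyc: "(X 0, X i) \<in> ?R" for i
    using c_ge_3 by simp
  have reach: "(X 0, t) \<in> ?R" if t: "t \<in> pverts G" for t
  proof (cases "t \<in> range X")
    case False
    then obtain i where "t \<in> leaves i" using leaf_cases t by blast
    then have "(X i, t) \<in> parcs G" by (auto simp: leaves_def nbrs_def)
    then show ?thesis using cyc t X_pverts by (auto intro: rtrancl_on_into_rtrancl_on)
  qed (use cyc in auto)
  have "Digraph_Component.connected (with_proj G)"
    unfolding connected_iff_rtrancl_on[OF pair_graph]
  proof (intro conjI ballI)
    show "pverts G \<noteq> {}" using X_pverts by blast
    fix s t assume "s \<in> pverts G" "t \<in> pverts G"
    then show "(s, t) \<in> ?R" using rtrancl_on_trans[OF sym[OF reach] reach] by blast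
  qed
  moreover have "cycle_labelling (skeleton G) (nat c) (\<lambda>i. X (int i))"
    using int_cycle_skeleton c_ge_3 by (intro int_cycle_imp_cycle_labelling) simp
  ultimately show ?thesis using pair_graph unfolding sunshine_def by blast
qed

text \<open>The image of the cycle is a walk on the cycle. It cannot turn back, since
  \<open>h\<close> is injective on the cycle and \<open>c\<close> does not divide 2, so it is a
  rotation or a reflection.\<close>

lemma cycle_map_dihedral:
  assumes inj: "\<And>i j. h (X i) = h (X j) \<Longrightarrow> X i = X j"
    and range: "\<And>i. h (X i) \<in> range X"
    and adj: "\<And>i. h (X (i + 1)) \<in> nbrs G (h (X i))"
  obtains s \<epsilon> where "\<epsilon> \<in> {1, -1}" "\<And>i. h (X i) = X (s + \<epsilon> * i)"
proof -
  obtain F where F: "h (X i) = X (F i)" for i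
  proof -
    have "\<forall>i. \<exists>j. h (X i) = X j" using range by blast
    then show thesis using that by metis
  qed
  define F' where "F' k = F (int k)" for k
  have step: "c dvd F' (Suc i) - F' i - 1 \<or> c dvd F' (Suc i) - F' i + 1" if "i < nat c" for i
    using adj[of "int i"] by (simp add: F F'_def X_nbrs add.commute)
  have turn: "\<not> c dvd F' (Suc (Suc i)) - F' i" if "Suc i < nat c" for i
  proof
    assume "c dvd F' (Suc (Suc i)) - F' i"
    then have "h (X (int i + 2)) = h (X (int i))" by (simp add: F F'_def X_eq_iff add.commute)
    then have "X (int i + 2) = X (int i)" by (rule inj)
    then have "c dvd 2" by (simp add: X_eq_iff)
    then show False using small_not_dvd[of 2] c_ge_3 by simp
  qed
  obtain \<epsilon> :: int where \<epsilon>: "\<epsilon> \<in> {1, -1}" "\<And>i. i \<le> nat c \<Longrightarrow> c dvd F' i - (F' 0 + \<epsilon> * int i)"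
    using walk_keeps_direction[of "nat c" c F', OF step turn] by blast
  have "h (X i) = X (F' 0 + \<epsilon> * i)" for i
  proof -
    have "h (X i) = h (X (int (nat (i mod c))))" using c_ge_3 by simp
    also have "\<dots> = X (F' (nat (i mod c)))" by (simp add: F F'_def)
    also have "\<dots> = X (F' 0 + \<epsilon> * (i mod c))"
      using \<epsilon>(2)[of "nat (i mod c)"] c_ge_3 by (simp add: X_eq_iff nat_le_iff pos_mod_bound less_imp_le)
    also have "\<dots> = X (F' 0 + \<epsilon> * i)"
    proof -
      have "c dvd \<epsilon> * (i mod c - i)" by (intro dvd_mult) (simp add: mod_eq_dvd_iff[symmetric])
      then show ?thesis by (simp add: X_eq_iff algebra_simps)
    qed
    finally show ?thesis .
  qed
  then show ?thesis using that \<epsilon>(1) by blast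
qed

end

text \<open>Connectedness enters in the proof of \<open>pendant\<close>: an isolated vertex, or two
  adjacent vertices of degree one, would be a closed set from which the cycle cannot be
  reached.\<close>

lemma sunshine_imp_sun:
  assumes sun: "sunshine G" and cyc: "cycle_labelling (skeleton G) c x"
  shows "sun G (int c) (\<lambda>i. x (nat (i mod int c)))"
proof -
  let ?X = "\<lambda>i. x (nat (i mod int c))"
  have G: "pair_graph G" and conn: "Digraph_Component.connected (with_proj G)"
    using sun by (auto simp: sunshine_def)
  have IC: "int_cycle (skeleton G) (int c) ?X" by (rule cycle_labelling_imp_int_cycle[OF cyc])
  then have eq: "?X i = ?X j \<longleftrightarrow> int c dvd i - j" for i j unfolding int_cycle_def by blast
  have c3: "3 \<le> int c" using IC by (simp add: int_cycle_def)
  have sk: "pverts (skeleton G) = {t \<in> pverts G. 2 \<le> deg G t}"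
    by (auto simp: skeleton_def vdegree_eq_deg)
  have rng: "range ?X = {t \<in> pverts G. 2 \<le> deg G t}"
    using IC sk unfolding int_cycle_def by simp
  have mem: "?X i \<in> pverts G" "2 \<le> deg G (?X i)" for i
    using rng by (auto simp: set_eq_iff)
  have parcs: "parcs (skeleton G) = {(?X i, ?X (i + 1)) | i. True} \<union> {(?X (i + 1), ?X i) | i. True}"
    using IC unfolding int_cycle_def by blast
  have nb: "?X j \<in> nbrs G (?X i) \<longleftrightarrow> int c dvd j - i - 1 \<or> int c dvd j - i + 1" for i j
  proof -
    have "?X j \<in> nbrs G (?X i) \<longleftrightarrow> (?X i, ?X j) \<in> parcs (skeleton G)"
      using mem(2)[of i] mem(2)[of j]
      by (auto simp: nbrs_def[of G "?X i"] skeleton_def parcs_delete vdegree_eq_deg simp del: One_nat_def)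
    also have "\<dots> \<longleftrightarrow> (\<exists>k. ?X i = ?X k \<and> ?X j = ?X (k + 1)) \<or> (\<exists>k. ?X i = ?X (k + 1) \<and> ?X j = ?X k)"
      unfolding parcs by blast
    also have "\<dots> \<longleftrightarrow> (\<exists>k. int c dvd i - k \<and> int c dvd j - (k + 1)) \<or> (\<exists>k. int c dvd i - (k + 1) \<and> int c dvd j - k)"
      unfolding eq ..
    also have "(\<exists>k. int c dvd i - k \<and> int c dvd j - (k + 1)) \<longleftrightarrow> int c dvd j - i - 1"
    proof
      assume "\<exists>k. int c dvd i - k \<and> int c dvd j - (k + 1)"
      then obtain k where k: "int c dvd i - k" "int c dvd j - (k + 1)" by blast
      have "int c dvd (j - (k + 1)) - (i - k)" using k(2,1) by (rule dvd_diff)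
      then show "int c dvd j - i - 1" by (simp add: algebra_simps)
    next
      assume "int c dvd j - i - 1"
      then show "\<exists>k. int c dvd i - k \<and> int c dvd j - (k + 1)"
        by (intro exI[of _ i]) (simp add: algebra_simps)
    qed
    also have "(\<exists>k. int c dvd i - (k + 1) \<and> int c dvd j - k) \<longleftrightarrow> int c dvd j - i + 1"
    proof
      assume "\<exists>k. int c dvd i - (k + 1) \<and> int c dvd j - k"
      then obtain k where k: "int c dvd i - (k + 1)" "int c dvd j - k" by blast
      have "int c dvd (j - k) - (i - (k + 1))" using k(2,1) by (rule dvd_diff)
      then show "int c dvd j - i + 1" by (simp add: algebra_simps)
    next
      assume *: "int c dvd j - i + 1"
      have "i - (j + 1) = - (j - i + 1)" by simp
      then have "int c dvd i - (j + 1)" using * by (simp only: dvd_minus_iff)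
      then show "\<exists>k. int c dvd i - (k + 1) \<and> int c dvd j - k"
        by (intro exI[of _ j]) simp
    qed
    finally show ?thesis .
  qed
  have X0: "?X 0 \<in> pverts G" "2 \<le> deg G (?X 0)" using mem by blast+
  have pend: "\<exists>i. nbrs G t = {?X i}" if t: "t \<in> pverts G" "t \<notin> range ?X" for t
  proof -
    have dt: "deg G t \<le> 1" using t rng by auto
    have closed: "b \<in> K" if "(a, b) \<in> rtrancl_on (pverts G) (parcs G)" "a \<in> K"
      "\<And>p. p \<in> K \<Longrightarrow> nbrs G p \<subseteq> K" for a b K
      using that by (induction rule: rtrancl_on_induct) (auto simp: nbrs_def)
    have reach: "(t, ?X 0) \<in> rtrancl_on (pverts G) (parcs G)"
      using conn t(1) X0(1) connected_iff_rtrancl_on[OF G] by blast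
    have ne: "t \<noteq> ?X 0" using t(2) by blast
    have "nbrs G t \<noteq> {}"
    proof
      assume "nbrs G t = {}"
      then have "?X 0 \<in> {t}" using closed[OF reach, of "{t}"] by blast
      then show False using ne by simp
    qed
    then obtain p where p: "nbrs G t = {p}"
      using dt finite_nbrs[OF G] by (metis One_nat_def card_1_singletonE card_eq_0_iff le_less less_one)
    have "p \<in> range ?X"
    proof (rule ccontr)
      assume "p \<notin> range ?X"
      then have np: "?X 0 \<noteq> p" "deg G p \<le> 1"
        using X0(2) rng nbrs_subset[OF G, of t] p by auto
      have "t \<in> nbrs G p" using p nbrs_sym[OF G] by blast
      then have "nbrs G p \<subseteq> {t}"
        using np(2) finite_nbrs[OF G, of p] by (metis card_le_Suc0_iff_eq One_nat_def singleton_iff subsetI)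
      then have "?X 0 \<in> {t, p}" using closed[OF reach, of "{t, p}"] p by blast
      then show False using ne np by blast
    qed
    then show ?thesis using p by blast
  qed
  show ?thesis by (rule sun.intro[OF G c3 eq mem(1) nb pend])
qed

subsection \<open>Deleting a cycle vertex of degree two\<close>

context sun
begin

lemma delete_pendant:
  assumes "s \<notin> range X"
  shows "sun (delete_vert G s) c X"
proof (rule sun.intro[OF pair_graph_delete[OF pair_graph] c_ge_3 X_eq_iff])
  show "X i \<in> pverts (delete_vert G s)" for i
    using assms X_pverts by auto
  show "X j \<in> nbrs (delete_vert G s) (X i) \<longleftrightarrow> c dvd j - i - 1 \<or> c dvd j - i + 1" for i j
  proof -
    have "X i \<noteq> s" "X j \<noteq> s" using assms by blast+
    then show ?thesis by (simp add: nbrs_delete X_nbrs)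
  qed
  fix t assume t: "t \<in> pverts (delete_vert G s)" "t \<notin> range X"
  then obtain i where "nbrs G t = {X i}" using pendant[of t] by auto
  then show "\<exists>i. nbrs (delete_vert G s) t = {X i}"
    using t(1) assms by (auto simp: nbrs_delete)
qed

lemma deg_delete_leaf:
  assumes s: "s \<in> leaves j"
  shows "int (deg (delete_vert G s) (X i)) = d i - mark c j i"
proof -
  have "X i \<noteq> s" using s by (auto simp: leaves_iff)
  moreover have "s \<in> nbrs G (X i) \<longleftrightarrow> c dvd i - j"
    using nbrs_sym[OF pair_graph, of s "X i"] s by (simp add: leaves_iff X_eq_iff)
  ultimately show ?thesis
    using deg_delete_vert[OF pair_graph, of "X i" s] by (simp add: d_def mark_def)
qed

text \<open>Offsets are counted from \<open>\<alpha> + 1\<close>: deleting \<open>X \<alpha>\<close>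
  leaves the path \<open>X (\<alpha> + 1 + j)\<close> with \<open>0 <= j <= c - 2\<close>, whose
  last vertex is \<open>X (\<alpha> - 1)\<close>.\<close>

definition lo :: "int \<Rightarrow> int" where
  "lo \<alpha> = of_bool (d (\<alpha> + 1) = 2)"

definition hi :: "int \<Rightarrow> int" where
  "hi \<alpha> = c - 2 - of_bool (d (\<alpha> - 1) = 2)"

text \<open>The vertices of degree at least two that survive the deletion of a cycle vertex of degree two:
  a neighbour on the cycle drops out if it becomes a leaf.\<close>

definition core :: "int \<Rightarrow> 'a set" where
  "core \<alpha> = (\<lambda>j. X (\<alpha> + 1 + j)) ` {lo \<alpha>..hi \<alpha>}"

lemma core_memI: "lo \<alpha> \<le> j \<Longrightarrow> j \<le> hi \<alpha> \<Longrightarrow> X (\<alpha> + 1 + j) \<in> core \<alpha>"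
  by (simp add: core_def)

lemma lo_hi_bounds: "0 \<le> lo \<alpha>" "lo \<alpha> \<le> 1" "c - 3 \<le> hi \<alpha>" "hi \<alpha> \<le> c - 2"
  by (auto simp: lo_def hi_def)

lemma inj_on_shifted_X:
  assumes "b - a < c"
  shows "inj_on (\<lambda>j. X (s + j)) {a..b}"
proof (rule inj_onI)
  fix i j assume ij: "i \<in> {a..b}" "j \<in> {a..b}" "X (s + i) = X (s + j)"
  then have "c dvd i - j" by (simp add: X_eq_iff)
  moreover have "\<bar>i - j\<bar> < c" using ij(1,2) assms by auto
  ultimately show "i = j" using zdvd_imp_le[of c "\<bar>i - j\<bar>"] by auto
qed

lemma card_core: "int (card (core \<alpha>)) = hi \<alpha> - lo \<alpha> + 1"
proof -
  have "inj_on (\<lambda>j. X (\<alpha> + 1 + j)) {lo \<alpha>..hi \<alpha>}"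
    using inj_on_shifted_X[of "hi \<alpha>" "lo \<alpha>" "\<alpha> + 1"] lo_hi_bounds[of \<alpha>] by simp
  then have "card (core \<alpha>) = card {lo \<alpha>..hi \<alpha>}"
    unfolding core_def by (rule card_image)
  then show ?thesis using lo_hi_bounds[of \<alpha>] c_ge_3 by simp
qed

context
  fixes \<alpha> :: int
  assumes d\<alpha>: "d \<alpha> = 2"
begin

lemma leaves_empty: "leaves \<alpha> = {}"
  using card_leaves[of \<alpha>] d\<alpha> finite_leaves[of \<alpha>] by simp

lemma nbrs_X\<alpha>: "nbrs G (X \<alpha>) = {X (\<alpha> - 1), X (\<alpha> + 1)}"
  using cycle_nbrs[of \<alpha>] leaves_empty by (auto simp: leaves_def)

lemma deg_cut_cycle:
  assumes "\<not> c dvd i - \<alpha>"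
  shows "int (deg (delete_vert G (X \<alpha>)) (X i)) = d i - mark c (\<alpha> + 1) i - mark c (\<alpha> - 1) i"
proof -
  have ne: "X i \<noteq> X \<alpha>" using assms by (simp add: X_eq_iff)
  have "X \<alpha> \<in> nbrs G (X i) \<longleftrightarrow> X i \<in> {X (\<alpha> - 1), X (\<alpha> + 1)}"
    using nbrs_sym[OF pair_graph] nbrs_X\<alpha> by blast
  also have "\<dots> \<longleftrightarrow> c dvd i - (\<alpha> - 1) \<or> c dvd i - (\<alpha> + 1)" by (simp add: X_eq_iff)
  finally have *: "X \<alpha> \<in> nbrs G (X i) \<longleftrightarrow> c dvd i - (\<alpha> - 1) \<or> c dvd i - (\<alpha> + 1)" .
  have "\<not> (c dvd i - (\<alpha> - 1) \<and> c dvd i - (\<alpha> + 1))"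
  proof
    assume "c dvd i - (\<alpha> - 1) \<and> c dvd i - (\<alpha> + 1)"
    then have "c dvd (i - (\<alpha> - 1)) - (i - (\<alpha> + 1))" using dvd_diff by blast
    then show False using small_not_dvd[of 2] c_ge_3 by simp
  qed
  then show ?thesis
    unfolding deg_delete_vert[OF pair_graph ne] * by (auto simp: d_def mark_def)
qed

lemma nbrs_cut_pendant:
  assumes "t \<in> pverts G" "t \<notin> range X"
  shows "nbrs (delete_vert G (X \<alpha>)) t = nbrs G t"
proof -
  have "t \<noteq> X \<alpha>" using assms by blast
  moreover have "X \<alpha> \<notin> nbrs G t"
    using assms nbrs_X\<alpha> nbrs_sym[OF pair_graph, of "X \<alpha>" t] by auto
  ultimately show ?thesis by (simp add: nbrs_delete)
qed

lemma cut_cases: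
  assumes "t \<in> pverts (delete_vert G (X \<alpha>))"
  obtains (pendant) "t \<notin> range X" | (cycle) j where "t = X (\<alpha> + 1 + j)" "0 \<le> j" "j \<le> c - 2"
proof (cases "t \<in> range X")
  case True
  then obtain i where i: "t = X i" by auto
  let ?j = "(i - \<alpha> - 1) mod c"
  have j: "0 \<le> ?j" "?j < c" using c_ge_3 by auto
  have t: "t = X (\<alpha> + 1 + ?j)"
  proof -
    have "c dvd ?j - (i - \<alpha> - 1)" by (simp add: mod_eq_dvd_iff[symmetric])
    then have "c dvd \<alpha> + 1 + ?j - i" by (simp add: algebra_simps)
    then show ?thesis using i by (simp add: X_eq_iff dvd_diff_commute)
  qed
  have "?j \<noteq> c - 1"
  proof
    assume "?j = c - 1"
    then have "t = X (\<alpha> + c)" using t by simp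
    then show False using assms by simp
  qed
  then show ?thesis using cycle t j by simp
qed (use pendant in blast)

lemma deg_cut_spine:
  assumes "0 \<le> j" "j \<le> c - 2"
  shows "int (deg (delete_vert G (X \<alpha>)) (X (\<alpha> + 1 + j))) =
    d (\<alpha> + 1 + j) - of_bool (j = 0) - of_bool (j = c - 2)"
proof -
  have "\<not> c dvd \<alpha> + 1 + j - \<alpha>" using small_not_dvd[of "1 + j"] assms by simp
  moreover have "mark c (\<alpha> + 1) (\<alpha> + 1 + j) = of_bool (j = 0)"
    using small_not_dvd[of j] assms by (auto simp: mark_def)
  moreover have "mark c (\<alpha> - 1) (\<alpha> + 1 + j) = of_bool (j = c - 2)"
    using small_not_dvd[of "j + 2"] assms by (auto simp: mark_def algebra_simps)
  ultimately show ?thesis by (simp add: deg_cut_cycle)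
qed

lemma deg_cut_ge_2_iff:
  assumes t: "t \<in> pverts (delete_vert G (X \<alpha>))"
  shows "2 \<le> deg (delete_vert G (X \<alpha>)) t \<longleftrightarrow> t \<in> core \<alpha>"
  using t
proof (cases rule: cut_cases)
  case pendant
  then have "deg (delete_vert G (X \<alpha>)) t = 1"
    using t pendant_deg by (simp add: nbrs_cut_pendant)
  then show ?thesis using pendant by (auto simp: core_def)
next
  case (cycle j)
  have "X (\<alpha> + 1 + j) = X (\<alpha> + 1 + k) \<longleftrightarrow> j = k" if "k \<in> {lo \<alpha>..hi \<alpha>}" for k
    using inj_on_shifted_X[of "c - 2" 0 "\<alpha> + 1"] cycle that lo_hi_bounds[of \<alpha>]
    by (auto simp: inj_on_def)
  then have "t \<in> core \<alpha> \<longleftrightarrow> j \<in> {lo \<alpha>..hi \<alpha>}"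
    unfolding cycle(1) core_def image_iff by metis
  also have "\<dots> \<longleftrightarrow> 2 \<le> int (deg (delete_vert G (X \<alpha>)) t)"
  proof -
    have "\<alpha> + 1 + (c - 2) = (\<alpha> - 1) + c" by simp
    then have "d (\<alpha> + 1 + (c - 2)) = d (\<alpha> - 1)" by (simp only: d_add_c)
    then show ?thesis
      unfolding cycle(1) deg_cut_spine[OF cycle(2,3)]
      using cycle d_ge_2[of "\<alpha> + 1 + j"] c_ge_3
      by (cases "j = 0"; cases "j = c - 2") (auto simp: lo_def hi_def)
  qed
  finally show ?thesis by simp
qed

lemma deg_cut_ge_1:
  assumes t: "t \<in> pverts (delete_vert G (X \<alpha>))"
  shows "1 \<le> deg (delete_vert G (X \<alpha>)) t"
  using t
proof (cases rule: cut_cases)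
  case pendant
  then show ?thesis using t pendant_deg by (simp add: nbrs_cut_pendant)
next
  case (cycle j)
  then show ?thesis
    using deg_cut_spine[of j] d_ge_2[of "\<alpha> + 1 + j"] c_ge_3
    by (cases "j = 0"; cases "j = c - 2") auto
qed

lemma spine_step:
  assumes "0 \<le> j" "j < c - 2"
  shows "X (\<alpha> + 1 + (j + 1)) \<in> nbrs (delete_vert G (X \<alpha>)) (X (\<alpha> + 1 + j))"
    "X (\<alpha> + 1 + j) \<in> nbrs (delete_vert G (X \<alpha>)) (X (\<alpha> + 1 + (j + 1)))"
proof -
  have "X (\<alpha> + 1 + j) \<noteq> X \<alpha>" "X (\<alpha> + 1 + (j + 1)) \<noteq> X \<alpha>"
    using small_not_dvd[of "j + 1"] small_not_dvd[of "j + 2"] assms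
    by (simp_all add: X_eq_iff algebra_simps)
  then show "X (\<alpha> + 1 + (j + 1)) \<in> nbrs (delete_vert G (X \<alpha>)) (X (\<alpha> + 1 + j))"
    by (simp add: nbrs_delete X_nbrs)
  then show "X (\<alpha> + 1 + j) \<in> nbrs (delete_vert G (X \<alpha>)) (X (\<alpha> + 1 + (j + 1)))"
    using nbrs_sym[OF pair_graph_delete[OF pair_graph]] by blast
qed

text \<open>Every other vertex of the core has its predecessor and its successor on the path as core
  neighbours.\<close>

lemma core_end:
  assumes p: "p \<in> core \<alpha>" and one: "card (nbrs (delete_vert G (X \<alpha>)) p \<inter> core \<alpha>) \<le> 1"
  shows "p \<in> {X (\<alpha> + 1 + lo \<alpha>), X (\<alpha> + 1 + hi \<alpha>)}"
proof (rule ccontr)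
  assume np: "\<not> ?thesis"
  obtain j where j: "p = X (\<alpha> + 1 + j)" "lo \<alpha> \<le> j" "j \<le> hi \<alpha>" using p by (auto simp: core_def)
  then have j': "lo \<alpha> < j" "j < hi \<alpha>" using np by (auto simp: order.strict_iff_order)
  let ?a = "X (\<alpha> + 1 + (j + 1))" and ?b = "X (\<alpha> + 1 + (j - 1))"
  have "?a \<in> core \<alpha>" "?b \<in> core \<alpha>" using j' by (intro core_memI; simp)+
  moreover have "?a \<in> nbrs (delete_vert G (X \<alpha>)) p" "?b \<in> nbrs (delete_vert G (X \<alpha>)) p"
    using spine_step(1)[of j] spine_step(2)[of "j - 1"] j j' lo_hi_bounds[of \<alpha>] by simp_all
  ultimately have "{?a, ?b} \<subseteq> nbrs (delete_vert G (X \<alpha>)) p \<inter> core \<alpha>" by blast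
  then have "card {?a, ?b} \<le> card (nbrs (delete_vert G (X \<alpha>)) p \<inter> core \<alpha>)"
    using finite_nbrs[OF pair_graph_delete[OF pair_graph]] by (intro card_mono) auto
  moreover have "?a \<noteq> ?b" using small_not_dvd[of 2] c_ge_3 by (simp add: X_eq_iff)
  ultimately show False using one by simp
qed

text \<open>Since \<open>lo\<close> is at most 1 and \<open>hi\<close> at least
  \<open>c - 3\<close>, the core has two vertices as soon as \<open>5 <= c\<close>.\<close>

lemma core_has_core_nbr:
  assumes p: "p \<in> core \<alpha>" and c: "5 \<le> c"
  shows "nbrs (delete_vert G (X \<alpha>)) p \<inter> core \<alpha> \<noteq> {}"
proof -
  obtain j where j: "p = X (\<alpha> + 1 + j)" "lo \<alpha> \<le> j" "j \<le> hi \<alpha>" using p by (auto simp: core_def)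
  show ?thesis
  proof (cases "j < hi \<alpha>")
    case True
    then have "X (\<alpha> + 1 + (j + 1)) \<in> nbrs (delete_vert G (X \<alpha>)) p" "X (\<alpha> + 1 + (j + 1)) \<in> core \<alpha>"
      using spine_step(1)[of j] j lo_hi_bounds[of \<alpha>] core_memI[of \<alpha> "j + 1"] by auto
    then show ?thesis by blast
  next
    case False
    then have "X (\<alpha> + 1 + (j - 1)) \<in> nbrs (delete_vert G (X \<alpha>)) p" "X (\<alpha> + 1 + (j - 1)) \<in> core \<alpha>"
      using spine_step(2)[of "j - 1"] j c lo_hi_bounds[of \<alpha>] core_memI[of \<alpha> "j - 1"] by auto
    then show ?thesis by blast
  qed
qed

lemma X\<alpha>_notin_core: "X \<alpha> \<notin> core \<alpha>"
proof
  assume "X \<alpha> \<in> core \<alpha>"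
  then obtain j where "X \<alpha> = X (\<alpha> + 1 + j)" "lo \<alpha> \<le> j" "j \<le> hi \<alpha>" by (auto simp: core_def)
  then have "X (\<alpha> + 1 + j) = X \<alpha>" "0 < 1 + j" "1 + j < c" using lo_hi_bounds[of \<alpha>] by auto
  then show False using small_not_dvd[of "1 + j"] by (simp add: X_eq_iff)
qed

lemma core_pverts: "core \<alpha> \<subseteq> pverts (delete_vert G (X \<alpha>))"
  using X\<alpha>_notin_core X_pverts unfolding core_def pverts_delete by blast

end

end

text \<open>Counting the vertices that become isolated determines how many neighbours of a deleted vertex
  are leaves.\<close>

lemma iso_isolated:
  assumes G: "pair_graph G" and H: "pair_graph H"
    and f: "graph_iso f (delete_vert G a) (delete_vert H b)"
    and degG: "\<And>t. t \<in> pverts G \<Longrightarrow> 1 \<le> deg G t" and degH: "\<And>t. t \<in> pverts H \<Longrightarrow> 1 \<le> deg H t"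
  shows "card {t \<in> nbrs G a. deg G t = 1} = card {t \<in> nbrs H b. deg H t = 1}"
proof -
  have isolated: "{t \<in> pverts (delete_vert K s). nbrs (delete_vert K s) t = {}} = {t \<in> nbrs K s. deg K t = 1}"
    if K: "pair_graph K" and degK: "\<And>t. t \<in> pverts K \<Longrightarrow> 1 \<le> deg K t" for K :: "'c pair_pre_digraph" and s
  proof (intro equalityI subsetI)
    fix t assume "t \<in> {t \<in> pverts (delete_vert K s). nbrs (delete_vert K s) t = {}}"
    then have "t \<in> pverts K" "nbrs K t \<subseteq> {s}" by (auto simp: nbrs_delete)
    moreover have "nbrs K t \<noteq> {}" using degK[of t] \<open>t \<in> pverts K\<close> by auto
    ultimately have "nbrs K t = {s}" by blast
    then show "t \<in> {t \<in> nbrs K s. deg K t = 1}" using nbrs_sym[OF K] by auto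
  next
    fix t assume "t \<in> {t \<in> nbrs K s. deg K t = 1}"
    then have t: "t \<in> nbrs K s" "deg K t = 1" by auto
    then have "s \<in> nbrs K t" using nbrs_sym[OF K] by blast
    then have "nbrs K t = {s}" using t(2) by (metis card_1_singletonE singletonD)
    moreover have "t \<noteq> s" "t \<in> pverts K" using t(1) not_in_own_nbrs[OF K] nbrs_subset[OF K] by auto
    ultimately show "t \<in> {t \<in> pverts (delete_vert K s). nbrs (delete_vert K s) t = {}}"
      by (simp add: nbrs_delete)
  qed
  let ?G = "delete_vert G a" and ?H = "delete_vert H b"
  have "{t \<in> pverts ?H. nbrs ?H t = {}} = f ` {t \<in> pverts ?G. nbrs ?G t = {}}"
    using iso_pverts[OF pair_graph_delete[OF G] f] iso_nbrs[OF pair_graph_delete[OF G] f] by auto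
  moreover have "inj_on f {t \<in> pverts ?G. nbrs ?G t = {}}"
    using iso_inj[OF pair_graph_delete[OF G] f] by (rule inj_on_subset) auto
  ultimately have "card {t \<in> pverts ?H. nbrs ?H t = {}} = card {t \<in> pverts ?G. nbrs ?G t = {}}"
    by (simp add: card_image)
  then show ?thesis using isolated[OF G degG, of a] isolated[OF H degH, of b] by simp
qed

subsection \<open>Common cards and the alignment of their cores\<close>

text \<open>Here \<open>orient\<close> normalises the direction of the labelling. It rules out one
  of the two possible one-place shifts between the words of a card of \<open>U\<close> and a card of
  \<open>T\<close>.\<close>

locale sun_pair = sun G c X for G :: "'a pair_pre_digraph" and c X +
  fixes w v :: 'a and \<nu> :: int
  assumes w_leaf: "w \<in> leaves 0" and v_eq: "v = X \<nu>" and d_\<nu>: "d \<nu> = 2"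
    and orient: "d (\<nu> + 1) \<le> d (\<nu> - 1)"
begin

abbreviation U\<^sub>0 :: "'a pair_pre_digraph" where "U\<^sub>0 \<equiv> delete_vert G w"
abbreviation T\<^sub>0 :: "'a pair_pre_digraph" where "T\<^sub>0 \<equiv> delete_vert G v"

lemma w_facts: "w \<in> pverts G" "w \<notin> range X" "nbrs G w = {X 0}"
  using w_leaf by (auto simp: leaves_iff)

sublocale U: sun U\<^sub>0 c X
  by (rule delete_pendant) (rule w_facts)

lemma Ud_eq: "U.d i = d i - mark c 0 i"
  using deg_delete_leaf[OF w_leaf] by (simp add: U.d_def)

lemma pair_graph_T: "pair_graph T\<^sub>0"
  by (rule pair_graph_delete[OF pair_graph])

lemma deg_T_ge_2_iff: "t \<in> pverts T\<^sub>0 \<Longrightarrow> 2 \<le> deg T\<^sub>0 t \<longleftrightarrow> t \<in> core \<nu>"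
  and deg_T_ge_1: "t \<in> pverts T\<^sub>0 \<Longrightarrow> 1 \<le> deg T\<^sub>0 t"
  using deg_cut_ge_2_iff[OF d_\<nu>] deg_cut_ge_1[OF d_\<nu>] by (simp_all add: v_eq)

context
  fixes a b f
  assumes a: "a \<in> pverts U\<^sub>0" and b: "b \<in> pverts T\<^sub>0"
    and f: "graph_iso f (delete_vert U\<^sub>0 a) (delete_vert T\<^sub>0 b)"
begin

text \<open>Deleting \<open>w\<close> costs one edge of \<open>G\<close> and deleting
  \<open>v\<close> two, so \<open>U\<close> has one edge more than \<open>T\<close>, while
  isomorphic cards have equally many.\<close>

lemma matched_deg: "deg U\<^sub>0 a = deg T\<^sub>0 b + 1"
proof -
  have "deg G w = 1" using w_facts by simp
  moreover have "deg G v = 2" using d_\<nu> by (simp add: v_eq d_def)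
  moreover have "card (parcs (delete_vert T\<^sub>0 b)) = card (parcs (delete_vert U\<^sub>0 a))"
    using iso_card_parcs[OF pair_graph_delete[OF U.pair_graph] f] .
  ultimately show ?thesis
    using card_parcs_delete_vert[OF pair_graph w_facts(1)]
      card_parcs_delete_vert[OF pair_graph, of v] X_pverts[of \<nu>]
      card_parcs_delete_vert[OF U.pair_graph a] card_parcs_delete_vert[OF pair_graph_T b]
    by (simp add: v_eq)
qed

lemma matched_cycle: "a \<in> range X"
  using matched_deg deg_T_ge_1[OF b] U.deg_ge_2_iff[OF a] by simp

text \<open>Isolated vertices are counted on both cards: the cycle vertex \<open>a\<close> leaves
  \<open>deg a - 2\<close> of them, and \<open>b\<close> leaves one for each neighbour outside the
  core. With \<open>deg a = deg b + 1\<close> exactly one neighbour of \<open>b\<close> lies in the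
  core.\<close>

lemma matched_one_core_nbr: "card (nbrs T\<^sub>0 b \<inter> core \<nu>) = 1"
proof -
  obtain i where i: "a = X i" using matched_cycle by auto
  have "{t \<in> nbrs U\<^sub>0 a. deg U\<^sub>0 t = 1} = U.leaves i"
  proof -
    have "deg U\<^sub>0 t = 1 \<longleftrightarrow> t \<notin> range X" if "t \<in> nbrs U\<^sub>0 a" for t
      using that nbrs_subset[OF U.pair_graph, of a] U.deg_ge_2_iff[of t] U.pendant_deg[of t] by fastforce
    then show ?thesis by (auto simp: U.leaves_def i)
  qed
  moreover have "{t \<in> nbrs T\<^sub>0 b. deg T\<^sub>0 t = 1} = nbrs T\<^sub>0 b - core \<nu>"
  proof -
    have "deg T\<^sub>0 t = 1 \<longleftrightarrow> t \<notin> core \<nu>" if "t \<in> nbrs T\<^sub>0 b" for t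
      using that nbrs_subset[OF pair_graph_T, of b] deg_T_ge_2_iff[of t] deg_T_ge_1[of t] by fastforce
    then show ?thesis by auto
  qed
  moreover have "card {t \<in> nbrs U\<^sub>0 a. deg U\<^sub>0 t = 1} = card {t \<in> nbrs T\<^sub>0 b. deg T\<^sub>0 t = 1}"
    by (rule iso_isolated[OF U.pair_graph pair_graph_T f U.deg_ge_1 deg_T_ge_1])
  ultimately have "card (U.leaves i) = card (nbrs T\<^sub>0 b - core \<nu>)" by simp
  moreover have "int (card (U.leaves i)) = int (deg U\<^sub>0 a) - 2"
    using U.card_leaves[of i] by (simp add: U.d_def i)
  moreover have "deg T\<^sub>0 b = card (nbrs T\<^sub>0 b \<inter> core \<nu>) + card (nbrs T\<^sub>0 b - core \<nu>)"
    using finite_nbrs[OF pair_graph_T] by (simp add: card_Int_Diff)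
  ultimately show ?thesis using matched_deg by linarith
qed

lemma matched_nonleaf:
  assumes "2 \<le> deg T\<^sub>0 b"
  shows "b \<in> {X (\<nu> + 1 + lo \<nu>), X (\<nu> + 1 + hi \<nu>)}"
  using core_end[OF d_\<nu>, of b] matched_one_core_nbr assms deg_T_ge_2_iff[OF b] by (simp add: v_eq)

text \<open>If \<open>p\<close> has degree two, one of its two neighbours is the leaf
  \<open>b\<close>; at most one core neighbour remains, so \<open>p\<close> is an end of the
  core.\<close>

lemma matched_leaf:
  assumes "deg T\<^sub>0 b = 1"
  obtains p where "nbrs T\<^sub>0 b = {p}" "p \<in> core \<nu>" "2 \<le> deg T\<^sub>0 p"
    "deg T\<^sub>0 p = 2 \<Longrightarrow> p \<in> {X (\<nu> + 1 + lo \<nu>), X (\<nu> + 1 + hi \<nu>)}"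
proof -
  obtain p where p: "nbrs T\<^sub>0 b = {p}" using assms by (rule card_1_singletonE)
  then have core: "p \<in> core \<nu>" using matched_one_core_nbr by (cases "p \<in> core \<nu>") auto
  have pv: "p \<in> pverts T\<^sub>0" using p nbrs_subset[OF pair_graph_T, of b] by auto
  have b_nbr: "b \<in> nbrs T\<^sub>0 p" using p nbrs_sym[OF pair_graph_T, of p b] by simp
  have "b \<notin> core \<nu>" using assms deg_T_ge_2_iff[OF b] by simp
  then have "nbrs T\<^sub>0 p \<inter> core \<nu> \<subseteq> nbrs T\<^sub>0 p - {b}" by blast
  then have "card (nbrs T\<^sub>0 p \<inter> core \<nu>) \<le> deg T\<^sub>0 p - 1"
    using b_nbr finite_nbrs[OF pair_graph_T] card_mono[of "nbrs T\<^sub>0 p - {b}"]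
    by (simp add: card_Diff_singleton)
  then have "p \<in> {X (\<nu> + 1 + lo \<nu>), X (\<nu> + 1 + hi \<nu>)}" if "deg T\<^sub>0 p = 2"
    using core_end[OF d_\<nu> core] that by (simp add: v_eq)
  then show ?thesis using that p core deg_T_ge_2_iff[OF pv] by blast
qed

end

context
  fixes \<alpha> :: int and b p f
  assumes b: "b \<in> pverts T\<^sub>0" and f: "graph_iso f (delete_vert U\<^sub>0 (X \<alpha>)) (delete_vert T\<^sub>0 b)"
    and p: "nbrs T\<^sub>0 b = {p}" "3 \<le> deg T\<^sub>0 p"
begin

lemma nice_Ud: "U.d \<alpha> = 2"
  using matched_deg[OF U.X_pverts b f] p(1) by (simp add: U.d_def)

lemma deg_T_delete_leaf:
  assumes "s \<noteq> b"
  shows "int (deg (delete_vert T\<^sub>0 b) s) = int (deg T\<^sub>0 s) - of_bool (s = p)"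
proof -
  have "b \<in> nbrs T\<^sub>0 s \<longleftrightarrow> s = p" using p(1) nbrs_sym[OF pair_graph_T, of b s] by auto
  then show ?thesis using deg_delete_vert[OF pair_graph_T assms] by simp
qed

lemma b_notin_core: "b \<notin> core \<nu>"
  using deg_T_ge_2_iff[OF b] p(1) by simp

lemma p_core: "p \<in> core \<nu>"
  using deg_T_ge_2_iff[of p] p nbrs_subset[OF pair_graph_T, of b] by auto

lemma lo_le_hi: "lo \<nu> \<le> hi \<nu>"
  using p_core by (auto simp: core_def)

text \<open>Cores are recognised by degree at least two. Deleting the leaf \<open>b\<close> changes
  only the degree of \<open>p\<close>, and \<open>3 <= deg p\<close> keeps \<open>p\<close> in the
  core.\<close>

lemma core_image: "f ` U.core \<alpha> = core \<nu>"
proof -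
  let ?D = "delete_vert U\<^sub>0 (X \<alpha>)" and ?E = "delete_vert T\<^sub>0 b"
  have D: "pair_graph ?D" by (rule pair_graph_delete[OF U.pair_graph])
  have E: "2 \<le> deg ?E s \<longleftrightarrow> s \<in> core \<nu>" if "s \<in> pverts ?E" for s
    using that deg_T_delete_leaf[of s] deg_T_ge_2_iff[of s] p(2) by (cases "s = p") auto
  have Dt: "2 \<le> deg ?D t \<longleftrightarrow> t \<in> U.core \<alpha>" if "t \<in> pverts ?D" for t
    using U.deg_cut_ge_2_iff[OF nice_Ud that] .
  have "U.core \<alpha> \<subseteq> pverts ?D" by (rule U.core_pverts[OF nice_Ud])
  moreover have "core \<nu> \<subseteq> f ` pverts ?D"
    using core_pverts[OF d_\<nu>] b_notin_core unfolding iso_pverts[OF D f, symmetric] by (auto simp: v_eq)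
  moreover have "f t \<in> core \<nu> \<longleftrightarrow> t \<in> U.core \<alpha>" if "t \<in> pverts ?D" for t
  proof -
    have "f t \<in> pverts ?E" unfolding iso_pverts[OF D f] using that by (rule imageI)
    then show ?thesis using E Dt[OF that] iso_deg[OF D f that] by metis
  qed
  ultimately show ?thesis by blast
qed

text \<open>The core of the card of \<open>U\<close> is a path, and \<open>f\<close> turns it into a
  walk on the cycle without repetition, hence into a walk in one direction. Equal cardinalities of
  the cores give equal lengths.\<close>

lemma core_walk:
  obtains \<epsilon> s where "\<epsilon> \<in> {1, -1}" "hi \<nu> - lo \<nu> = U.hi \<alpha> - U.lo \<alpha>"
    "\<And>k. 0 \<le> k \<Longrightarrow> k \<le> hi \<nu> - lo \<nu> \<Longrightarrow> f (X (\<alpha> + 1 + (U.lo \<alpha> + k))) = X (s + \<epsilon> * k)"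
proof -
  let ?D = "delete_vert U\<^sub>0 (X \<alpha>)" and ?E = "delete_vert T\<^sub>0 b"
  let ?Y = "\<lambda>k. X (\<alpha> + 1 + (U.lo \<alpha> + k))"
  have D: "pair_graph ?D" by (rule pair_graph_delete[OF U.pair_graph])
  have sub: "U.core \<alpha> \<subseteq> pverts ?D" by (rule U.core_pverts[OF nice_Ud])
  have inj: "inj_on f (U.core \<alpha>)" using iso_inj[OF D f] sub by (rule inj_on_subset)
  have "card (core \<nu>) = card (U.core \<alpha>)"
    using card_image[OF inj] by (simp add: core_image)
  then have N: "hi \<nu> - lo \<nu> = U.hi \<alpha> - U.lo \<alpha>" using card_core[of \<nu>] U.card_core[of \<alpha>] by simp
  define N where "N = nat (hi \<nu> - lo \<nu>)"
  have N_int: "int N = hi \<nu> - lo \<nu>" using lo_le_hi by (simp add: N_def)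
  have Y: "?Y k \<in> U.core \<alpha>" if "0 \<le> k" "k \<le> hi \<nu> - lo \<nu>" for k
    using that N by (intro U.core_memI) auto
  have "\<exists>i. 0 \<le> k \<and> k \<le> hi \<nu> - lo \<nu> \<longrightarrow> f (?Y k) = X i" for k
  proof (cases "0 \<le> k \<and> k \<le> hi \<nu> - lo \<nu>")
    case True
    then have "f (?Y k) \<in> core \<nu>" using Y core_image by blast
    then show ?thesis by (auto simp: core_def)
  qed blast
  then obtain F where F: "\<And>k. 0 \<le> k \<Longrightarrow> k \<le> hi \<nu> - lo \<nu> \<Longrightarrow> f (?Y k) = X (F k)" by metis
  define F' where "F' k = F (int k)" for k
  have step: "c dvd F' (Suc i) - F' i - 1 \<or> c dvd F' (Suc i) - F' i + 1" if "i < N" for i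
  proof -
    have i: "0 \<le> int i" "int i + 1 \<le> hi \<nu> - lo \<nu>" using that N_int by linarith+
    have "?Y (int i + 1) \<in> nbrs ?D (?Y (int i))"
      using U.spine_step(1)[OF nice_Ud, of "U.lo \<alpha> + int i"] i N U.lo_hi_bounds[of \<alpha>]
      by (simp add: add.assoc)
    moreover have "?Y (int i) \<in> pverts ?D" "?Y (int i + 1) \<in> pverts ?D"
      using Y[of "int i"] Y[of "int i + 1"] i sub by (simp_all add: subset_iff)
    ultimately have "f (?Y (int i + 1)) \<in> nbrs ?E (f (?Y (int i)))"
      using iso_nbrs[OF D f] by blast
    moreover have "f (?Y (int i)) = X (F' i)" "f (?Y (int i + 1)) = X (F' (Suc i))"
      using F[of "int i"] F[of "int i + 1"] i by (simp_all add: F'_def add.commute)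
    ultimately have "X (F' (Suc i)) \<in> nbrs ?E (X (F' i))" by simp
    then have "X (F' (Suc i)) \<in> nbrs G (X (F' i))"
      by (auto simp: nbrs_def parcs_delete)
    then show ?thesis by (simp add: X_nbrs)
  qed
  have turn: "\<not> c dvd F' (Suc (Suc i)) - F' i" if "Suc i < N" for i
  proof
    assume dv: "c dvd F' (Suc (Suc i)) - F' i"
    have i: "0 \<le> int i" "int i + 2 \<le> hi \<nu> - lo \<nu>" using that N_int by linarith+
    have "X (F' (Suc (Suc i))) = X (F' i)" using dv by (simp add: X_eq_iff)
    then have "f (?Y (int i + 2)) = f (?Y (int i))"
      using F[of "int i"] F[of "int i + 2"] i by (simp add: F'_def add.commute)
    then have "?Y (int i + 2) = ?Y (int i)"
      by (rule inj_onD[OF inj]) (use Y[of "int i"] Y[of "int i + 2"] i in simp_all)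
    then show False using small_not_dvd[of 2] c_ge_3 by (simp add: X_eq_iff)
  qed
  obtain \<epsilon> :: int where \<epsilon>: "\<epsilon> \<in> {1, -1}" "\<And>i. i \<le> N \<Longrightarrow> c dvd F' i - (F' 0 + \<epsilon> * int i)"
    using walk_keeps_direction[of N c F', OF step turn] by blast
  have "f (?Y k) = X (F' 0 + \<epsilon> * k)" if k: "0 \<le> k" "k \<le> hi \<nu> - lo \<nu>" for k
  proof -
    have "c dvd F k - (F' 0 + \<epsilon> * k)" using \<epsilon>(2)[of "nat k"] k N_int by (simp add: F'_def)
    then show ?thesis using F[OF k] by (simp add: X_eq_iff)
  qed
  then show ?thesis using that \<epsilon>(1) N by blast
qed

text \<open>After a reflection of the labels on the side of \<open>U\<^sub>0\<close> the two cores are traversed in the same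
  direction.\<close>

lemma core_alignment:
  obtains \<epsilon> :: int and o' l' where "\<epsilon> \<in> {1, -1}"
    "o' = of_bool (U.d (\<alpha> + \<epsilon>) = 2)" "l' = c - 2 - of_bool (U.d (\<alpha> - \<epsilon>) = 2)" "l' - o' = hi \<nu> - lo \<nu>"
    "\<And>k. 0 \<le> k \<Longrightarrow> k \<le> hi \<nu> - lo \<nu> \<Longrightarrow> f (X (\<alpha> + \<epsilon> * (1 + o' + k))) = X (\<nu> + 1 + lo \<nu> + k)"
proof -
  obtain \<epsilon> s where \<epsilon>: "\<epsilon> \<in> {1, -1}" and N: "hi \<nu> - lo \<nu> = U.hi \<alpha> - U.lo \<alpha>"
    and fk: "\<And>k. 0 \<le> k \<Longrightarrow> k \<le> hi \<nu> - lo \<nu> \<Longrightarrow> f (X (\<alpha> + 1 + (U.lo \<alpha> + k))) = X (s + \<epsilon> * k)"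
    by (rule core_walk) (rule that)
  let ?N = "hi \<nu> - lo \<nu>"
  have N0: "0 \<le> ?N"
    using lo_le_hi by simp
  have NN: "?N \<le> c - 2" using lo_hi_bounds[of \<nu>] by simp
  have core_s: "core \<nu> = (\<lambda>k. X (s + \<epsilon> * k)) ` {0..?N}"
  proof -
    have "U.core \<alpha> = (\<lambda>k. X (\<alpha> + 1 + (U.lo \<alpha> + k))) ` {0..?N}"
    proof -
      have "{U.lo \<alpha>..U.hi \<alpha>} = (\<lambda>k. U.lo \<alpha> + k) ` {0..?N}" using N by simp
      then show ?thesis by (simp only: U.core_def image_image)
    qed
    then have "core \<nu> = (\<lambda>k. f (X (\<alpha> + 1 + (U.lo \<alpha> + k)))) ` {0..?N}"
      by (simp only: core_image[symmetric] image_image)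
    also have "\<dots> = (\<lambda>k. X (s + \<epsilon> * k)) ` {0..?N}"
      by (rule image_cong) (auto simp: fk)
    finally show ?thesis .
  qed
  \<comment> \<open>The image has at most \<open>c - 1\<close> vertices and does not wrap around to
    the position before its start. So \<open>X s\<close> is an end of the core, the lower one for
    \<open>\<epsilon> = 1\<close> and the upper one for \<open>\<epsilon> = -1\<close>.\<close>
  have start: "X (s - \<epsilon>) \<notin> core \<nu>"
  proof
    assume "X (s - \<epsilon>) \<in> core \<nu>"
    then obtain k where k: "0 \<le> k" "k \<le> ?N" "c dvd s - \<epsilon> - (s + \<epsilon> * k)"
      by (auto simp: core_s X_eq_iff)
    have "c dvd 1 + k" using k(3) \<epsilon> by (auto simp: algebra_simps dvd_diff_commute)
    then show False using small_not_dvd[of "1 + k"] k NN by simp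
  qed
  have "X s \<in> core \<nu>" unfolding core_s using N0 by (intro image_eqI[of _ _ 0]) auto
  then obtain j where j: "X s = X (\<nu> + 1 + j)" "lo \<nu> \<le> j" "j \<le> hi \<nu>" by (auto simp: core_def)
  have shift: "X (s + i) = X (\<nu> + 1 + j + i)" for i
    using j(1) by (simp add: X_eq_iff)
  show ?thesis
  proof (cases "\<epsilon> = 1")
    case True
    have "j = lo \<nu>"
    proof (rule ccontr)
      assume "j \<noteq> lo \<nu>"
      then have "X (\<nu> + 1 + (j - 1)) \<in> core \<nu>" using j by (intro core_memI) auto
      then show False using start shift[of "-1"] True by (simp add: algebra_simps)
    qed
    show ?thesis
    proof (rule that[of 1 "U.lo \<alpha>" "U.hi \<alpha>"])
      show "f (X (\<alpha> + 1 * (1 + U.lo \<alpha> + k))) = X (\<nu> + 1 + lo \<nu> + k)" if "0 \<le> k" "k \<le> hi \<nu> - lo \<nu>" for k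
        using fk[OF that] shift[of k] True \<open>j = lo \<nu>\<close> by (simp add: add.assoc)
    qed (use N in \<open>simp_all add: U.lo_def U.hi_def\<close>)
  next
    case False
    then have e: "\<epsilon> = -1" using \<epsilon> by simp
    have "j = hi \<nu>"
    proof (rule ccontr)
      assume "j \<noteq> hi \<nu>"
      then have "X (\<nu> + 1 + (j + 1)) \<in> core \<nu>" using j by (intro core_memI) auto
      then show False using start shift[of 1] e by (simp add: algebra_simps)
    qed
    show ?thesis
    \<comment> \<open>Reversing the path turns the offset \<open>j\<close> into
      \<open>c - 2 - j\<close>, which exchanges the roles of \<open>lo\<close> and
      \<open>hi\<close>.\<close>
    proof (rule that[of "-1" "c - 2 - U.hi \<alpha>" "c - 2 - U.lo \<alpha>"])
      show "f (X (\<alpha> + -1 * (1 + (c - 2 - U.hi \<alpha>) + k))) = X (\<nu> + 1 + lo \<nu> + k)"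
        if k: "0 \<le> k" "k \<le> hi \<nu> - lo \<nu>" for k
      proof -
        have "X (\<alpha> + -1 * (1 + (c - 2 - U.hi \<alpha>) + k)) = X (\<alpha> + 1 + (U.lo \<alpha> + (?N - k)))"
          unfolding N by (simp add: X_eq_iff)
        also have "f \<dots> = X (s - (?N - k))" using fk[of "?N - k"] k e by (simp add: algebra_simps)
        also have "\<dots> = X (\<nu> + 1 + lo \<nu> + k)"
          using shift[of "- (?N - k)"] \<open>j = hi \<nu>\<close> by (simp add: algebra_simps)
        finally show ?thesis .
      qed
    qed (use N in \<open>simp_all add: U.lo_def U.hi_def\<close>)
  qed
qed

end

end

section \<open>Degree words read off from a matched card\<close>

lemma mark_mod: "mark c y (i mod c) = mark c y i"
  by (simp add: mark_def mod_eq_dvd_iff[symmetric])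

lemma mark_small: "\<bar>i - y\<bar> < c \<Longrightarrow> mark c y i = of_bool (i = y)"
  using zdvd_imp_le[of c "\<bar>i - y\<bar>"] by (auto simp: mark_def)

lemma mark_reflect: "\<epsilon> \<in> {1, -1} \<Longrightarrow> mark c (a + \<epsilon> * y) (a + \<epsilon> * i) = mark c y i"
  by (auto simp: mark_def dvd_diff_commute)

context sun_pair
begin

text \<open>The two ways, up to reflection, in which \<open>T\<^sub>0\<close> can be completed to a cyclic degree word. The
  second one arises when \<open>X (\<nu> + 1)\<close> becomes a leaf, so that this leaf may be traded for one at the
  other end of the core.\<close>

definition completion :: "int \<Rightarrow> int \<Rightarrow> int" where
  "completion \<tau> J = d (\<nu> + \<tau> + J) + \<tau> * (mark c 1 J - mark c (-2) J)"

lemma completion_mod: "completion \<tau> (J mod c) = completion \<tau> J"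
proof -
  have "c dvd \<nu> + \<tau> + J mod c - (\<nu> + \<tau> + J)" by (simp add: mod_eq_dvd_iff[symmetric])
  then show ?thesis by (simp add: completion_def mark_mod d_cong)
qed

text \<open>On the aligned cores the isomorphism equates degrees. Correcting both sides for the
  deleted cycle vertices, and the side of \<open>T\<close> for its leaf \<open>b\<close> at
  \<open>p\<close>, turns this into an equation of words with one mark. The few positions outside
  the core carry degree two on both sides.\<close>

lemma matched_word:
  assumes b: "b \<in> pverts T\<^sub>0" and f: "graph_iso f (delete_vert U\<^sub>0 (X \<alpha>)) (delete_vert T\<^sub>0 b)"
    and p: "nbrs T\<^sub>0 b = {p}" "3 \<le> deg T\<^sub>0 p"
  obtains \<epsilon> \<tau> K :: int where "\<epsilon> \<in> {1, -1}" "\<tau> \<in> {0, 1}"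
    "\<tau> = 1 \<Longrightarrow> d (\<nu> + 1) = 2 \<and> 3 \<le> d (\<nu> - 1)"
    "\<And>J. U.d (\<alpha> + \<epsilon> * J) + mark c K J = completion \<tau> J"
    "p = X (\<nu> + \<tau> + K)" "f (X (\<alpha> + \<epsilon> * K)) = p" "\<not> c dvd K"
proof -
  let ?D = "delete_vert U\<^sub>0 (X \<alpha>)" and ?E = "delete_vert T\<^sub>0 b"
  have D: "pair_graph ?D" by (rule pair_graph_delete[OF U.pair_graph])
  have U\<alpha>: "U.d \<alpha> = 2" by (rule nice_Ud[OF b f p])
  obtain \<epsilon> :: int and o' l' where \<epsilon>: "\<epsilon> \<in> {1, -1}"
    and o': "o' = of_bool (U.d (\<alpha> + \<epsilon>) = 2)" and l': "l' = c - 2 - of_bool (U.d (\<alpha> - \<epsilon>) = 2)"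
    and N: "l' - o' = hi \<nu> - lo \<nu>"
    and align: "\<And>k. 0 \<le> k \<Longrightarrow> k \<le> hi \<nu> - lo \<nu> \<Longrightarrow> f (X (\<alpha> + \<epsilon> * (1 + o' + k))) = X (\<nu> + 1 + lo \<nu> + k)"
    by (rule core_alignment[OF b f p]) (rule that)
  have o'_bounds: "0 \<le> o'" "o' \<le> 1" "c - 3 \<le> l'" "l' \<le> c - 2" using o' l' by auto
  \<comment> \<open>A neighbour of the cut vertex may have dropped out of one core and not of the
    other; \<open>\<tau>\<close> is the resulting shift between the starts of the cores.\<close>
  define \<tau> where "\<tau> = lo \<nu> - o'"
  obtain j where j: "p = X (\<nu> + 1 + j)" "lo \<nu> \<le> j" "j \<le> hi \<nu>"
    using p_core[OF b f p] by (auto simp: core_def)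
  define K where "K = 1 + o' + (j - lo \<nu>)"
  have pK: "p = X (\<nu> + \<tau> + K)" using j by (simp add: K_def \<tau>_def algebra_simps)
  have K_bounds: "1 + o' \<le> K" "K \<le> 1 + l'" "\<not> c dvd K"
  proof -
    show "1 + o' \<le> K" "K \<le> 1 + l'" using j N by (simp_all add: K_def)
    then show "\<not> c dvd K" using small_not_dvd[of K] o'_bounds by simp
  qed
  have fK: "f (X (\<alpha> + \<epsilon> * K)) = p"
    using align[of "j - lo \<nu>"] j by (simp add: K_def add.assoc)
  have key: "U.d (\<alpha> + \<epsilon> * J) - mark c 1 J - mark c (-1) J =
      d (\<nu> + \<tau> + J) - mark c 1 (\<tau> + J) - mark c (-1) (\<tau> + J) - mark c K J"
    if J: "1 + o' \<le> J" "J \<le> 1 + l'" for J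
  proof -
    let ?t = "X (\<alpha> + \<epsilon> * J)" and ?j = "\<nu> + \<tau> + J"
    have k: "0 \<le> J - 1 - o'" "J - 1 - o' \<le> hi \<nu> - lo \<nu>" using J N by auto
    have "\<nu> + 1 + lo \<nu> + (J - 1 - o') = ?j" "1 + o' + (J - 1 - o') = J" by (simp_all add: \<tau>_def)
    then have ft: "f ?t = X ?j" using align[OF k] by metis
    have Jc: "\<not> c dvd J" using small_not_dvd[of J] J o'_bounds by simp
    then have nd: "\<not> c dvd \<alpha> + \<epsilon> * J - \<alpha>" using \<epsilon> by auto
    then have "?t \<in> pverts ?D" using U.X_pverts by (simp add: X_eq_iff)
    then have "deg ?E (X ?j) = deg ?D ?t" using iso_deg[OF D f] ft by metis
    moreover have "int (deg ?D ?t) = U.d (\<alpha> + \<epsilon> * J) - mark c 1 J - mark c (-1) J"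
    proof -
      have "mark c (\<alpha> + 1) (\<alpha> + \<epsilon> * J) + mark c (\<alpha> - 1) (\<alpha> + \<epsilon> * J) = mark c 1 J + mark c (-1) J"
        using mark_reflect[OF \<epsilon>, of c \<alpha> 1 J] mark_reflect[OF \<epsilon>, of c \<alpha> "-1" J] \<epsilon> by auto
      then show ?thesis using U.deg_cut_cycle[OF U\<alpha> nd] by simp
    qed
    moreover have "int (deg ?E (X ?j)) = d ?j - mark c 1 (\<tau> + J) - mark c (-1) (\<tau> + J) - mark c K J"
    proof -
      have t1: "1 \<le> \<tau> + J" "\<tau> + J \<le> c - 1"
        using k lo_hi_bounds[of \<nu>] by (auto simp: \<tau>_def)
      have nd': "\<not> c dvd ?j - \<nu>" using small_not_dvd[of "\<tau> + J"] t1 by simp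
      have "X ?j \<noteq> b"
        using core_memI[of \<nu> "lo \<nu> + (J - 1 - o')"] k b_notin_core[OF b f p]
        by (auto simp: \<tau>_def algebra_simps)
      then have "int (deg ?E (X ?j)) = int (deg T\<^sub>0 (X ?j)) - of_bool (X ?j = p)"
        by (rule deg_T_delete_leaf[OF b f p])
      moreover have "of_bool (X ?j = p) = mark c K J"
        by (simp add: pK X_eq_iff mark_def)
      moreover have "int (deg T\<^sub>0 (X ?j)) = d ?j - mark c (\<nu> + 1) ?j - mark c (\<nu> - 1) ?j"
        using deg_cut_cycle[OF d_\<nu> nd'] by (simp add: v_eq)
      moreover have "mark c (\<nu> + 1) ?j = mark c 1 (\<tau> + J)" "mark c (\<nu> - 1) ?j = mark c (-1) (\<tau> + J)"
        by (simp_all add: mark_def algebra_simps)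
      ultimately show ?thesis by simp
    qed
    ultimately show ?thesis by simp
  qed
  \<comment> \<open>Equal lengths force a mismatch at the start to be undone at the end. The shift
    -1 would need \<open>d (\<nu> - 1) = 2\<close>; by \<open>orient\<close> also
    \<open>d (\<nu> + 1) = 2\<close>, and then \<open>lo \<nu>\<close> is 1 and not 0.\<close>
  have \<tau>_cases: "\<tau> = 0 \<and> l' = hi \<nu> \<or> \<tau> = 1 \<and> lo \<nu> = 1 \<and> o' = 0 \<and> hi \<nu> = c - 2 \<and> l' = c - 3"
  proof (cases "o' = lo \<nu>")
    case True
    then show ?thesis using N by (simp add: \<tau>_def)
  next
    case False
    have "lo \<nu> \<noteq> 0"
    proof
      assume lo: "lo \<nu> = 0"
      then have "hi \<nu> = c - 3" using False N o'_bounds lo_hi_bounds[of \<nu>] by linarith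
      then have "d (\<nu> - 1) = 2" by (simp add: hi_def split: if_splits)
      then have "lo \<nu> = 1" using orient d_ge_2[of "\<nu> + 1"] by (simp add: lo_def)
      then show False using lo by simp
    qed
    then have "lo \<nu> = 1" "o' = 0" using False o'_bounds lo_hi_bounds[of \<nu>] by linarith+
    then show ?thesis using N o'_bounds lo_hi_bounds[of \<nu>] by (simp add: \<tau>_def)
  qed
  have Ud_last: "U.d (\<alpha> + \<epsilon> * (c - 1)) = U.d (\<alpha> - \<epsilon>)"
    by (rule U.d_cong) (simp add: algebra_simps)
  have d_last: "d (\<nu> + i + (c - 1)) = d (\<nu> + i - 1)" for i
    by (rule d_cong) simp
  have word: "U.d (\<alpha> + \<epsilon> * J) + mark c K J = completion \<tau> J" if J: "0 \<le> J" "J \<le> c - 1" for J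
  proof (cases "1 + o' \<le> J \<and> J \<le> 1 + l'")
    case True
    from \<tau>_cases show ?thesis
    proof (elim disjE conjE)
      assume "\<tau> = 0" then show ?thesis using key[of J] True by (simp add: completion_def)
    next
      \<comment> \<open>For \<open>\<tau> = 1\<close> two corrections survive: plus one at the first
        core vertex, where the former cycle vertex now counts as a leaf, and minus one at the last,
        where a leaf takes over the cycle position. They are the marks 1 and -2 of
        \<open>completion\<close>.\<close>
      assume \<tau>: "\<tau> = 1" "o' = 0" "l' = c - 3"
      have "mark c (-1) J = 0" "mark c 1 (1 + J) = 0" "mark c (-1) (1 + J) = mark c (-2) J"
        using small_not_dvd[of "J + 1"] small_not_dvd[of J] True \<tau>
        by (simp_all add: mark_def algebra_simps)
      then show ?thesis using key[of J] True \<tau> by (simp add: completion_def)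
    qed
  next
    case False
    then have K0: "mark c K J = 0" using J K_bounds o'_bounds mark_small[of J K c] by auto
    consider "J = 0" | "J = 1" "o' = 1" | "J = c - 1" "l' = c - 3"
      using False J o'_bounds by fastforce
    then show ?thesis
    proof cases
      case 1
      have "mark c 1 0 = 0" "mark c (-2) 0 = 0"
        using mark_small[of 0 1 c] mark_small[of 0 "-2" c] c_ge_3 by auto
      then show ?thesis using 1 K0 U\<alpha> d_\<nu> \<tau>_cases
        by (auto simp: completion_def lo_def split: if_splits)
    next
      case 2
      then have \<tau>: "\<tau> = 0" "lo \<nu> = 1" using \<tau>_cases by (auto simp: \<tau>_def)
      then show ?thesis using 2 K0 o' by (simp add: completion_def lo_def split: if_splits)
    next
      case 3
      have Ud: "U.d (\<alpha> + \<epsilon> * J) = 2" using 3 l' Ud_last by (simp split: if_splits)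
      from \<tau>_cases show ?thesis
      proof (elim disjE conjE)
        assume \<tau>: "\<tau> = 0" "l' = hi \<nu>"
        then have "d (\<nu> - 1) = 2" using 3 by (simp add: hi_def split: if_splits)
        then show ?thesis using Ud K0 \<tau> 3 d_last[of 0] by (simp add: completion_def)
      next
        assume \<tau>: "\<tau> = 1" "o' = 0" "l' = c - 3"
        have "mark c 1 J = 0" using mark_small[of J 1 c] 3 c_ge_3 by auto
        moreover have "mark c (-2) J = mark c (c - 2) J" by (rule mark_cong) simp
        then have "mark c (-2) J = 0" using mark_small[of J "c - 2" c] 3 c_ge_3 by auto
        ultimately show ?thesis using Ud K0 \<tau> 3 d_last[of 1] d_\<nu> by (simp add: completion_def)
      qed
    qed
  qed
  have word': "U.d (\<alpha> + \<epsilon> * J) + mark c K J = completion \<tau> J" for J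
  proof -
    have "c dvd \<epsilon> * (J mod c - J)" by (intro dvd_mult) (simp add: mod_eq_dvd_iff[symmetric])
    then have "c dvd \<alpha> + \<epsilon> * (J mod c) - (\<alpha> + \<epsilon> * J)" by (simp add: right_diff_distrib)
    then have "U.d (\<alpha> + \<epsilon> * (J mod c)) = U.d (\<alpha> + \<epsilon> * J)" by (rule U.d_cong)
    then show ?thesis
      using word[of "J mod c"] c_ge_3 by (simp add: mark_mod completion_mod)
  qed
  have "d (\<nu> + 1) = 2 \<and> 3 \<le> d (\<nu> - 1)" if "\<tau> = 1"
  proof -
    have "lo \<nu> = 1" "hi \<nu> = c - 2" using \<tau>_cases that by auto
    then have "d (\<nu> + 1) = 2" "d (\<nu> - 1) \<noteq> 2" by (auto simp: lo_def hi_def split: if_splits)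
    then show ?thesis using d_ge_2[of "\<nu> - 1"] by simp
  qed
  moreover have "\<tau> \<in> {0, 1}" using \<tau>_cases by auto
  ultimately show ?thesis using that \<epsilon> word' pK fK K_bounds(3) by blast
qed

end

subsection \<open>Saturating sets and automorphisms\<close>

lemma finite_B_vw: "finite (pverts G) \<Longrightarrow> finite (B_vw G w v)"
  by (rule finite_subset[OF _ finite_permutations[of "pverts G"]]) (auto simp: B_vw_def)

lemma B_U_subset: "B_U G w v \<subseteq> B_vw G w v"
  by (auto simp: B_U_def)

lemma ex_max_saturating:
  assumes fin: "finite (pverts G)" and S: "S \<subseteq> B_vw G w v" "id \<in> S" "separated w v S"
  obtains X where "max_saturating G w v X" "S \<subseteq> X"
proof -
  define A where "A = {X. S \<subseteq> X \<and> X \<subseteq> B_vw G w v \<and> separated w v X}"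
  have "finite A"
    by (rule finite_subset[of _ "Pow (B_vw G w v)"]) (auto simp: A_def finite_B_vw[OF fin])
  moreover have "S \<in> A" using S by (simp add: A_def)
  ultimately obtain X where X: "X \<in> A" "\<forall>Y\<in>A. X \<subseteq> Y \<longrightarrow> X = Y"
    using finite_has_maximal2[of A S] by blast
  have "max_saturating G w v X"
    unfolding max_saturating_def
  proof (intro conjI notI)
    assume "\<exists>s\<in>B_vw G w v - X. separated w v (insert s X)"
    then obtain s where s: "s \<in> B_vw G w v - X" "separated w v (insert s X)" by blast
    then have "insert s X \<in> A" using X(1) by (auto simp: A_def)
    then show False using X(2) s(1) by blast
  qed (use X(1) S in \<open>auto simp: A_def\<close>)
  then show ?thesis using that[of X] X(1) by (simp add: A_def)
qed

lemma finite_chi_set: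
  assumes "finite (pverts G)"
  shows "finite {card (X \<inter> B_U G w v) | X. max_saturating G w v X}"
proof -
  have "{card (X \<inter> B_U G w v) | X. max_saturating G w v X} \<subseteq>
      (\<lambda>X. card (X \<inter> B_U G w v)) ` Pow (B_vw G w v)"
    by (auto simp: max_saturating_def)
  then show ?thesis by (rule finite_subset) (simp add: finite_B_vw[OF assms])
qed

lemma id_in_B_vw: "id \<in> B_vw G w v"
proof -
  have "relabel id H = H" for H :: "'a pair_pre_digraph"
    by (simp add: relabel_def map_prod.id)
  then show ?thesis by (simp add: B_vw_def permutes_id delete_verts_commute)
qed

text \<open>As \<open>B_vw\<close> is finite, a separated subset of \<open>B_U\<close> that contains
  the identity extends to a maximum saturating set.\<close>

lemma chi_ge:
  assumes fin: "finite (pverts G)" and S: "S \<subseteq> B_U G w v" "id \<in> S" "separated w v S"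
  shows "card S \<le> chi G w v"
proof -
  obtain X where X: "max_saturating G w v X" "S \<subseteq> X"
    using ex_max_saturating[OF fin _ S(2,3)] S(1) B_U_subset[of G w v] by blast
  then have "finite X" using finite_B_vw[OF fin] by (auto simp: max_saturating_def intro: finite_subset)
  then have "card S \<le> card (X \<inter> B_U G w v)" using X(2) S(1) by (intro card_mono) auto
  also have "\<dots> \<le> chi G w v"
    unfolding chi_def using X(1) finite_chi_set[OF fin] by (intro Max_ge) auto
  finally show ?thesis .
qed

lemma chi_le:
  assumes fin: "finite (pverts G)"
    and le: "\<And>X. max_saturating G w v X \<Longrightarrow> card (X \<inter> B_U G w v) \<le> k"
  shows "chi G w v \<le> k"
proof -
  obtain X where "max_saturating G w v X"
    using ex_max_saturating[OF fin, of "{id}" w v] id_in_B_vw[of G w v]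
    by (metis empty_subsetI insert_subset separated_def singletonD singletonI)
  then show ?thesis
    unfolding chi_def using le finite_chi_set[OF fin, of w v] by (subst Max_le_iff) auto
qed

lemma automorphisms_subset_B_U:
  assumes G: "pair_graph G" and wv: "w \<in> pverts G" "v \<in> pverts G"
  shows "automorphisms G \<subseteq> B_U G w v"
proof
  fix h assume "h \<in> automorphisms G"
  then have h: "h permutes pverts G" "relabel h G = G" by (auto simp: automorphisms_def)
  then have iso: "graph_iso h G G" by (simp add: graph_iso_def permutes_inj_on)
  have v': "inv h v \<in> pverts G" "h (inv h v) = v"
    using h(1) wv by (auto simp: permutes_inv permutes_in_image permutes_inverses)
  have "relabel h (delete_verts G {w, inv h v}) = delete_verts G {h w, v}"
    using iso_delete[OF G iso, of "{w, inv h v}"] wv v' by (simp add: graph_iso_def)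
  moreover have "delete_vert (delete_vert G s) t = delete_verts G {s, t}" for s t
    by (auto simp: delete_verts_def)
  moreover have "relabel h (delete_vert G w) = delete_vert G (h w)"
    using iso_delete_vert[OF G iso wv(1)] by (simp add: graph_iso_def)
  ultimately show "h \<in> B_U G w v"
    using h(1) by (simp add: B_U_def B_vw_def insert_commute)
qed

section \<open>Rotations of the degree word as automorphisms\<close>

context sun
begin

lemma dihedral:
  assumes \<epsilon>: "\<epsilon> \<in> {1, -1}"
  shows "sun G c (\<lambda>i. X (y + \<epsilon> * i))"
proof (rule sun.intro[OF pair_graph c_ge_3])
  show "X (y + \<epsilon> * i) = X (y + \<epsilon> * j) \<longleftrightarrow> c dvd i - j" for i j
    using \<epsilon> by (auto simp: X_eq_iff dvd_diff_commute)
  show "X (y + \<epsilon> * i) \<in> pverts G" for i by (rule X_pverts)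
  show "X (y + \<epsilon> * j) \<in> nbrs G (X (y + \<epsilon> * i)) \<longleftrightarrow> c dvd j - i - 1 \<or> c dvd j - i + 1" for i j
  proof -
    have "c dvd i - j - 1 \<longleftrightarrow> c dvd j - i + 1" for i j
      using dvd_minus_iff[of c "i - j - 1"] by (simp add: algebra_simps)
    then show ?thesis using \<epsilon> by (auto simp: X_nbrs)
  qed
  fix t assume t: "t \<in> pverts G" "t \<notin> range (\<lambda>i. X (y + \<epsilon> * i))"
  have undo: "X i = X (y + \<epsilon> * (\<epsilon> * (i - y)))" for i using \<epsilon> by auto
  then have "t \<notin> range X" using t(2) by blast
  then obtain i where "nbrs G t = {X i}" using pendant t(1) by blast
  then show "\<exists>i. nbrs G t = {X (y + \<epsilon> * i)}" using undo by metis
qed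

lemma leaves_disjoint: "t \<in> leaves i \<Longrightarrow> t \<in> leaves j \<Longrightarrow> c dvd i - j"
  by (simp add: leaves_iff X_eq_iff)

lemma leaves_cong: "c dvd i - j \<Longrightarrow> leaves i = leaves j"
  using X_eq_iff[of i j] by (simp add: leaves_def)

text \<open>A period preserves the number of leaves at each cycle vertex, so arbitrary bijections
  between corresponding leaf sets extend the rotation of the cycle.\<close>

lemma rotation_automorphism:
  assumes per: "\<And>i. d (i + r) = d i"
  obtains h where "h \<in> automorphisms G" "\<And>i. h (X i) = X (i + r)"
    "\<And>i t. t \<in> leaves i \<Longrightarrow> h t \<in> leaves (i + r)"
proof -
  have "card (leaves i) = card (leaves (i + r))" for i
    using card_leaves[of i] card_leaves[of "i + r"] per[of i] by linarith
  then have "\<exists>\<phi>. bij_betw \<phi> (leaves i) (leaves (i + r))" for i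
    using finite_leaves by (metis finite_same_card_bij)
  then obtain \<phi> where \<phi>: "\<And>i. bij_betw (\<phi> i) (leaves i) (leaves (i + r))" by metis
  define idx where "idx t = (SOME i. t = X i)" for t
  \<comment> \<open>The bijections \<open>\<phi> i\<close> are chosen separately for each integer
    \<open>i\<close>, while leaf sets depend only on its residue. The representative modulo
    \<open>c\<close> selects one bijection for all leaves at a vertex.\<close>
  define lidx where "lidx t = (SOME i. t \<in> leaves i) mod c" for t
  define h where "h t = (if t \<in> range X then X (idx t + r) else if t \<in> pverts G then \<phi> (lidx t) t else t)" for t
  have hX: "h (X i) = X (i + r)" for i
  proof -
    have "X i = X (idx (X i))" unfolding idx_def by (rule someI[of _ i]) simp
    then have "X (idx (X i) + r) = X (i + r)" by (simp add: X_eq_iff dvd_diff_commute)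
    then show ?thesis by (simp add: h_def)
  qed
  have lidx: "t \<in> leaves (lidx t)" "lidx t = i mod c" if "t \<in> leaves i" for t i
  proof -
    let ?k = "SOME i. t \<in> leaves i"
    have k: "t \<in> leaves ?k" using that by (rule someI)
    then show "lidx t = i mod c" using leaves_disjoint[OF k that] by (simp add: lidx_def mod_eq_dvd_iff)
    moreover have "leaves (i mod c) = leaves i"
      by (rule leaves_cong) (simp add: mod_eq_dvd_iff[symmetric])
    ultimately show "t \<in> leaves (lidx t)" using that by simp
  qed
  have hl_eq: "h t = \<phi> (i mod c) t" if "t \<in> leaves i" for t i
    using that lidx(2)[OF that] by (auto simp: h_def leaves_iff)
  have hl: "h t \<in> leaves (i + r)" if t: "t \<in> leaves i" for t i
  proof -
    have eq: "leaves (i mod c) = leaves i" "leaves (i mod c + r) = leaves (i + r)"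
      by (rule leaves_cong; simp add: mod_eq_dvd_iff[symmetric])+
    then show ?thesis using \<phi>[of "i mod c"] t by (auto simp: hl_eq[OF t] bij_betw_def)
  qed
  have cases: "(\<exists>i. t = X i) \<or> (\<exists>i. t \<in> leaves i)" if "t \<in> pverts G" for t
    using leaf_cases[OF that] by blast
  have leaf_not_X: "t \<noteq> X j" if "t \<in> leaves i" for t i j using that by (auto simp: leaves_iff)
  have inj: "s = t" if st: "s \<in> pverts G" "t \<in> pverts G" "h s = h t" for s t
  proof -
    consider i j where "s = X i" "t = X j" | i j where "s = X i" "t \<in> leaves j"
      | i j where "s \<in> leaves i" "t = X j" | i j where "s \<in> leaves i" "t \<in> leaves j"
      using cases st(1,2) by metis
    then show ?thesis
    proof cases
      case 1
      then show ?thesis using st(3) by (simp add: hX X_eq_iff)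
    next
      case 2
      then show ?thesis using st(3) hl[of t j] leaf_not_X[of "h t"] by (simp add: hX) metis
    next
      case 3
      then show ?thesis using st(3) hl[of s i] leaf_not_X[of "h s"] by (simp add: hX) metis
    next
      case 4
      then have "c dvd i + r - (j + r)" using hl[of s i] hl[of t j] st(3) leaves_disjoint by metis
      then have ij: "i mod c = j mod c" by (simp add: mod_eq_dvd_iff)
      moreover have "leaves (i mod c) = leaves i" "leaves (j mod c) = leaves j"
        by (rule leaves_cong; simp add: mod_eq_dvd_iff[symmetric])+
      ultimately have "s \<in> leaves (i mod c)" "t \<in> leaves (i mod c)" using 4 by auto
      moreover have "\<phi> (i mod c) s = \<phi> (i mod c) t"
        using hl_eq[OF 4(1)] hl_eq[OF 4(2)] st(3) ij by simp
      ultimately show ?thesis using \<phi>[of "i mod c"] by (auto simp: bij_betw_def dest: inj_onD)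
    qed
  qed
  have into: "h t \<in> pverts G" if "t \<in> pverts G" for t
    using cases[OF that] hl X_pverts by (auto simp: hX leaves_iff)
  have "h ` pverts G = pverts G"
    using into inj finite_pverts[OF pair_graph] by (intro endo_inj_surj) (auto intro: inj_onI)
  then have bij: "bij_betw h (pverts G) (pverts G)"
    using inj by (auto simp: bij_betw_def intro: inj_onI)
  have outside: "h t = t" if "t \<notin> pverts G" for t using that X_pverts by (auto simp: h_def)
  have perm: "h permutes pverts G" using bij outside by (rule bij_imp_permutes)
  have X_leaf: "(X i, t) \<in> parcs G \<longleftrightarrow> c dvd i - j" if "t \<in> leaves j" for i j t
  proof -
    have "(X i, t) \<in> parcs G \<longleftrightarrow> X i \<in> nbrs G t" using arc_sym[OF pair_graph] by (auto simp: nbrs_def)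
    then show ?thesis using that by (simp add: leaves_iff X_eq_iff)
  qed
  have arcs: "(h s, h t) \<in> parcs G \<longleftrightarrow> (s, t) \<in> parcs G" if st: "s \<in> pverts G" "t \<in> pverts G" for s t
  proof -
    consider i j where "s = X i" "t = X j" | i j where "s = X i" "t \<in> leaves j"
      | i j where "s \<in> leaves i" "t = X j" | i j where "s \<in> leaves i" "t \<in> leaves j"
      using cases st by metis
    then show ?thesis
    proof cases
      case 1
      then show ?thesis using X_nbrs by (simp add: hX nbrs_def)
    next
      case 2
      then show ?thesis using X_leaf[of t j i] X_leaf[of "h t" "j + r" "i + r"] hl[of t j] by (simp add: hX)
    next
      case 3
      then show ?thesis
        using X_leaf[of s i j] X_leaf[of "h s" "i + r" "j + r"] hl[of s i]
          arc_sym[OF pair_graph, of s t] arc_sym[OF pair_graph, of "h s" "h t"] by (simp add: hX)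
    next
      case 4
      have "(s', t') \<notin> parcs G" if "s' \<in> leaves i'" "t' \<in> leaves j'" for s' t' i' j'
        using that by (auto simp: leaves_iff nbrs_def)
      then show ?thesis using 4 hl by blast
    qed
  qed
  have "graph_iso h G G" using graph_isoI[OF pair_graph pair_graph bij] arcs by blast
  then have "h \<in> automorphisms G" using perm by (simp add: automorphisms_def graph_iso_def)
  then show ?thesis using that hX hl by blast
qed

end

section \<open>Lower and upper bounds for chi\<close>

context sun_pair
begin

lemma v_pverts: "v \<in> pverts G"
  using X_pverts by (simp add: v_eq)

text \<open>The identity, the rotation and its square send the foot of \<open>w\<close> to three
  different positions, and so do their inverses with \<open>v\<close>, because neither
  \<open>r\<close> nor \<open>2 * r\<close> is a multiple of \<open>c\<close>. The three
  automorphisms are thus separated.\<close>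

lemma chi_ge_3:
  assumes per: "\<And>i. d (i + r) = d i" and r: "\<not> c dvd 2 * r"
  shows "3 \<le> chi G w v"
proof -
  have r1: "\<not> c dvd r" using r by auto
  obtain h where h: "h \<in> automorphisms G" "\<And>i. h (X i) = X (i + r)"
    "\<And>i t. t \<in> leaves i \<Longrightarrow> h t \<in> leaves (i + r)"
    using rotation_automorphism[of r] per by blast
  have perm: "h permutes pverts G" using h(1) by (simp add: automorphisms_def)
  have hh: "h \<circ> h \<in> automorphisms G"
  proof -
    have "graph_iso h G G" using h(1) perm by (simp add: automorphisms_def graph_iso_def permutes_inj_on)
    then have "graph_iso (h \<circ> h) G G" using graph_iso_comp by blast
    then show ?thesis using permutes_compose[OF perm perm] by (simp add: automorphisms_def graph_iso_def)
  qed
  have id: "id \<in> automorphisms G"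
    by (simp add: automorphisms_def permutes_id relabel_def map_prod.id)
  let ?S = "{id, h, h \<circ> h}"
  have wl: "w \<in> leaves 0" "h w \<in> leaves r" "h (h w) \<in> leaves (2 * r)"
    using w_leaf h(3)[OF w_leaf] h(3)[of "h w" r] by auto
  have w_ne: "w \<noteq> h w" "w \<noteq> h (h w)" "h w \<noteq> h (h w)"
    using leaves_disjoint[OF wl(2), of 0] leaves_disjoint[OF wl(3), of 0] leaves_disjoint[OF wl(3), of r] wl r r1
    by auto
  have bij: "bij h" "bij (h \<circ> h)" using perm by (auto intro: permutes_bij bij_comp)
  have "inv h v = X (\<nu> - r)" "inv (h \<circ> h) v = X (\<nu> - 2 * r)"
    using h(2) bij by (auto simp: v_eq bij_def intro!: inv_f_eq)
  then have v_ne: "v \<noteq> inv h v" "v \<noteq> inv (h \<circ> h) v" "inv h v \<noteq> inv (h \<circ> h) v"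
    using r r1 by (simp_all add: v_eq X_eq_iff)
  have "separated w v ?S"
    using w_ne v_ne by (auto simp: separated_def)
  moreover have "?S \<subseteq> B_U G w v"
    using automorphisms_subset_B_U[OF pair_graph w_facts(1) v_pverts] id h(1) hh by blast
  ultimately have "card ?S \<le> chi G w v"
    using finite_pverts[OF pair_graph] by (intro chi_ge) auto
  moreover have "card ?S = 3"
  proof -
    have "id \<noteq> h" "id \<noteq> h \<circ> h" "h \<noteq> h \<circ> h" using w_ne by (metis comp_apply id_apply)+
    then show ?thesis by simp
  qed
  ultimately show ?thesis by simp
qed

text \<open>Since \<open>U\<^sub>0\<close> and \<open>G\<close> without \<open>h w\<close> have
  equally many edges, \<open>h w\<close> is again a leaf. In both graphs the cycle then consists of
  the vertices of degree at least two, so \<open>h\<close> carries it to itself.\<close>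

lemma B_U_dihedral:
  assumes h: "h \<in> B_U G w v"
  obtains \<epsilon> s j where "\<epsilon> \<in> {1, -1}" "\<And>i. h (X i) = X (s + \<epsilon> * i)" "h w \<in> leaves j"
    "\<And>i. U.d i = d (s + \<epsilon> * i) - mark c j (s + \<epsilon> * i)"
proof -
  have perm: "h permutes pverts G" and rel: "relabel h U\<^sub>0 = delete_vert G (h w)"
    using h by (auto simp: B_U_def B_vw_def)
  have inj: "inj h" using perm by (rule permutes_inj)
  have iso: "graph_iso h U\<^sub>0 (delete_vert G (h w))"
    using rel inj by (auto simp: graph_iso_def intro: inj_on_subset)
  have hw: "h w \<in> pverts G" using perm w_facts(1) by (simp add: permutes_in_image)
  have "deg G (h w) = deg G w"
    using iso_card_parcs[OF U.pair_graph iso]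
      card_parcs_delete_vert[OF pair_graph hw] card_parcs_delete_vert[OF pair_graph w_facts(1)] by simp
  then have nr: "h w \<notin> range X" using deg_ge_2_iff[OF hw] w_facts by simp
  then obtain j where j: "h w \<in> leaves j" using leaf_cases hw by blast
  interpret V: sun "delete_vert G (h w)" c X by (rule delete_pendant[OF nr])
  have deg: "deg (delete_vert G (h w)) (h (X i)) = deg U\<^sub>0 (X i)" for i
    using iso_deg[OF U.pair_graph iso U.X_pverts] .
  have rng: "h (X i) \<in> range X" for i
  proof -
    have "h (X i) \<in> pverts (delete_vert G (h w))"
      using iso_pverts[OF U.pair_graph iso] U.X_pverts by blast
    moreover have "2 \<le> deg (delete_vert G (h w)) (h (X i))"
      using deg[of i] U.d_ge_2[of i] by (simp add: U.d_def)
    ultimately show ?thesis using V.deg_ge_2_iff by blast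
  qed
  have adj: "h (X (i + 1)) \<in> nbrs G (h (X i))" for i
  proof -
    have "h (X (i + 1)) \<in> nbrs (delete_vert G (h w)) (h (X i))"
      using iso_nbrs[OF U.pair_graph iso U.X_pverts] U.X_neighbours(1) by blast
    then show ?thesis by (auto simp: nbrs_def parcs_delete)
  qed
  obtain s \<epsilon> where s: "\<epsilon> \<in> {1, -1}" "\<And>i. h (X i) = X (s + \<epsilon> * i)"
    using cycle_map_dihedral[of h] inj rng adj by (metis injD)
  have "U.d i = d (s + \<epsilon> * i) - mark c j (s + \<epsilon> * i)" for i
    using deg[of i] deg_delete_leaf[OF j, of "s + \<epsilon> * i"] s(2)[of i] by (simp add: U.d_def)
  then show ?thesis using that s j by blast
qed

text \<open>The word \<open>d\<close> and its pullback along \<open>h\<close> differ by two marks,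
  at the foot of \<open>w\<close> and at the preimage of the foot of \<open>h w\<close>. A
  nontrivial period makes the two coincide, and then \<open>h\<close> preserves the edge at
  \<open>w\<close> as well.\<close>

lemma B_U_eq_automorphisms:
  assumes per: "\<And>i. d (i + r) = d i" and r: "\<not> c dvd r"
  shows "B_U G w v = automorphisms G"
proof
  show "automorphisms G \<subseteq> B_U G w v"
    by (rule automorphisms_subset_B_U[OF pair_graph w_facts(1) v_pverts])
  show "B_U G w v \<subseteq> automorphisms G"
  proof
    fix h assume h: "h \<in> B_U G w v"
    then have perm: "h permutes pverts G" and rel: "relabel h U\<^sub>0 = delete_vert G (h w)"
      by (auto simp: B_U_def B_vw_def)
    obtain \<epsilon> s j where \<epsilon>: "\<epsilon> \<in> {1, -1}" and hX: "\<And>i. h (X i) = X (s + \<epsilon> * i)"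
      and j: "h w \<in> leaves j" and Ud: "\<And>i. U.d i = d (s + \<epsilon> * i) - mark c j (s + \<epsilon> * i)"
      using B_U_dihedral[OF h] by metis
    \<comment> \<open>The index \<open>\<epsilon> * (j - s)\<close> is the one that \<open>h\<close>
      sends to \<open>j\<close>.\<close>
    have "c dvd 0 - \<epsilon> * (j - s)"
    proof (rule periodic_difference_two_marks[where f = d and g = "\<lambda>i. d (s + \<epsilon> * i)" and r = r])
      show "d i - d (s + \<epsilon> * i) = mark c 0 i - mark c (\<epsilon> * (j - s)) i" for i
        using Ud[of i] Ud_eq[of i] mark_reflect[OF \<epsilon>, of c s "\<epsilon> * (j - s)" i] \<epsilon> by auto
      have per': "d (i - r) = d i" for i using per[of "i - r"] by simp
      have "s + \<epsilon> * (i + r) = (s + \<epsilon> * i) + r \<or> s + \<epsilon> * (i + r) = (s + \<epsilon> * i) - r" for i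
        using \<epsilon> by auto
      then show "d (s + \<epsilon> * (i + r)) = d (s + \<epsilon> * i)" for i using per per' by metis
    qed (use per r in auto)
    then have sj: "X j = h (X 0)" using \<epsilon> by (auto simp: hX X_eq_iff dvd_diff_commute)
    have inj: "inj h" using perm by (rule permutes_inj)
    have iso: "graph_iso h U\<^sub>0 (delete_vert G (h w))"
      using rel inj by (auto simp: graph_iso_def intro: inj_on_subset)
    have w_arc: "(h w, h t) \<in> parcs G \<longleftrightarrow> (w, t) \<in> parcs G" for t
    proof -
      have "(h w, h t) \<in> parcs G \<longleftrightarrow> h t = X j" using j by (auto simp: leaves_iff nbrs_def set_eq_iff)
      also have "\<dots> \<longleftrightarrow> t = X 0" using sj inj by (auto dest: injD)
      also have "\<dots> \<longleftrightarrow> (w, t) \<in> parcs G" using w_facts(3) by (auto simp: nbrs_def set_eq_iff)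
      finally show ?thesis .
    qed
    have "graph_iso h G G"
    proof (rule graph_isoI[OF pair_graph pair_graph])
      show "bij_betw h (pverts G) (pverts G)" using perm by (rule permutes_imp_bij)
      fix p q assume pq: "p \<in> pverts G" "q \<in> pverts G"
      show "(h p, h q) \<in> parcs G \<longleftrightarrow> (p, q) \<in> parcs G"
      proof (cases "p = w \<or> q = w")
        case True
        then show ?thesis
          using w_arc arc_sym[OF pair_graph, of p q] arc_sym[OF pair_graph, of "h p" "h q"] by auto
      next
        case False
        then have "(h p, h q) \<in> parcs (delete_vert G (h w)) \<longleftrightarrow> (p, q) \<in> parcs U\<^sub>0"
          using iso_arc[OF U.pair_graph iso, of p q] pq by simp
        then show ?thesis using False inj by (auto simp: parcs_delete dest: injD)
      qed
    qed
    then show "h \<in> automorphisms G" using perm by (simp add: automorphisms_def graph_iso_def)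
  qed
qed

text \<open>Every element of \<^const>\<open>B_U\<close> fixes \<open>X y\<close>, which leaves the identity and one reflection.\<close>

lemma chi_le_2:
  assumes per: "\<And>i. U.d (i + r) + mark c y (i + r) = U.d i + mark c y i"
    and r: "\<not> c dvd 2 * r" and y: "\<not> c dvd y"
  shows "chi G w v \<le> 2"
proof (rule chi_le[OF finite_pverts[OF pair_graph]])
  fix S assume S: "max_saturating G w v S"
  \<comment> \<open>\<open>D\<close> is the degree word of the graph in which the leaf
    \<open>w\<close> hangs at \<open>X y\<close>; the period \<open>r\<close> belongs to this
    word.\<close>
  define D where "D i = U.d i + mark c y i" for i
  have D: "D (i + r) = D i" for i using per by (simp add: D_def)
  then have D': "D (i - r) = D i" for i by (metis diff_add_cancel)
  have "inv h v \<in> {X \<nu>, X (2 * y - \<nu>)}" if h: "h \<in> B_U G w v" for h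
  proof -
    have bij: "bij h" using h by (auto simp: B_U_def B_vw_def intro: permutes_bij)
    obtain \<epsilon> s j where \<epsilon>: "\<epsilon> \<in> {1, -1}" and hX: "\<And>i. h (X i) = X (s + \<epsilon> * i)"
      and j: "h w \<in> leaves j" and Ud: "\<And>i. U.d i = d (s + \<epsilon> * i) - mark c j (s + \<epsilon> * i)"
      using B_U_dihedral[OF h] by metis
    \<comment> \<open>\<open>?g\<close> inverts the action of \<open>h\<close> on cycle indices, so
      that marks can be pulled back along \<open>h\<close>.\<close>
    let ?g = "\<lambda>z. \<epsilon> * (z - s)"
    have mg: "mark c z (s + \<epsilon> * i) = mark c (?g z) i" for z i
      using mark_reflect[OF \<epsilon>, of c s "?g z" i] \<epsilon> by auto
    have "c dvd y - ?g y \<and> c dvd ?g 0 - ?g j \<or> c dvd y - ?g j \<and> c dvd ?g 0 - ?g y"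
    proof (rule periodic_difference_four_marks[where f = D and g = "\<lambda>i. D (s + \<epsilon> * i)" and r = r])
      show "D i - D (s + \<epsilon> * i) = mark c y i + mark c (?g 0) i - mark c (?g y) i - mark c (?g j) i" for i
        using Ud[of i] Ud_eq[of "s + \<epsilon> * i"] by (simp add: D_def mg)
      have "s + \<epsilon> * (i + r) = (s + \<epsilon> * i) + r \<or> s + \<epsilon> * (i + r) = (s + \<epsilon> * i) - r" for i
        using \<epsilon> by auto
      then show "D (s + \<epsilon> * (i + r)) = D (s + \<epsilon> * i)" for i using D D' by metis
    qed (use D r in auto)
    \<comment> \<open>The other pairing of the marks would identify 0 and \<open>y\<close>, the two
      feet of the leaf. What remains says that \<open>h\<close> fixes \<open>X y\<close>.\<close>
    moreover have "\<not> c dvd ?g 0 - ?g y"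
      using y \<epsilon> by (auto simp: algebra_simps)
    ultimately have fix_y: "c dvd y - \<epsilon> * (y - s)" by blast
    show ?thesis
    proof (cases "\<epsilon> = 1")
      case True
      then have "h (X \<nu>) = v" using fix_y by (simp add: hX v_eq X_eq_iff)
      then show ?thesis using bij by (auto simp: bij_def intro: inv_f_eq)
    next
      case False
      then have e: "\<epsilon> = -1" using \<epsilon> by simp
      then have "h (X (2 * y - \<nu>)) = v"
        using fix_y by (simp add: hX v_eq X_eq_iff algebra_simps dvd_diff_commute)
      then show ?thesis using bij by (auto simp: bij_def intro: inv_f_eq)
    qed
  qed
  then have "(\<lambda>h. inv h v) ` (S \<inter> B_U G w v) \<subseteq> {X \<nu>, X (2 * y - \<nu>)}" by auto
  then have "card ((\<lambda>h. inv h v) ` (S \<inter> B_U G w v)) \<le> card {X \<nu>, X (2 * y - \<nu>)}"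
    by (intro card_mono) auto
  also have "\<dots> \<le> 2" by (simp add: card_insert_if)
  moreover have "inj_on (\<lambda>h. inv h v) (S \<inter> B_U G w v)"
    using S by (auto simp: max_saturating_def separated_def inj_on_def)
  ultimately show "card (S \<inter> B_U G w v) \<le> 2" by (simp add: card_image)
qed

end

subsection \<open>Moving the leaf\<close>

lemma sunshine_supercard_imp_sun_pair:
  assumes "sunshine_supercard U T G w v c x \<nu>"
  shows "sun_pair G (int c) (\<lambda>i. x (nat (i mod int c))) w v (int \<nu>)"
proof -
  let ?X = "\<lambda>i. x (nat (i mod int c))"
  have *: "sunshine G" "cycle_labelling (skeleton G) c x" "vdegree G w = 1" "vdegree G v = 2"
    "(x 0, w) \<in> parcs G" "\<nu> < c" "v = x \<nu>"
    "vdegree G (x ((\<nu> + 1) mod c)) \<le> vdegree G (x ((\<nu> + c - 1) mod c))"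
    using assms by (auto simp: sunshine_supercard_def)
  interpret sun G "int c" ?X by (rule sunshine_imp_sun[OF *(1,2)])
  have \<nu>: "?X (int \<nu>) = v" using *(6,7) by simp
  have "nat ((int \<nu> + 1) mod int c) = (\<nu> + 1) mod c"
    using nat_int[of "(\<nu> + 1) mod c"] by (simp add: of_nat_mod add.commute)
  moreover have "nat ((int \<nu> - 1) mod int c) = (\<nu> + c - 1) mod c"
  proof -
    have "int ((\<nu> + c - 1) mod c) = (int \<nu> - 1 + int c) mod int c"
      using c_ge_3 by (simp add: of_nat_mod of_nat_diff algebra_simps)
    also have "\<dots> = (int \<nu> - 1) mod int c" by simp
    finally show ?thesis by (metis nat_int)
  qed
  ultimately have "d (int \<nu> + 1) \<le> d (int \<nu> - 1)"
    using *(8) by (simp add: d_def vdegree_eq_deg)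
  moreover have "w \<in> leaves 0"
  proof -
    have "w \<in> nbrs G (?X 0)" using *(5) by (simp add: nbrs_def)
    moreover have "w \<notin> range ?X"
      using *(3) deg_ge_2_iff[of w] nbrs_subset[OF pair_graph, of "?X 0"] calculation
      by (auto simp: vdegree_eq_deg)
    ultimately show ?thesis by (simp add: leaves_def)
  qed
  moreover have "d (int \<nu>) = 2" using *(4) \<nu> by (simp add: d_def vdegree_eq_deg)
  ultimately show ?thesis using \<nu> by unfold_locales auto
qed

context sun_pair
begin

lemma imp_sunshine_supercard:
  assumes U: "isomorphic U\<^sub>0 U" and T: "isomorphic T\<^sub>0 T" and card: "card (pverts G) = card (pverts U) + 1"
    and \<nu>: "0 \<le> \<nu>" "\<nu> < c"
  shows "sunshine_supercard U T G w v (nat c) (\<lambda>i. X (int i)) (nat \<nu>)"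
proof -
  have "cycle_labelling (skeleton G) (nat c) (\<lambda>i. X (int i))"
    using int_cycle_skeleton c_ge_3 by (intro int_cycle_imp_cycle_labelling) simp
  moreover have "vdegree G w = 1" "vdegree G v = 2"
    using w_facts(3) d_\<nu> by (simp_all add: vdegree_eq_deg v_eq d_def)
  moreover have "v \<in> pverts (skeleton G)"
    using int_cycle_skeleton by (auto simp: int_cycle_def v_eq)
  moreover have "(X 0, w) \<in> parcs G" using w_leaf by (auto simp: leaves_def nbrs_def)
  moreover have "X (int ((nat \<nu> + 1) mod nat c)) = X (\<nu> + 1)"
    using \<nu> by (simp add: of_nat_mod X_mod add.commute)
  moreover have "X (int ((nat \<nu> + nat c - 1) mod nat c)) = X (\<nu> - 1)"
  proof -
    have "int (nat \<nu> + nat c - 1) = \<nu> - 1 + c" using \<nu> c_ge_3 by (simp add: of_nat_diff)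
    moreover have "int (nat c) = c" using c_ge_3 by simp
    ultimately have "X (int ((nat \<nu> + nat c - 1) mod nat c)) = X ((\<nu> - 1 + c) mod c)"
      by (simp only: of_nat_mod)
    then show ?thesis by (simp only: X_mod X_add_c)
  qed
  moreover have "supercard U T G"
    using pair_graph card w_facts(1) v_pverts U T unfolding supercard_def by blast
  ultimately show ?thesis
    using sunshine w_facts(1) U T orient \<nu>
    by (auto simp: sunshine_supercard_def vdegree_eq_deg v_eq d_def)
qed

text \<open>The vertex set stays the same, so the new graph lives over the same type and the
  maximality of \<open>chi\<close> applies to it. Deleting \<open>w\<close> still yields
  \<open>U\<^sub>0\<close> itself.\<close>

definition moved :: "int \<Rightarrow> 'a pair_pre_digraph" where
  "moved y = \<lparr> pverts = pverts G, parcs = parcs U\<^sub>0 \<union> {(X y, w), (w, X y)} \<rparr>"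

lemma nbrs_moved:
  "nbrs (moved y) t = (if t = w then {X y} else nbrs U\<^sub>0 t \<union> (if t = X y then {w} else {}))"
  using w_facts(2) by (auto simp: nbrs_def moved_def parcs_delete)

lemma w_notin_nbrs_U: "w \<notin> nbrs U\<^sub>0 t"
  by (auto simp: nbrs_def parcs_delete)

lemma moved_pair_graph: "pair_graph (moved y)"
proof -
  have "X y \<noteq> w" "X y \<in> pverts G" using w_facts(2) X_pverts by auto
  then show ?thesis
    using U.pair_graph w_facts(1) by (auto simp: pair_graph_iff moved_def sym_def)
qed

lemma moved_sun: "sun (moved y) c X"
proof (rule sun.intro[OF moved_pair_graph c_ge_3 X_eq_iff])
  have Xw: "X i \<noteq> w" for i using w_facts(2) by blast
  show "X i \<in> pverts (moved y)" for i using X_pverts by (simp add: moved_def)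
  show "X j \<in> nbrs (moved y) (X i) \<longleftrightarrow> c dvd j - i - 1 \<or> c dvd j - i + 1" for i j
    using Xw U.X_nbrs[of j i] by (simp add: nbrs_moved)
  fix t assume t: "t \<in> pverts (moved y)" "t \<notin> range X"
  show "\<exists>i. nbrs (moved y) t = {X i}"
  proof (cases "t = w")
    case False
    then have "t \<in> pverts U\<^sub>0" using t(1) by (simp add: moved_def)
    then show ?thesis using U.pendant t(2) False by (auto simp: nbrs_moved)
  qed (auto simp: nbrs_moved)
qed

lemma deg_moved: "int (deg (moved y) (X i)) = U.d i + mark c y i"
proof -
  have "X i \<noteq> w" using w_facts(2) by blast
  then show ?thesis
    using w_notin_nbrs_U[of "X i"] finite_nbrs[OF U.pair_graph, of "X i"]
    by (simp add: nbrs_moved U.d_def mark_def X_eq_iff)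
qed

lemma moved_delete_w: "delete_vert (moved y) w = U\<^sub>0"
proof -
  have "{e \<in> parcs (moved y). fst e \<notin> {w} \<and> snd e \<notin> {w}} = parcs U\<^sub>0"
    by (auto simp: moved_def parcs_delete)
  then show ?thesis by (simp add: delete_verts_def moved_def)
qed

text \<open>The leaf \<open>w\<close> plays the part of \<open>b\<close>: attached at the vertex
  that \<open>f\<close> sends to \<open>p\<close>, it extends the isomorphism of cards to all of
  \<open>T\<^sub>0\<close>. So moving the leaf keeps \<open>T\<close> among the cards.\<close>

lemma moved_delete_iso:
  assumes b: "b \<in> pverts T\<^sub>0" and f: "graph_iso f (delete_vert U\<^sub>0 (X \<alpha>)) (delete_vert T\<^sub>0 b)"
    and p: "nbrs T\<^sub>0 b = {p}" and y: "f (X y) = p" "X y \<noteq> X \<alpha>"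
  shows "graph_iso (f(w := b)) (delete_vert (moved y) (X \<alpha>)) T\<^sub>0"
proof -
  let ?D = "delete_vert U\<^sub>0 (X \<alpha>)" and ?W = "delete_vert (moved y) (X \<alpha>)" and ?f = "f(w := b)"
  have D: "pair_graph ?D" by (rule pair_graph_delete[OF U.pair_graph])
  have Xw: "X i \<noteq> w" for i using w_facts(2) by blast
  have vW: "pverts ?W = insert w (pverts ?D)"
    using w_facts(1) Xw by (auto simp: moved_def)
  have vT: "pverts T\<^sub>0 = insert b (f ` pverts ?D)"
    using iso_pverts[OF D f] b by auto
  have b_notin: "b \<notin> f ` pverts ?D" using iso_pverts[OF D f] by auto
  have Xy: "X y \<in> pverts ?D" using U.X_pverts y(2) by simp
  have eq: "?f t = f t" if "t \<in> pverts ?D" for t using that by auto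
  have im: "?f ` pverts ?D = f ` pverts ?D" by (rule image_cong) (auto simp: eq)
  have inj: "inj_on ?f (pverts ?D)"
    by (rule inj_on_cong[THEN iffD2, OF _ iso_inj[OF D f]]) (rule eq)
  have wD: "pverts ?D - {w} = pverts ?D" by auto
  have bij: "bij_betw ?f (pverts ?W) (pverts T\<^sub>0)"
    unfolding bij_betw_def vW vT inj_on_insert image_insert wD im fun_upd_same
    by (intro conjI inj b_notin refl)
  have w_arc: "(?f w, ?f t) \<in> parcs T\<^sub>0 \<longleftrightarrow> (w, t) \<in> parcs ?W" if t: "t \<in> pverts ?W" for t
  proof (cases "t = w")
    case True
    then show ?thesis
      using no_loop[OF pair_graph_T] no_loop[OF pair_graph_delete[OF moved_pair_graph]] by simp
  next
    case False
    then have tD: "t \<in> pverts ?D" using t unfolding vW by blast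
    have "(?f w, ?f t) \<in> parcs T\<^sub>0 \<longleftrightarrow> f t \<in> nbrs T\<^sub>0 b" using False by (simp add: nbrs_def)
    also have "\<dots> \<longleftrightarrow> f t = f (X y)" by (simp add: p y(1))
    also have "\<dots> \<longleftrightarrow> t = X y" by (rule inj_on_eq_iff[OF iso_inj[OF D f] tD Xy])
    also have "\<dots> \<longleftrightarrow> t \<in> nbrs ?W w"
      using Xw[of \<alpha>, symmetric] y(2) by (auto simp: nbrs_delete nbrs_moved)
    finally show ?thesis by (simp add: nbrs_def)
  qed
  show ?thesis
  proof (rule graph_isoI[OF pair_graph_delete[OF moved_pair_graph] pair_graph_T bij])
    fix s t assume st: "s \<in> pverts ?W" "t \<in> pverts ?W"
    show "(?f s, ?f t) \<in> parcs T\<^sub>0 \<longleftrightarrow> (s, t) \<in> parcs ?W"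
    proof (cases "s = w \<or> t = w")
      case True
      then show ?thesis
        using w_arc st arc_sym[OF pair_graph_T, of "?f s" "?f t"]
          arc_sym[OF pair_graph_delete[OF moved_pair_graph], of s t] by metis
    next
      case False
      then have D': "s \<in> pverts ?D" "t \<in> pverts ?D" using st vW by auto
      have "(?f s, ?f t) \<in> parcs T\<^sub>0 \<longleftrightarrow> (f s, f t) \<in> parcs (delete_vert T\<^sub>0 b)"
        using False D' b_notin by (auto simp: parcs_delete[of T\<^sub>0])
      also have "\<dots> \<longleftrightarrow> (s, t) \<in> parcs ?D" using iso_arc[OF D f D'] .
      also have "\<dots> \<longleftrightarrow> (s, t) \<in> parcs ?W"
        using False D' by (auto simp: moved_def parcs_delete)
      finally show ?thesis .
    qed
  qed
qed

text \<open>The labels have to start at the new foot \<open>X y\<close> and may need a reflection to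
  satisfy the orientation condition at \<open>X \<alpha>\<close>. As the leaf is not attached at
  \<open>X \<alpha>\<close>, that vertex keeps degree two. The period \<open>r\<close> of the new
  word then supplies the bound on \<open>chi\<close>.\<close>

lemma moved_sunshine_supercard:
  assumes U: "isomorphic U\<^sub>0 U" and T: "isomorphic T\<^sub>0 T" and card: "card (pverts G) = card (pverts U) + 1"
    and iso: "graph_iso g (delete_vert (moved y) (X \<alpha>)) T\<^sub>0"
    and \<alpha>: "U.d \<alpha> = 2" "\<not> c dvd \<alpha> - y"
    and per: "\<And>i. U.d (i + r) + mark c y (i + r) = U.d i + mark c y i"
    and r: "\<not> c dvd 2 * r"
  obtains v' c' x' \<nu>' where "sunshine_supercard U T (moved y) w v' c' x' \<nu>'" "3 \<le> chi (moved y) w v'"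
proof -
  interpret W: sun "moved y" c X by (rule moved_sun)
  have Wd: "W.d i = U.d i + mark c y i" for i using deg_moved by (simp add: W.d_def)
  obtain \<epsilon> :: int where \<epsilon>: "\<epsilon> \<in> {1, -1}" "W.d (\<alpha> + \<epsilon>) \<le> W.d (\<alpha> - \<epsilon>)"
  proof (cases "W.d (\<alpha> + 1) \<le> W.d (\<alpha> - 1)")
    case True
    then show ?thesis using that[of 1] by simp
  next
    case False
    then show ?thesis using that[of "-1"] by simp
  qed
  let ?X = "\<lambda>i. X (y + \<epsilon> * i)" and ?\<nu> = "\<epsilon> * (\<alpha> - y) mod c"
  interpret Y: sun "moved y" c ?X by (rule W.dihedral[OF \<epsilon>(1)])
  have Yd: "Y.d i = W.d (y + \<epsilon> * i)" for i by (simp add: Y.d_def W.d_def)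
  have \<nu>: "Y.d (?\<nu> + i) = W.d (\<alpha> + \<epsilon> * i)" "?X ?\<nu> = X \<alpha>" for i
  proof -
    have "c dvd \<epsilon> * (?\<nu> - \<epsilon> * (\<alpha> - y))" by (intro dvd_mult) (simp add: mod_eq_dvd_iff[symmetric])
    moreover have "\<epsilon> * (?\<nu> - \<epsilon> * (\<alpha> - y)) = \<epsilon> * ?\<nu> - (\<alpha> - y)" using \<epsilon>(1) by auto
    ultimately have *: "c dvd \<epsilon> * ?\<nu> - (\<alpha> - y)" by simp
    have eq: "y + \<epsilon> * (?\<nu> + i) - (\<alpha> + \<epsilon> * i) = \<epsilon> * ?\<nu> - (\<alpha> - y)" by (simp add: algebra_simps)
    show "Y.d (?\<nu> + i) = W.d (\<alpha> + \<epsilon> * i)" unfolding Yd by (rule W.d_cong) (subst eq, rule *)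
    have "y + \<epsilon> * ?\<nu> - \<alpha> = \<epsilon> * ?\<nu> - (\<alpha> - y)" by simp
    then show "?X ?\<nu> = X \<alpha>" using * by (simp only: X_eq_iff)
  qed
  interpret Y: sun_pair "moved y" c ?X w "X \<alpha>" ?\<nu>
  proof
    have "w \<in> pverts (moved y)" using w_facts(1) by (simp add: moved_def)
    moreover have "w \<notin> range ?X" using w_facts(2) by blast
    ultimately show "w \<in> Y.leaves 0" by (simp add: Y.leaves_iff nbrs_moved)
    show "X \<alpha> = ?X ?\<nu>" using \<nu>(2) ..
    have "mark c y \<alpha> = 0" using \<alpha>(2) by (simp add: mark_def)
    then show "Y.d ?\<nu> = 2" using \<nu>(1)[of 0] \<alpha>(1) Wd by simp
    show "Y.d (?\<nu> + 1) \<le> Y.d (?\<nu> - 1)" using \<nu>(1)[of 1] \<nu>(1)[of "-1"] \<epsilon>(2) by simp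
  qed
  have "isomorphic (delete_vert (moved y) (X \<alpha>)) T"
  proof -
    obtain g' where "graph_iso g' T\<^sub>0 T" using T isomorphic_iff_graph_iso[OF pair_graph_T] by blast
    then show ?thesis
      using graph_iso_comp[OF iso] isomorphic_iff_graph_iso[OF pair_graph_delete[OF moved_pair_graph]] by blast
  qed
  moreover have "isomorphic (delete_vert (moved y) w) U" using U by (simp add: moved_delete_w)
  moreover have "card (pverts (moved y)) = card (pverts U) + 1" using card by (simp add: moved_def)
  ultimately have "sunshine_supercard U T (moved y) w (X \<alpha>) (nat c) (\<lambda>i. ?X (int i)) (nat ?\<nu>)"
    using c_ge_3 by (intro Y.imp_sunshine_supercard) auto
  moreover have "3 \<le> chi (moved y) w (X \<alpha>)"
  proof (rule Y.chi_ge_3[of "\<epsilon> * r"])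
    have perW: "W.d (i + r) = W.d i" for i using per by (simp add: Wd)
    have "y + \<epsilon> * (i + \<epsilon> * r) = y + \<epsilon> * i + r" for i using \<epsilon>(1) by auto
    then show "Y.d (i + \<epsilon> * r) = Y.d i" for i by (simp only: Yd perW)
    show "\<not> c dvd 2 * (\<epsilon> * r)" using r \<epsilon>(1) by auto
  qed
  ultimately show ?thesis using that by blast
qed

end

subsection \<open>Counting the common cards\<close>

text \<open>A difference annihilated by doubling is half of \<open>c\<close> up to sign, and only
  one position in \<open>{0..<c}\<close> lies at that distance from
  \<open>\<alpha>\<^sub>1\<close>.\<close>

lemma half_period_unique:
  fixes c \<alpha>\<^sub>1 \<alpha>\<^sub>2 \<alpha>\<^sub>3 :: int
  assumes \<alpha>: "\<alpha>\<^sub>1 \<in> {0..<c}" "\<alpha>\<^sub>2 \<in> {0..<c}" "\<alpha>\<^sub>3 \<in> {0..<c}"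
    and ne: "\<alpha>\<^sub>1 \<noteq> \<alpha>\<^sub>2" "\<alpha>\<^sub>1 \<noteq> \<alpha>\<^sub>3" "\<alpha>\<^sub>2 \<noteq> \<alpha>\<^sub>3"
  shows "\<not> c dvd 2 * (\<alpha>\<^sub>1 - \<alpha>\<^sub>2) \<or> \<not> c dvd 2 * (\<alpha>\<^sub>1 - \<alpha>\<^sub>3)"
proof -
  have half: "2 * x = c \<or> 2 * x = - c" if x: "c dvd 2 * x" "x \<noteq> 0" "\<bar>x\<bar> < c" for x
  proof -
    obtain k where k: "2 * x = c * k" using x(1) by (rule dvdE)
    have c: "0 < c" using x by simp
    have "k \<noteq> 0" using k x(2) by auto
    moreover have "k < 2"
    proof (rule ccontr)
      assume "\<not> k < 2"
      then have "c * 2 \<le> c * k" using c by (intro mult_left_mono) auto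
      then show False using k x(3) by linarith
    qed
    moreover have "-2 < k"
    proof (rule ccontr)
      assume "\<not> -2 < k"
      then have "c * k \<le> c * (-2)" using c by (intro mult_left_mono) auto
      then show False using k x(3) by linarith
    qed
    ultimately have "k = 1 \<or> k = -1" by linarith
    then show ?thesis using k by auto
  qed
  show ?thesis
  proof (rule ccontr)
    assume "\<not> ?thesis"
    then have "2 * (\<alpha>\<^sub>1 - \<alpha>\<^sub>2) = c \<or> 2 * (\<alpha>\<^sub>1 - \<alpha>\<^sub>2) = - c" "2 * (\<alpha>\<^sub>1 - \<alpha>\<^sub>3) = c \<or> 2 * (\<alpha>\<^sub>1 - \<alpha>\<^sub>3) = - c"
      using half[of "\<alpha>\<^sub>1 - \<alpha>\<^sub>2"] half[of "\<alpha>\<^sub>1 - \<alpha>\<^sub>3"] \<alpha> ne by auto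
    then show False using \<alpha> ne by auto
  qed
qed

lemma card_ge_3_elements:
  assumes "3 \<le> card S"
  obtains a b e where "a \<in> S" "b \<in> S" "e \<in> S" "a \<noteq> b" "a \<noteq> e" "b \<noteq> e"
proof -
  obtain S' where "S' \<subseteq> S" "card S' = 3" using assms by (meson obtain_subset_with_card_n)
  then show ?thesis using that by (auto simp: card_3_iff)
qed

lemma period_diff:
  assumes "\<And>i. f (i + r) = f (i::int)"
  shows "f (i - r) = f i"
  using assms[of "i - r"] by simp

lemma period_reflect:
  assumes "\<And>i. f (i + r) = f (i::int)" and "\<epsilon> \<in> {1, -1 :: int}"
  shows "f (a + \<epsilon> * (J + r)) = f (a + \<epsilon> * J)"
proof -
  have "a + \<epsilon> * (J + r) = (a + \<epsilon> * J) + r \<or> a + \<epsilon> * (J + r) = (a + \<epsilon> * J) - r"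
    using assms(2) by auto
  then show ?thesis using assms(1) period_diff[of f r] by metis
qed

section \<open>Classification of the matched cards by the vertex deleted from T\<close>

locale matched_cards = sun_pair G c X w v \<nu>
  for G :: "'a pair_pre_digraph" and c X w v \<nu> +
  fixes A :: "'a set" and \<beta> :: "'a \<Rightarrow> 'a"
  assumes A_sub: "A \<subseteq> pverts U\<^sub>0" and inj_\<beta>: "inj_on \<beta> A" and \<beta>_sub: "\<beta> ` A \<subseteq> pverts T\<^sub>0"
    and matched: "a \<in> A \<Longrightarrow> \<exists>f. graph_iso f (delete_vert U\<^sub>0 a) (delete_vert T\<^sub>0 (\<beta> a))"
begin

definition ends :: "'a set" where
  "ends = {X (\<nu> + 1 + lo \<nu>), X (\<nu> + 1 + hi \<nu>)}"

definition A_inner :: "'a set" where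
  "A_inner = {a \<in> A. deg T\<^sub>0 (\<beta> a) \<noteq> 1}"

definition A_bad :: "'a set" where
  "A_bad = {a \<in> A. deg T\<^sub>0 (\<beta> a) = 1 \<and> (\<exists>p. nbrs T\<^sub>0 (\<beta> a) = {p} \<and> deg T\<^sub>0 p = 2)}"

definition A_good :: "'a set" where
  "A_good = {a \<in> A. \<exists>p. nbrs T\<^sub>0 (\<beta> a) = {p} \<and> 3 \<le> deg T\<^sub>0 p}"

lemma finite_A: "finite A"
  using A_sub finite_pverts[OF U.pair_graph] by (rule finite_subset)

lemma A_range: "A \<subseteq> range X"
proof
  fix a assume a: "a \<in> A"
  then obtain f where "graph_iso f (delete_vert U\<^sub>0 a) (delete_vert T\<^sub>0 (\<beta> a))" using matched by blast
  then show "a \<in> range X" using matched_cycle a A_sub \<beta>_sub by blast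
qed

lemma card_A_le_c: "int (card A) \<le> c"
proof -
  have "finite (range X)" unfolding range_X by simp
  then have "card A \<le> card (range X)" using A_range by (rule card_mono)
  then show ?thesis using card_range_X by simp
qed

lemma A_split: "A \<subseteq> A_inner \<union> (A_bad \<union> A_good)"
proof
  fix a assume a: "a \<in> A"
  then obtain f where f: "graph_iso f (delete_vert U\<^sub>0 a) (delete_vert T\<^sub>0 (\<beta> a))" using matched by blast
  have mem: "a \<in> pverts U\<^sub>0" "\<beta> a \<in> pverts T\<^sub>0" using a A_sub \<beta>_sub by auto
  show "a \<in> A_inner \<union> (A_bad \<union> A_good)"
  proof (cases "deg T\<^sub>0 (\<beta> a) = 1")
    case True
    then obtain p where "nbrs T\<^sub>0 (\<beta> a) = {p}" "2 \<le> deg T\<^sub>0 p" using matched_leaf[OF mem f] by metis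
    moreover from this have "deg T\<^sub>0 p = 2 \<or> 3 \<le> deg T\<^sub>0 p" by linarith
    ultimately show ?thesis using a True unfolding A_bad_def A_good_def by blast
  qed (use a in \<open>simp add: A_inner_def\<close>)
qed

lemma card_A_le: "card A \<le> card A_inner + card A_bad + card A_good"
proof -
  have fin: "finite A_inner" "finite A_bad" "finite A_good"
    using finite_A by (simp_all add: A_inner_def A_bad_def A_good_def)
  then have "card A \<le> card (A_inner \<union> (A_bad \<union> A_good))" using A_split by (intro card_mono) auto
  then show ?thesis
    using card_Un_le[of A_inner "A_bad \<union> A_good"] card_Un_le[of A_bad A_good] by linarith
qed

lemma card_inner: "card A_inner \<le> 2"
proof -
  have "\<beta> ` A_inner \<subseteq> ends"
  proof
    fix b assume "b \<in> \<beta> ` A_inner"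
    then obtain a where a: "a \<in> A" "deg T\<^sub>0 (\<beta> a) \<noteq> 1" "b = \<beta> a" by (auto simp: A_inner_def)
    then obtain f where f: "graph_iso f (delete_vert U\<^sub>0 a) (delete_vert T\<^sub>0 (\<beta> a))" using matched by blast
    have mem: "a \<in> pverts U\<^sub>0" "\<beta> a \<in> pverts T\<^sub>0" using a A_sub \<beta>_sub by auto
    have "2 \<le> deg T\<^sub>0 (\<beta> a)" using a(2) deg_T_ge_1[OF mem(2)] by linarith
    then show "b \<in> ends" using matched_nonleaf[OF mem f] a(3) by (simp add: ends_def)
  qed
  then have "card (\<beta> ` A_inner) \<le> card ends" by (intro card_mono) (auto simp: ends_def)
  also have "\<dots> \<le> 2" by (simp add: ends_def card_insert_if)
  finally show ?thesis
    using inj_\<beta> by (subst (asm) card_image) (auto simp: A_inner_def intro: inj_on_subset)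
qed

lemma leaf_notin_core: "deg T\<^sub>0 b = 1 \<Longrightarrow> b \<in> pverts T\<^sub>0 \<Longrightarrow> b \<notin> core \<nu>"
  using deg_T_ge_2_iff by fastforce

text \<open>Besides its leaves, \<open>p\<close> has a neighbour in the core, hence the strict
  inequality.\<close>

lemma card_leaf_nbrs:
  assumes c: "5 \<le> c" and p: "p \<in> core \<nu>" and B: "B \<subseteq> pverts T\<^sub>0" "\<And>b. b \<in> B \<Longrightarrow> nbrs T\<^sub>0 b = {p}"
  shows "card B < deg T\<^sub>0 p"
proof -
  have "B \<subset> nbrs T\<^sub>0 p"
  proof
    show "B \<subseteq> nbrs T\<^sub>0 p" using B(2) nbrs_sym[OF pair_graph_T] by blast
    have "B \<inter> core \<nu> = {}" using leaf_notin_core B by fastforce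
    then show "B \<noteq> nbrs T\<^sub>0 p" using core_has_core_nbr[OF d_\<nu> p c] by (auto simp: v_eq)
  qed
  then show ?thesis using finite_nbrs[OF pair_graph_T] by (rule psubset_card_mono[rotated])
qed

text \<open>A core end of degree two has a core neighbour and hence at most one leaf, so different
  bad cards use different ends.\<close>

lemma card_bad:
  assumes c: "5 \<le> c"
  shows "card A_bad \<le> card {z \<in> ends. deg T\<^sub>0 z = 2}"
proof -
  define q where "q b = the_elem (nbrs T\<^sub>0 b)" for b
  have q: "nbrs T\<^sub>0 (\<beta> a) = {q (\<beta> a)}" "deg T\<^sub>0 (q (\<beta> a)) = 2" "q (\<beta> a) \<in> core \<nu>" "q (\<beta> a) \<in> ends"
    if a: "a \<in> A_bad" for a
  proof -
    obtain p where p: "a \<in> A" "deg T\<^sub>0 (\<beta> a) = 1" "nbrs T\<^sub>0 (\<beta> a) = {p}" "deg T\<^sub>0 p = 2"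
      using a by (auto simp: A_bad_def)
    then obtain f where f: "graph_iso f (delete_vert U\<^sub>0 a) (delete_vert T\<^sub>0 (\<beta> a))" using matched by blast
    have mem: "a \<in> pverts U\<^sub>0" "\<beta> a \<in> pverts T\<^sub>0" using p(1) A_sub \<beta>_sub by auto
    obtain p' where "nbrs T\<^sub>0 (\<beta> a) = {p'}" "p' \<in> core \<nu>" "deg T\<^sub>0 p' = 2 \<Longrightarrow> p' \<in> ends"
      using matched_leaf[OF mem f p(2)] unfolding ends_def by metis
    then show "nbrs T\<^sub>0 (\<beta> a) = {q (\<beta> a)}" "deg T\<^sub>0 (q (\<beta> a)) = 2" "q (\<beta> a) \<in> core \<nu>" "q (\<beta> a) \<in> ends"
      using p by (simp_all add: q_def)
  qed
  have "inj_on (\<lambda>a. q (\<beta> a)) A_bad"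
  proof (rule inj_onI)
    fix a a' assume a: "a \<in> A_bad" "a' \<in> A_bad" "q (\<beta> a) = q (\<beta> a')"
    have AA: "a \<in> A" "a' \<in> A" using a by (auto simp: A_bad_def)
    have "card {\<beta> a, \<beta> a'} < deg T\<^sub>0 (q (\<beta> a))"
      using c q(3)[OF a(1)] q(1)[OF a(1)] q(1)[OF a(2)] a(3) \<beta>_sub AA
      by (intro card_leaf_nbrs) auto
    then have "card {\<beta> a, \<beta> a'} < 2" using q(2)[OF a(1)] by simp
    then have "\<beta> a = \<beta> a'" by (cases "\<beta> a = \<beta> a'") auto
    then show "a = a'" using inj_\<beta> AA by (auto dest: inj_onD)
  qed
  moreover have "(\<lambda>a. q (\<beta> a)) ` A_bad \<subseteq> {z \<in> ends. deg T\<^sub>0 z = 2}" using q by auto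
  ultimately show ?thesis by (rule card_inj_on_le) (simp add: ends_def)
qed

definition I_good :: "int set" where
  "I_good = {\<alpha> \<in> {0..<c}. X \<alpha> \<in> A_good}"

lemma card_I_good: "card I_good = card A_good" and finite_I_good: "finite I_good"
proof -
  have "X ` I_good = A_good"
  proof
    show "A_good \<subseteq> X ` I_good"
    proof
      fix a assume a: "a \<in> A_good"
      then have "a \<in> X ` {0..<c}" using A_range range_X by (auto simp: A_good_def)
      then show "a \<in> X ` I_good" using a by (auto simp: I_good_def)
    qed
  qed (auto simp: I_good_def)
  moreover have "inj_on X I_good" using inj_on_X by (rule inj_on_subset) (auto simp: I_good_def)
  ultimately show "card I_good = card A_good" using card_image by fastforce
  show "finite I_good" by (rule finite_subset[of _ "{0..<c}"]) (auto simp: I_good_def)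
qed

text \<open>Collects what the two cases need from one good card: the degree bound enters the product
  estimate of the periodic case, and the isomorphism shows in the aperiodic case that the leaf can
  be moved.\<close>

definition fits :: "int \<Rightarrow> int \<Rightarrow> int \<Rightarrow> int \<Rightarrow> bool" where
  "fits \<alpha> \<epsilon> \<tau> K \<longleftrightarrow> \<epsilon> \<in> {1, -1} \<and> \<tau> \<in> {0, 1} \<and> (\<tau> = 1 \<longrightarrow> d (\<nu> + 1) = 2 \<and> 3 \<le> d (\<nu> - 1)) \<and>
     (\<forall>J. U.d (\<alpha> + \<epsilon> * J) + mark c K J = completion \<tau> J) \<and> \<not> c dvd K \<and> U.d \<alpha> = 2 \<and>
     X (\<nu> + \<tau> + K) \<in> core \<nu> \<and> nbrs T\<^sub>0 (\<beta> (X \<alpha>)) = {X (\<nu> + \<tau> + K)} \<and> 3 \<le> deg T\<^sub>0 (X (\<nu> + \<tau> + K)) \<and>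
     int (deg T\<^sub>0 (X (\<nu> + \<tau> + K))) \<le> U.d (\<alpha> + \<epsilon> * K) + 1 \<and>
     (\<exists>g. graph_iso g (delete_vert (moved (\<alpha> + \<epsilon> * K)) (X \<alpha>)) T\<^sub>0)"

lemma ex_fits:
  assumes "\<alpha> \<in> I_good"
  obtains \<epsilon> \<tau> K where "fits \<alpha> \<epsilon> \<tau> K"
proof -
  have "X \<alpha> \<in> A" using assms by (auto simp: I_good_def A_good_def)
  then have b: "\<beta> (X \<alpha>) \<in> pverts T\<^sub>0" using \<beta>_sub by auto
  obtain p where p: "nbrs T\<^sub>0 (\<beta> (X \<alpha>)) = {p}" "3 \<le> deg T\<^sub>0 p"
    using assms by (auto simp: I_good_def A_good_def)
  obtain f where f: "graph_iso f (delete_vert U\<^sub>0 (X \<alpha>)) (delete_vert T\<^sub>0 (\<beta> (X \<alpha>)))"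
    using matched \<open>X \<alpha> \<in> A\<close> by blast
  obtain \<epsilon> \<tau> K where *: "\<epsilon> \<in> {1, -1}" "\<tau> \<in> {0, 1}" "\<tau> = 1 \<Longrightarrow> d (\<nu> + 1) = 2 \<and> 3 \<le> d (\<nu> - 1)"
    "\<And>J. U.d (\<alpha> + \<epsilon> * J) + mark c K J = completion \<tau> J"
    "p = X (\<nu> + \<tau> + K)" "f (X (\<alpha> + \<epsilon> * K)) = p" "\<not> c dvd K"
    by (rule matched_word[OF b f p]) (rule that)
  have ne: "X (\<alpha> + \<epsilon> * K) \<noteq> X \<alpha>" using *(1,7) by (auto simp: X_eq_iff)
  have D: "pair_graph (delete_vert U\<^sub>0 (X \<alpha>))" by (rule pair_graph_delete[OF U.pair_graph])
  \<comment> \<open>After the deletions the degrees of \<open>p\<close> and of its preimage agree;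
    \<open>p\<close> has lost only its leaf \<open>b\<close>, and the preimage has at most its
    original degree.\<close>
  have "int (deg T\<^sub>0 p) \<le> U.d (\<alpha> + \<epsilon> * K) + 1"
  proof -
    have "X (\<alpha> + \<epsilon> * K) \<in> pverts (delete_vert U\<^sub>0 (X \<alpha>))" using ne U.X_pverts by simp
    then have "deg (delete_vert T\<^sub>0 (\<beta> (X \<alpha>))) p = deg (delete_vert U\<^sub>0 (X \<alpha>)) (X (\<alpha> + \<epsilon> * K))"
      using iso_deg[OF D f] *(6) by metis
    moreover have "p \<noteq> \<beta> (X \<alpha>)" using p(1) not_in_own_nbrs[OF pair_graph_T, of "\<beta> (X \<alpha>)"] by auto
    moreover have "deg (delete_vert U\<^sub>0 (X \<alpha>)) (X (\<alpha> + \<epsilon> * K)) \<le> deg U\<^sub>0 (X (\<alpha> + \<epsilon> * K))"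
      using ne finite_nbrs[OF U.pair_graph] by (simp add: nbrs_delete card_Diff1_le)
    ultimately show ?thesis
      using deg_T_delete_leaf[OF b f p, of p] by (simp add: U.d_def)
  qed
  moreover have "graph_iso (f(w := \<beta> (X \<alpha>))) (delete_vert (moved (\<alpha> + \<epsilon> * K)) (X \<alpha>)) T\<^sub>0"
    by (rule moved_delete_iso[OF b f p(1) *(6) ne])
  ultimately have "fits \<alpha> \<epsilon> \<tau> K"
    unfolding fits_def *(5)[symmetric] using * p p_core[OF b f p] nice_Ud[OF b f p] by blast
  then show ?thesis using that by blast
qed

lemma fits_shift:
  assumes "fits \<alpha> \<epsilon> \<tau> K"
  shows "U.d i + mark c (\<alpha> + \<epsilon> * K) i = completion \<tau> (\<epsilon> * (i - \<alpha>))"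
proof -
  have \<epsilon>: "\<epsilon> \<in> {1, -1}" and *: "\<And>J. U.d (\<alpha> + \<epsilon> * J) + mark c K J = completion \<tau> J"
    using assms by (auto simp: fits_def)
  have "\<alpha> + \<epsilon> * (\<epsilon> * (i - \<alpha>)) = i" using \<epsilon> by auto
  then show ?thesis
    using *[of "\<epsilon> * (i - \<alpha>)"] mark_reflect[OF \<epsilon>, of c \<alpha> K "\<epsilon> * (i - \<alpha>)"] by simp
qed

text \<open>Three cards with the same orientation and completion see one word \<open>?W\<close>
  under three different rotations, which is the situation of \<open>three_rotations\<close>. With a
  common foot \<open>y\<close>, differences of their positions become periods of the word with the
  mark added.\<close>

lemma aperiodic_case:
  assumes aper: "\<And>r. (\<And>i. U.d (i + r) = U.d i) \<Longrightarrow> c dvd r" and card: "10 \<le> card A_good"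
  obtains \<alpha> y r g where "graph_iso g (delete_vert (moved y) (X \<alpha>)) T\<^sub>0" "U.d \<alpha> = 2" "\<not> c dvd \<alpha> - y"
    "\<And>i. U.d (i + r) + mark c y (i + r) = U.d i + mark c y i" "\<not> c dvd 2 * r"
proof -
  have "\<forall>\<alpha>\<in>I_good. \<exists>\<epsilon> \<tau> K. fits \<alpha> \<epsilon> \<tau> K" using ex_fits by metis
  then obtain e t k where ft: "\<And>\<alpha>. \<alpha> \<in> I_good \<Longrightarrow> fits \<alpha> (e \<alpha>) (t \<alpha>) (k \<alpha>)" by metis
  define S where "S \<epsilon> \<tau> = {\<alpha> \<in> I_good. e \<alpha> = \<epsilon> \<and> t \<alpha> = \<tau>}" for \<epsilon> \<tau> :: int
  have "I_good \<subseteq> (S 1 0 \<union> S 1 1) \<union> (S (-1) 0 \<union> S (-1) 1)"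
    using ft by (fastforce simp: S_def fits_def)
  moreover have "finite (S \<epsilon> \<tau>)" for \<epsilon> \<tau> using finite_I_good by (simp add: S_def)
  ultimately have "card I_good \<le> card ((S 1 0 \<union> S 1 1) \<union> (S (-1) 0 \<union> S (-1) 1))"
    by (intro card_mono) auto
  also have "\<dots> \<le> (card (S 1 0) + card (S 1 1)) + (card (S (-1) 0) + card (S (-1) 1))"
    by (intro order.trans[OF card_Un_le] add_mono card_Un_le)
  finally have sum: "10 \<le> (card (S 1 0) + card (S 1 1)) + (card (S (-1) 0) + card (S (-1) 1))"
    using card card_I_good by simp
  have "\<exists>\<epsilon> \<tau>. 3 \<le> card (S \<epsilon> \<tau>)"
  proof (rule ccontr)
    assume "\<not> ?thesis"
    then have "card (S \<epsilon> \<tau>) < 3" for \<epsilon> \<tau> by (meson not_le)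
    from this[of 1 0] this[of 1 1] this[of "-1" 0] this[of "-1" 1] show False using sum by linarith
  qed
  then obtain \<epsilon> \<tau> where "3 \<le> card (S \<epsilon> \<tau>)" by blast
  then obtain \<alpha>\<^sub>1 \<alpha>\<^sub>2 \<alpha>\<^sub>3 where \<alpha>: "\<alpha>\<^sub>1 \<in> S \<epsilon> \<tau>" "\<alpha>\<^sub>2 \<in> S \<epsilon> \<tau>" "\<alpha>\<^sub>3 \<in> S \<epsilon> \<tau>" "\<alpha>\<^sub>1 \<noteq> \<alpha>\<^sub>2" "\<alpha>\<^sub>1 \<noteq> \<alpha>\<^sub>3" "\<alpha>\<^sub>2 \<noteq> \<alpha>\<^sub>3"
    by (rule card_ge_3_elements)
  define a where "a s = (if s = 1 then \<alpha>\<^sub>1 else if s = 2 then \<alpha>\<^sub>2 else \<alpha>\<^sub>3)" for s :: nat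
  define y where "y s = a s + \<epsilon> * k (a s)" for s
  have aS: "a s \<in> S \<epsilon> \<tau>" for s using \<alpha> by (simp add: a_def)
  have fa: "fits (a s) \<epsilon> \<tau> (k (a s))" for s using ft[of "a s"] aS[of s] by (simp add: S_def)
  have a_range: "a s \<in> {0..<c}" for s using aS by (auto simp: S_def I_good_def)
  let ?W = "\<lambda>i. completion \<tau> (\<epsilon> * i)"
  have h: "U.d i + mark c (y s) i = ?W (i - a s)" for s i
    using fits_shift[OF fa] by (simp add: y_def)
  have a_ne: "\<not> c dvd a s - a t" if "s \<in> {1, 2, 3}" "t \<in> {1, 2, 3}" "s \<noteq> t" for s t
  proof
    assume "c dvd a s - a t"
    then have "X (a s) = X (a t)" by (simp add: X_eq_iff)
    then have "a s = a t" using inj_on_X a_range by (blast dest: inj_onD)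
    then show False using that \<alpha> by (auto simp: a_def split: if_splits)
  qed
  have yy: "c dvd y 2 - y 1" "c dvd y 3 - y 1"
    using three_rotations[of U.d c y ?W a, OF h a_ne aper U.d_add_c] by auto
  define D where "D i = U.d i + mark c (y 1) i" for i
  have D: "D i = ?W (i - a s)" if "s \<in> {1, 2, 3}" for s i
  proof -
    have "mark c (y s) i = mark c (y 1) i" using that yy by (auto intro: mark_cong)
    then show ?thesis using h[of i s] by (simp add: D_def)
  qed
  have per: "D (i + (a 1 - a s)) = D i" if "s \<in> {1, 2, 3}" for s i
  proof -
    have "D (i + (a 1 - a s)) = ?W (i - a s)" using D[of 1 "i + (a 1 - a s)"] by simp
    then show ?thesis using D[OF that, of i] by simp
  qed
  \<comment> \<open>At most one of the two differences is a half turn; the other gives a rotation of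
    order at least three.\<close>
  have "\<not> c dvd 2 * (a 1 - a 2) \<or> \<not> c dvd 2 * (a 1 - a 3)"
    using half_period_unique[OF a_range[of 1] a_range[of 2] a_range[of 3]] \<alpha>(4-6) by (simp add: a_def)
  then obtain s where s: "s \<in> {1, 2, 3}" "\<not> c dvd 2 * (a 1 - a s)" by blast
  obtain g where "graph_iso g (delete_vert (moved (y 1)) (X (a 1))) T\<^sub>0" "U.d (a 1) = 2" "\<not> c dvd k (a 1)" "\<epsilon> \<in> {1, -1}"
    using fa[of 1] by (auto simp: fits_def y_def)
  moreover from this have "\<not> c dvd a 1 - y 1" by (auto simp: y_def)
  ultimately show ?thesis using that[of g "y 1" "a 1" "a 1 - a s"] per[OF s(1)] s(2) by (simp add: D_def)
qed

text \<open>With orientation, completion and class of the mark fixed, the word of \<open>U\<close>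
  read from \<open>\<alpha>\<close> is the same for every \<open>\<alpha>\<close> in
  \<open>S\<close>, so two such starting points differ by a period.\<close>

lemma card_fits_le_periods:
  assumes S: "\<And>\<alpha>. \<alpha> \<in> S \<Longrightarrow> \<alpha> \<in> {0..<c} \<and> (\<exists>K. c dvd K - K\<^sub>0 \<and> fits \<alpha> \<epsilon> \<tau> K)"
  shows "card S \<le> card (periods c U.d)"
proof (cases "S = {}")
  case False
  then obtain \<alpha>\<^sub>0 where \<alpha>\<^sub>0: "\<alpha>\<^sub>0 \<in> S" by blast
  have word: "\<epsilon> \<in> {1, -1}" "U.d (\<alpha> + \<epsilon> * J) = completion \<tau> J - mark c K\<^sub>0 J" if "\<alpha> \<in> S" for \<alpha> J
  proof -
    obtain K where K: "c dvd K - K\<^sub>0" "fits \<alpha> \<epsilon> \<tau> K" using S \<open>\<alpha> \<in> S\<close> by blast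
    then show "\<epsilon> \<in> {1, -1}" by (simp add: fits_def)
    have "U.d (\<alpha> + \<epsilon> * J) + mark c K J = completion \<tau> J" using K(2) by (simp add: fits_def)
    then show "U.d (\<alpha> + \<epsilon> * J) = completion \<tau> J - mark c K\<^sub>0 J" using mark_cong[OF K(1), of J] by simp
  qed
  have "inj_on (\<lambda>\<alpha>. (\<alpha> - \<alpha>\<^sub>0) mod c) S"
  proof (rule inj_onI)
    fix \<alpha> \<alpha>' assume \<alpha>: "\<alpha> \<in> S" "\<alpha>' \<in> S" "(\<alpha> - \<alpha>\<^sub>0) mod c = (\<alpha>' - \<alpha>\<^sub>0) mod c"
    then have "X \<alpha> = X \<alpha>'" by (simp add: X_eq_iff mod_eq_dvd_iff)
    then show "\<alpha> = \<alpha>'" using inj_on_X S \<alpha> by (blast dest: inj_onD)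
  qed
  moreover have "(\<lambda>\<alpha>. (\<alpha> - \<alpha>\<^sub>0) mod c) ` S \<subseteq> periods c U.d"
  proof (rule image_subsetI)
    fix \<alpha> assume \<alpha>: "\<alpha> \<in> S"
    have "U.d (i + (\<alpha> - \<alpha>\<^sub>0)) = U.d i" for i
    proof -
      have "i + (\<alpha> - \<alpha>\<^sub>0) = \<alpha> + \<epsilon> * (\<epsilon> * (i - \<alpha>\<^sub>0))" "i = \<alpha>\<^sub>0 + \<epsilon> * (\<epsilon> * (i - \<alpha>\<^sub>0))"
        using word(1)[OF \<alpha>] by auto
      then show ?thesis using word(2)[OF \<alpha>] word(2)[OF \<alpha>\<^sub>0] by metis
    qed
    then show "(\<alpha> - \<alpha>\<^sub>0) mod c \<in> periods c U.d"
      using c_ge_3 U.d_add_c by (intro mod_periods) auto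
  qed
  ultimately show ?thesis by (intro card_inj_on_le[OF _ _ finite_periods])
qed simp

text \<open>The orbits of a vertex of degree \<open>\<delta> \<ge> 3\<close> and of one of degree two under the
  rotations of the word, with the attached leaves, have at least \<open>\<delta>\<close> vertices per rotation.\<close>

lemma card_periods_mult_le:
  assumes i: "3 \<le> U.d i" and \<alpha>: "U.d \<alpha> = 2"
  shows "int (card (periods c U.d)) * U.d i \<le> int (card (pverts U\<^sub>0))"
proof -
  let ?R = "periods c U.d" and ?o = "\<lambda>j r. (j + r) mod c"
  have Ud: "U.d (?o j r) = U.d j" if "r \<in> ?R" for j r
  proof -
    have "U.d (?o j r) = U.d (j + r)" by (rule U.d_cong) (simp add: mod_eq_dvd_iff[symmetric])
    then show ?thesis using that by (simp add: periods_def)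
  qed
  have inj: "inj_on (?o j) ?R" for j
  proof (rule inj_onI)
    fix r r' assume r: "r \<in> ?R" "r' \<in> ?R" "?o j r = ?o j r'"
    then have "X r = X r'" by (simp add: X_eq_iff mod_eq_dvd_iff)
    then show "r = r'" using inj_on_X r(1,2) by (auto simp: periods_def dest: inj_onD)
  qed
  have sum: "(\<Sum>j\<in>?o k ` ?R. U.d j - 1) = int (card ?R) * (U.d k - 1)" for k
  proof -
    have "(\<Sum>j\<in>?o k ` ?R. U.d j - 1) = (\<Sum>r\<in>?R. U.d (?o k r) - 1)"
      by (subst sum.reindex[OF inj]) simp
    also have "\<dots> = (\<Sum>r\<in>?R. U.d k - 1)" by (rule sum.cong) (simp_all only: Ud)
    finally show ?thesis by simp
  qed
  have "?o i ` ?R \<inter> ?o \<alpha> ` ?R = {}"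
  proof (rule ccontr)
    assume "\<not> ?thesis"
    then obtain r r' where "r \<in> ?R" "r' \<in> ?R" "?o i r = ?o \<alpha> r'" by blast
    then have "U.d i = U.d \<alpha>" using Ud by metis
    then show False using i \<alpha> by simp
  qed
  then have "(\<Sum>j\<in>?o i ` ?R \<union> ?o \<alpha> ` ?R. U.d j - 1) =
      (\<Sum>j\<in>?o i ` ?R. U.d j - 1) + (\<Sum>j\<in>?o \<alpha> ` ?R. U.d j - 1)"
    by (intro sum.union_disjoint) simp_all
  then have "(\<Sum>j\<in>?o i ` ?R \<union> ?o \<alpha> ` ?R. U.d j - 1) = int (card ?R) * U.d i"
    unfolding sum using \<alpha> by (simp add: algebra_simps)
  moreover have "?o i ` ?R \<union> ?o \<alpha> ` ?R \<subseteq> {0..<c}" using c_ge_3 by auto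
  ultimately show ?thesis using U.sum_le_card_pverts by metis
qed

text \<open>For one completion the two estimates multiply to
  \<open>card (S \<tau>)^2 <= 2 * card ?R * ?\<delta>\<close>, and the orbit count bounds the right
  side by twice the order of \<open>U\<close>. The factor 2 stands for the two orientations and is
  the source of the 2 under the root.\<close>

lemma periodic_case:
  assumes per: "\<And>i. U.d (i + r) = U.d i" and r: "\<not> c dvd r"
    and sq: "\<And>m::nat. m * m \<le> 2 * card (pverts U\<^sub>0) \<Longrightarrow> m \<le> s" and s: "5 \<le> s" and c: "14 \<le> c"
  shows "card A \<le> 2 * s + 3"
proof (rule ccontr)
  assume big: "\<not> card A \<le> 2 * s + 3"
  have "\<forall>\<alpha>\<in>I_good. \<exists>\<epsilon> \<tau> K. fits \<alpha> \<epsilon> \<tau> K" using ex_fits by metis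
  then obtain e t k where ft: "\<And>\<alpha>. \<alpha> \<in> I_good \<Longrightarrow> fits \<alpha> (e \<alpha>) (t \<alpha>) (k \<alpha>)" by metis
  have e: "e \<alpha> \<in> {1, -1}" and t: "t \<alpha> \<in> {0, 1}"
    and word: "U.d (\<alpha> + e \<alpha> * J) + mark c (k \<alpha>) J = completion (t \<alpha>) J" if "\<alpha> \<in> I_good" for \<alpha> J
    using ft[OF that] by (auto simp: fits_def)
  have same: "c dvd k \<alpha> - k \<alpha>'" if \<alpha>: "\<alpha> \<in> I_good" "\<alpha>' \<in> I_good" "t \<alpha> = t \<alpha>'" for \<alpha> \<alpha>'
  proof (rule periodic_difference_two_marks)
    show "U.d (\<alpha>' + e \<alpha>' * J) - U.d (\<alpha> + e \<alpha> * J) = mark c (k \<alpha>) J - mark c (k \<alpha>') J" for J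
      using word[OF \<alpha>(1), of J] word[OF \<alpha>(2), of J] \<alpha>(3) by simp
    show "U.d (\<alpha>' + e \<alpha>' * (J + r)) = U.d (\<alpha>' + e \<alpha>' * J)" for J
      using per e[OF \<alpha>(2)] by (rule period_reflect)
    show "U.d (\<alpha> + e \<alpha> * (J + r)) = U.d (\<alpha> + e \<alpha> * J)" for J
      using per e[OF \<alpha>(1)] by (rule period_reflect)
  qed (rule r)
  let ?R = "periods c U.d"
  define S where "S \<tau> = {\<alpha> \<in> I_good. t \<alpha> = \<tau>}" for \<tau>
  have finS: "finite (S \<tau>)" for \<tau> using finite_I_good by (simp add: S_def)
  have le_R: "card (S \<tau>) \<le> 2 * card ?R" for \<tau>
  proof (cases "S \<tau> = {}")
    case False
    then obtain \<alpha>\<^sub>0 where \<alpha>\<^sub>0: "\<alpha>\<^sub>0 \<in> S \<tau>" by blast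
    let ?S = "\<lambda>\<epsilon>. {\<alpha> \<in> S \<tau>. e \<alpha> = \<epsilon>}"
    have one: "card (?S \<epsilon>) \<le> card ?R" for \<epsilon>
    proof (rule card_fits_le_periods[where K\<^sub>0 = "k \<alpha>\<^sub>0"])
      fix \<alpha> assume "\<alpha> \<in> ?S \<epsilon>"
      then show "\<alpha> \<in> {0..<c} \<and> (\<exists>K. c dvd K - k \<alpha>\<^sub>0 \<and> fits \<alpha> \<epsilon> \<tau> K)"
        using same[of \<alpha> \<alpha>\<^sub>0] ft[of \<alpha>] \<alpha>\<^sub>0 by (auto simp: S_def I_good_def)
    qed
    have "S \<tau> \<subseteq> ?S 1 \<union> ?S (-1)" using e by (auto simp: S_def)
    then have "card (S \<tau>) \<le> card (?S 1 \<union> ?S (-1))" using finS by (intro card_mono) auto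
    then show ?thesis using card_Un_le[of "?S 1" "?S (-1)"] one[of 1] one[of "-1"] by linarith
  qed simp
  have le_s: "card (S \<tau>) \<le> s" for \<tau>
  \<comment> \<open>More than two cards make the degree at the mark at least three, which separates
    its orbit from that of the degree-two vertex \<open>X \<alpha>\<close>.\<close>
  proof (cases "card (S \<tau>) \<le> 2")
    case False
    then obtain \<alpha> where \<alpha>: "\<alpha> \<in> S \<tau>" by fastforce
    then have \<alpha>I: "\<alpha> \<in> I_good" "t \<alpha> = \<tau>" by (auto simp: S_def)
    let ?p = "X (\<nu> + \<tau> + k \<alpha>)" and ?\<delta> = "U.d (\<alpha> + e \<alpha> * k \<alpha>)"
    have f\<alpha>: "?p \<in> core \<nu>" "int (deg T\<^sub>0 ?p) \<le> ?\<delta> + 1" "U.d \<alpha> = 2"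
      using ft[OF \<alpha>I(1)] \<alpha>I(2) by (auto simp: fits_def)
    \<comment> \<open>All deleted leaves hang at the one vertex \<open>?p\<close>. The strictness
      makes up for the extra 1 in \<open>f\<alpha>(2)\<close>.\<close>
    have "card ((\<lambda>\<alpha>. \<beta> (X \<alpha>)) ` S \<tau>) < deg T\<^sub>0 ?p"
    proof (rule card_leaf_nbrs[OF _ f\<alpha>(1)])
      show "(\<lambda>\<alpha>. \<beta> (X \<alpha>)) ` S \<tau> \<subseteq> pverts T\<^sub>0"
        using \<beta>_sub by (auto simp: S_def I_good_def A_good_def)
      fix b assume "b \<in> (\<lambda>\<alpha>. \<beta> (X \<alpha>)) ` S \<tau>"
      then obtain \<alpha>' where \<alpha>': "\<alpha>' \<in> S \<tau>" "b = \<beta> (X \<alpha>')" by blast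
      then have "nbrs T\<^sub>0 b = {X (\<nu> + \<tau> + k \<alpha>')}" using ft[of \<alpha>'] by (auto simp: S_def fits_def)
      moreover have "X (\<nu> + \<tau> + k \<alpha>') = ?p"
        using same[of \<alpha>' \<alpha>] \<alpha> \<alpha>'(1) by (simp add: S_def X_eq_iff)
      ultimately show "nbrs T\<^sub>0 b = {?p}" by simp
    qed (use c in simp)
    moreover have "inj_on (\<lambda>\<alpha>. \<beta> (X \<alpha>)) (S \<tau>)"
    proof (rule inj_onI)
      fix i j assume ij: "i \<in> S \<tau>" "j \<in> S \<tau>" "\<beta> (X i) = \<beta> (X j)"
      then have "X i \<in> A" "X j \<in> A" "i \<in> {0..<c}" "j \<in> {0..<c}"
        by (auto simp: S_def I_good_def A_good_def)
      then show "i = j" using inj_\<beta> inj_on_X ij(3) by (blast dest: inj_onD)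
    qed
    ultimately have \<delta>: "int (card (S \<tau>)) \<le> ?\<delta>" using f\<alpha>(2) by (simp add: card_image)
    then have "int (card ?R) * ?\<delta> \<le> int (card (pverts U\<^sub>0))"
      using False f\<alpha>(3) by (intro card_periods_mult_le) auto
    moreover have "int (card (S \<tau>)) * int (card (S \<tau>)) \<le> int (2 * card ?R) * ?\<delta>"
      using \<delta> le_R[of \<tau>] by (intro mult_mono) auto
    ultimately have "int (card (S \<tau>) * card (S \<tau>)) \<le> int (2 * card (pverts U\<^sub>0))" by simp
    then show ?thesis using sq by (simp only: of_nat_le_iff)
  qed (use s in simp)
  have "I_good \<subseteq> S 0 \<union> S 1" using t by (auto simp: S_def)
  then have "card I_good \<le> card (S 0 \<union> S 1)" using finS by (intro card_mono) auto
  then have good: "card A_good \<le> card (S 0) + card (S 1)"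
    using card_Un_le[of "S 0" "S 1"] card_I_good by linarith
  let ?Z = "{z \<in> ends. deg T\<^sub>0 z = 2}"
  have "card ?Z \<le> card ends" by (intro card_mono) (auto simp: ends_def)
  moreover have "card ends \<le> 2" by (simp add: ends_def card_insert_if)
  ultimately have Z: "card A_bad \<le> card ?Z" "card ?Z \<le> card ends" "card ends \<le> 2"
    using card_bad c by auto
  have tight: "2 \<le> card ?Z" "5 \<le> card (S 0)" "5 \<le> card (S 1)"
    using big card_A_le card_inner good Z le_s[of 0] le_s[of 1] s by linarith+
  have "?Z = ends" using tight(1) Z(2,3) by (intro card_subset_eq) (auto simp: ends_def)
  then have deg_hi: "deg T\<^sub>0 (X (\<nu> + 1 + hi \<nu>)) = 2" by (auto simp: ends_def)
  text \<open>Only the case of four exceptional cards and two full completions remains. The second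
    completion forces the leaf of the first one to sit at an end of the core, where four exceptional
    cards force the degree two.\<close>
  have "3 \<le> card ?R" using le_R[of 0] tight(2) by linarith
  then obtain r\<^sub>2 where r\<^sub>2: "\<And>i. U.d (i + r\<^sub>2) = U.d i" "\<not> c dvd 2 * r\<^sub>2"
    using ex_period_order_ge_3[of c U.d] c_ge_3 by auto
  obtain \<alpha> \<alpha>' where "\<alpha> \<in> S 0" "\<alpha>' \<in> S 1" using tight(2,3) by fastforce
  then have \<alpha>: "\<alpha> \<in> I_good" "t \<alpha> = 0" "\<alpha>' \<in> I_good" "t \<alpha>' = 1" by (auto simp: S_def)
  \<comment> \<open>The second word is read at \<open>J - 1\<close>, so that both words are compared
    with \<open>d\<close> starting at \<open>\<nu>\<close>; its correction marks 1 and -2 thereby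
    move to 2 and -1. Pairing -1 with 2 would make \<open>c\<close> divide 3.\<close>
  have "c dvd (k \<alpha>' + 1) - k \<alpha> \<and> c dvd -1 - 2 \<or> c dvd (k \<alpha>' + 1) - 2 \<and> c dvd -1 - k \<alpha>"
  proof (rule periodic_difference_four_marks[where f = "\<lambda>J. U.d (\<alpha> + e \<alpha> * J)"
        and g = "\<lambda>J. U.d ((\<alpha>' - e \<alpha>') + e \<alpha>' * J)" and r = r\<^sub>2])
    show "U.d (\<alpha> + e \<alpha> * J) - U.d ((\<alpha>' - e \<alpha>') + e \<alpha>' * J) =
        mark c (k \<alpha>' + 1) J + mark c (-1) J - mark c (k \<alpha>) J - mark c 2 J" for J
    proof -
      have "\<alpha>' + e \<alpha>' * (J - 1) = (\<alpha>' - e \<alpha>') + e \<alpha>' * J" by (simp add: algebra_simps)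
      then have "U.d ((\<alpha>' - e \<alpha>') + e \<alpha>' * J) + mark c (k \<alpha>') (J - 1) = completion 1 (J - 1)"
        using word[OF \<alpha>(3), of "J - 1"] \<alpha>(4) by metis
      moreover have "mark c (k \<alpha>') (J - 1) = mark c (k \<alpha>' + 1) J" "mark c 1 (J - 1) = mark c 2 J"
        "mark c (-2) (J - 1) = mark c (-1) J"
        by (simp_all add: mark_def algebra_simps)
      ultimately show ?thesis using word[OF \<alpha>(1), of J] \<alpha>(2) by (simp add: completion_def)
    qed
    show "U.d (\<alpha> + e \<alpha> * (J + r\<^sub>2)) = U.d (\<alpha> + e \<alpha> * J)" for J
      using r\<^sub>2(1) e[OF \<alpha>(1)] by (rule period_reflect)
    show "U.d ((\<alpha>' - e \<alpha>') + e \<alpha>' * (J + r\<^sub>2)) = U.d ((\<alpha>' - e \<alpha>') + e \<alpha>' * J)" for J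
      using r\<^sub>2(1) e[OF \<alpha>(3)] by (rule period_reflect)
  qed (rule r\<^sub>2(2))
  moreover have "\<not> c dvd -1 - 2" using small_not_dvd[of 3] c by simp
  ultimately have k0: "c dvd -1 - k \<alpha>" by blast
  have "3 \<le> d (\<nu> - 1)" using ft[OF \<alpha>(3)] \<alpha>(4) by (simp add: fits_def)
  \<comment> \<open>Now \<open>X (\<nu> - 1)\<close> is itself the upper end of the core, and the
    mark \<open>k \<alpha>\<close> points to it.\<close>
  then have "hi \<nu> = c - 2" by (simp add: hi_def)
  then have "\<nu> + 1 + hi \<nu> - (\<nu> + 0 + k \<alpha>) = (-1 - k \<alpha>) + c" by simp
  moreover have "c dvd (-1 - k \<alpha>) + c" using k0 by (intro dvd_add) auto
  ultimately have "X (\<nu> + 1 + hi \<nu>) = X (\<nu> + 0 + k \<alpha>)" by (simp only: X_eq_iff)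
  moreover have "3 \<le> deg T\<^sub>0 (X (\<nu> + 0 + k \<alpha>))" using ft[OF \<alpha>(1)] \<alpha>(2) by (simp add: fits_def)
  ultimately show False using deg_hi by simp
qed

end

section \<open>The square root and the final case distinction\<close>

text \<open>From \<open>12 <= n\<close> the radicand is at least 25, hence \<open>5 <= s\<close>.
  Squares are compared with \<open>2 * n\<close>, the form in which the periodic case produces
  them.\<close>

lemma floor_sqrt_bound:
  fixes n :: nat
  assumes "12 \<le> n"
  obtains s :: nat where "\<lfloor>sqrt (2 * real n + 1)\<rfloor> = int s" "5 \<le> s" "\<And>m::nat. m * m \<le> 2 * n \<Longrightarrow> m \<le> s"
proof -
  let ?q = "\<lfloor>sqrt (2 * real n + 1)\<rfloor>"
  have le: "int m \<le> ?q" if "m * m \<le> 2 * n + 1" for m :: nat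
  proof -
    have "real (m * m) \<le> real (2 * n + 1)" using that by (simp only: of_nat_le_iff)
    then have "real m \<le> sqrt (2 * real n + 1)" by (intro real_le_rsqrt) (simp add: power2_eq_square)
    then show ?thesis by (simp add: le_floor_iff)
  qed
  have "int 5 \<le> ?q" using assms by (intro le) simp
  then have "5 \<le> nat ?q" "0 \<le> ?q" by linarith+
  moreover have "m \<le> nat ?q" if "m * m \<le> 2 * n" for m using le[of m] that by simp
  ultimately show ?thesis using that[of "nat ?q"] by (metis nat_0_le)
qed

theorem theorem4p22:
  fixes U :: "'a pair_pre_digraph" and T :: "'b pair_pre_digraph" and Up :: "'c pair_pre_digraph"
    and w v :: 'c and c \<nu> n :: nat and x :: "nat \<Rightarrow> 'c"
  assumes "sunshine U" and "card (pverts U) = n"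
    and "caterpillar T" and "card (pverts T) = n"
    and "n \<ge> 12"
    and "common_cards U T \<ge> 5"
    and "sunshine_supercard U T Up w v c x \<nu>"
    and chi_largest: "\<And>(W :: 'c pair_pre_digraph) w' v' c' x' \<nu>'.
          sunshine_supercard U T W w' v' c' x' \<nu>' \<Longrightarrow> chi W w' v' \<le> chi Up w v"
    and "B_U Up w v \<noteq> automorphisms Up"
  shows "int (common_cards U T) \<le> 2 * \<lfloor>sqrt (2 * real n + 1)\<rfloor> + 3"
proof -
  interpret sun_pair Up "int c" "\<lambda>i. x (nat (i mod int c))" w v "int \<nu>"
    by (rule sunshine_supercard_imp_sun_pair) (rule assms)
  have iso: "isomorphic U\<^sub>0 U" "isomorphic T\<^sub>0 T"
    using assms(7) unfolding sunshine_supercard_def by blast+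
  have UT: "pair_graph U" "pair_graph T"
    using assms(1,3) by (simp_all add: sunshine_def caterpillar_def)
  have card_Up: "card (pverts Up) = card (pverts U) + 1"
    using assms(7) by (simp add: sunshine_supercard_def supercard_def)
  then have n: "card (pverts U\<^sub>0) = n"
    using w_facts(1) assms(2) finite_pverts[OF pair_graph] by simp
  obtain A \<beta> where A: "A \<subseteq> pverts U\<^sub>0" "inj_on \<beta> A" "\<beta> ` A \<subseteq> pverts T\<^sub>0" "card A = common_cards U T"
    "\<And>a. a \<in> A \<Longrightarrow> \<exists>f. graph_iso f (delete_vert U\<^sub>0 a) (delete_vert T\<^sub>0 (\<beta> a))"
    by (rule common_cards_matching[OF UT U.pair_graph iso(1) pair_graph_T iso(2)]) (rule that)
  interpret matched_cards Up "int c" "\<lambda>i. x (nat (i mod int c))" w v "int \<nu>" A \<beta>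
    by unfold_locales (use A in auto)
  obtain s where s: "\<lfloor>sqrt (2 * real n + 1)\<rfloor> = int s" "5 \<le> s" "\<And>m::nat. m * m \<le> 2 * n \<Longrightarrow> m \<le> s"
    using floor_sqrt_bound[OF assms(5)] by blast
  have "card A \<le> 2 * s + 3"
  proof (rule ccontr)
    assume big: "\<not> card A \<le> 2 * s + 3"
    \<comment> \<open>All matched vertices of \<open>U\<close> lie on the cycle, so \<open>c\<close>
      is at least the number of common cards.\<close>
    then have c14: "14 \<le> int c" using s(2) card_A_le_c by linarith
    show False
    proof (cases "\<forall>r. (\<forall>i. U.d (i + r) = U.d i) \<longrightarrow> int c dvd r")
      case True
      have "card A_bad \<le> 2"
      proof -
        have "card {z \<in> ends. deg T\<^sub>0 z = 2} \<le> card ends" by (intro card_mono) (auto simp: ends_def)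
        also have "\<dots> \<le> 2" by (simp add: ends_def card_insert_if)
        finally show ?thesis using card_bad c14 by linarith
      qed
      \<comment> \<open>Of at least 14 cards at most two are inner and at most two bad.\<close>
      then have "10 \<le> card A_good" using big s(2) card_A_le card_inner by linarith
      then obtain \<alpha> y r g where
        g: "graph_iso g (delete_vert (moved y) (x (nat (\<alpha> mod int c)))) T\<^sub>0" "U.d \<alpha> = 2" "\<not> int c dvd \<alpha> - y"
        and per: "\<And>i. U.d (i + r) + mark (int c) y (i + r) = U.d i + mark (int c) y i"
        and r: "\<not> int c dvd 2 * r"
        using aperiodic_case True by metis
      show False
      proof (cases "int c dvd y")
        case True
        \<comment> \<open>The common foot is the one \<open>w\<close> already has, so the period
          belongs to the word of \<open>Up\<close> itself.\<close>
        then have "mark (int c) y i = mark (int c) 0 i" for i by (intro mark_cong) simp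
        then have "d (i + r) = d i" for i using per[of i] by (simp add: Ud_eq)
        moreover have "\<not> int c dvd r" using r by auto
        ultimately show False using B_U_eq_automorphisms assms(9) by blast
      next
        case False
        obtain v' c' x' \<nu>' where "sunshine_supercard U T (moved y) w v' c' x' \<nu>'" "3 \<le> chi (moved y) w v'"
          using moved_sunshine_supercard[OF iso card_Up g per r] by blast
        then have "3 \<le> chi Up w v" using chi_largest by (meson order_trans)
        moreover have "chi Up w v \<le> 2" using chi_le_2[OF per r False] .
        ultimately show False by simp
      qed
    next
      case False
      then obtain r where "\<And>i. U.d (i + r) = U.d i" "\<not> int c dvd r" by blast
      then show False using periodic_case[of r s] s(2,3) c14 big n by blast
    qed
  qed
  then show ?thesis using A(4) s(1) by simp
qed

end
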